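(* Suppose that: (III) there exists a continuously differentiable vector function $F(y)=(F_i(y))$, $i=1,\dots,k_0$, such that $\nabla F_i(y)^Tf(y,u)=0$ for all $i=1,\dots,k_0$ and all $(y,u)\in\hat Y\times U$; (IV) there is a constant $\mathcal{T}_0>0$ such that for any $z\in Z$ and any $y^1,y^2\in Y_z$ there exists a control $u(\cdot)$ ($u(t)\in U$) that steers the system $y'(t)=f(y(t),u(t))$ from $y^1$ to $y^2$ in finite time $\mathcal{T}(y^1,y^2,z)\leq\mathcal{T}_0$. Then, for every $z\in Z$, $$\lim_{T\rightarrow\infty}v_T(y_0)=k^*(y_0)=d^*(y_0)=\tilde k^*(z)\qquad\forall\,y_0\in Y_z,$$ where $$\tilde k^*(z)=\min_{\gamma\in\mathcal{W}(z)}\int_{Y_z\times U}k(y,u)\,\gamma(dy,du),\qquad \mathcal{W}(z)=\{\gamma\in W:\ \mathrm{supp}(\gamma)\subset Y_z\times U\}.$$ Also, $$\mathrm{cl}\,W_1(y_0)=W_2(y_0)=\mathcal{W}(z)\qquad\forall\,y_0\in Y_z,$$ where $\mathrm{cl}$ denotes the (weak$^*$) closure.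
   Context: Setting. $U$ is a compact metric space, $f:\mathbb{R}^m\times U\to\mathbb{R}^m$ is continuous in $(y,u)$ and Lipschitz in $y$ uniformly in $u\in U$, and $k:\mathbb{R}^m\times U\to\mathbb{R}$ is continuous. The control system is $y'(t)=f(y(t),u(t))$, $u(t)\in U$, $t\in[0,\infty)$. Controls are measurable functions $u(\cdot):[0,\infty)\to U$, and $y(t,y_0,u)$ is the solution with control $u(\cdot)$ and $y(0)=y_0$. $Y_z=\{y\in\mathbb{R}^m:F(y)=z\}$, $Z$ is a compact subset of $\mathbb{R}^{k_0}$, and $Y=\bigcup_{z\in Z}Y_z$. Here $\hat Y\subset\mathbb{R}^m$ is a sufficiently large compact set; it is assumed that $Y\subset\hat Y$, so that each $Y_z$ ($z\in Z$) and $Y$ are forward invariant for the system. As throughout, $Y$ is a compact set which is the closure of its interior. $\mathcal{U}_T(y_0)$ is the set of controls such that $y(t,y_0,u)\in Y$ for all $t\in[0,T]$, and $v_T(y_0)=\frac1T\inf_{u(\cdot)\in\mathcal{U}_T(y_0)}\int_0^Tk(y(t,y_0,u),u(t))\,dt$. $\mathcal{P}(Y\times U)$ and $\mathcal{M}_+(Y\times U)$ are the Borel probability measures and the finite non-negative Borel measures on $Y\times U$, with the weak$^*$ topology (tested against continuous functions on $Y\times U$); $C^1$ is the space of continuously differentiable functions $\phi:\mathbb{R}^m\to\mathbb{R}$. Define $$W=\Big\{\gamma\in\mathcal{P}(Y\times U):\int_{Y\times U}\nabla\phi(y)^Tf(y,u)\,\gamma(dy,du)=0\ \ \forall\phi\in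 C^1\Big\}.$$ $W_1(y_0)$ is the set of $\gamma\in W$ for which there exists $\xi\in\mathcal{M}_+(Y\times U)$ with $$\int_{Y\times U}(\phi(y)-\phi(y_0))\,\gamma(dy,du)=\int_{Y\times U}\nabla\phi(y)^Tf(y,u)\,\xi(dy,du)\quad\forall\phi\in C^1.$$ $W_2(y_0)$ is the set of $\gamma\in W$ for which there exists a sequence $\xi_l\in\mathcal{M}_+(Y\times U)$, $l=1,2,\dots$, with $$\int_{Y\times U}(\phi(y)-\phi(y_0))\,\gamma(dy,du)=\lim_{l\to\infty}\int_{Y\times U}\nabla\phi(y)^Tf(y,u)\,\xi_l(dy,du)\quad\forall\phi\in C^1.$$ $k^*(y_0)=\inf_{\gamma\in W_1(y_0)}\int_{Y\times U}k(y,u)\,\gamma(dy,du)$. $d^*(y_0)=\sup\mu$, the supremum being over all triplets $(\mu,\psi,\eta)\in\mathbb{R}\times C^1\times C^1$ such that for all $(y,u)\in Y\times U$: $k(y,u)+(\psi(y_0)-\psi(y))+\nabla\eta(y)^Tf(y,u)-\mu\ge0$ and $\nabla\psi(y)^Tf(y,u)\ge0$. *)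

theory Defs
  imports "HOL-Analysis.Analysis" "HOL-Probability.Probability_Measure"
begin

definition grad :: "('a::real_inner \<Rightarrow> real) \<Rightarrow> 'a \<Rightarrow> 'a" where
  "grad \<phi> y = (THE D. GDERIV \<phi> y :> D)"

definition C1 :: "('a::real_inner \<Rightarrow> real) set" where
  "C1 = {\<phi>. (\<forall>y. \<phi> differentiable (at y)) \<and> continuous_on UNIV (grad \<phi>)}"

definition control :: "'u::metric_space set \<Rightarrow> (real \<Rightarrow> 'u) \<Rightarrow> bool" where
  "control U u \<longleftrightarrow> u \<in> lebesgue_on {0..} \<rightarrow>\<^sub>M borel \<and> (\<forall>t\<ge>0. u t \<in> U)"

text \<open>Controls are only measurable, so solutions are meant in the sense of Caratheodory:
  \<open>y\<close> is locally absolutely continuous on \<open>[0, \<infinity>)\<close> and satisfies the equation almost everywhere,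
  i.e. it is the Lebesgue integral of the right-hand side. The values \<open>y t\<close> and \<open>u t\<close> for \<open>t < 0\<close>
  are irrelevant.\<close>

definition solves ::
  "('a::euclidean_space \<Rightarrow> 'u \<Rightarrow> 'a) \<Rightarrow> (real \<Rightarrow> 'u) \<Rightarrow> 'a \<Rightarrow> (real \<Rightarrow> 'a) \<Rightarrow> bool" where
  "solves f u y0 y \<longleftrightarrow>
     (\<forall>t\<ge>0. set_integrable lebesgue {0..t} (\<lambda>s. f (y s) (u s)) \<and>
            y t = y0 + (LINT s:{0..t}|lebesgue. f (y s) (u s)))"

definition forward_invariant ::
  "('a::euclidean_space \<Rightarrow> 'u::metric_space \<Rightarrow> 'a) \<Rightarrow> 'u set \<Rightarrow> 'a set \<Rightarrow> bool" where
  "forward_invariant f U A \<longleftrightarrow>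
     (\<forall>y0\<in>A. \<forall>u y. control U u \<longrightarrow> solves f u y0 y \<longrightarrow> (\<forall>t\<ge>0. y t \<in> A))"

definition steers_within ::
  "('a::euclidean_space \<Rightarrow> 'u::metric_space \<Rightarrow> 'a) \<Rightarrow> 'u set \<Rightarrow> real \<Rightarrow> 'a \<Rightarrow> 'a \<Rightarrow> bool" where
  "steers_within f U T0 y1 y2 \<longleftrightarrow>
     (\<exists>u y \<tau>. control U u \<and> solves f u y1 y \<and> 0 \<le> \<tau> \<and> \<tau> \<le> T0 \<and> y \<tau> = y2)"

text \<open>Pairs of a control that keeps the state in \<open>Y\<close> during \<open>[0, T]\<close> and its trajectory. As \<open>f\<close> is
  Lipschitz in the state, the trajectory on \<open>[0, \<infinity>)\<close> is determined by the control.\<close>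

definition admissible ::
  "('a::euclidean_space \<Rightarrow> 'u::metric_space \<Rightarrow> 'a) \<Rightarrow> 'u set \<Rightarrow> 'a set \<Rightarrow> real \<Rightarrow> 'a
    \<Rightarrow> ((real \<Rightarrow> 'u) \<times> (real \<Rightarrow> 'a)) set" where
  "admissible f U Y T y0 =
     {(u, y). control U u \<and> solves f u y0 y \<and> (\<forall>t\<in>{0..T}. y t \<in> Y)}"

text \<open>All optimal values are extended reals, so that infima and suprema carry their usual meaning
  also over empty or unbounded sets.\<close>

definition value_T ::
  "('a::euclidean_space \<Rightarrow> 'u::metric_space \<Rightarrow> 'a) \<Rightarrow> ('a \<Rightarrow> 'u \<Rightarrow> real) \<Rightarrow> 'u set \<Rightarrow> 'a set
    \<Rightarrow> 'a \<Rightarrow> real \<Rightarrow> ereal" where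
  "value_T f k U Y y0 T =
     ereal (1 / T) *
       (INF (u, y) \<in> admissible f U Y T y0. ereal (LINT t:{0..T}|lebesgue. k (y t) (u t)))"

text \<open>Borel measures on a subset \<open>S\<close> have the trace of the Borel sets on \<open>S\<close> as their
  sigma-algebra; their underlying space is \<open>S\<close>.\<close>

definition finite_measures_on :: "'b::topological_space set \<Rightarrow> 'b measure set" where
  "finite_measures_on S = {\<gamma>. sets \<gamma> = sets (restrict_space borel S) \<and> finite_measure \<gamma>}"

definition prob_measures_on :: "'b::topological_space set \<Rightarrow> 'b measure set" where
  "prob_measures_on S = {\<gamma>. sets \<gamma> = sets (restrict_space borel S) \<and> prob_space \<gamma>}"

definition weak_star_topology :: "'b::topological_space set \<Rightarrow> 'b measure topology" where
  "weak_star_topology S =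
     topology_generated_by
       {{\<gamma> \<in> prob_measures_on S. (\<integral>x. q x \<partial>\<gamma>) \<in> V} | (q :: 'b \<Rightarrow> real) V.
          continuous_on S q \<and> open V}"

lemma topspace_weak_star_topology: "topspace (weak_star_topology S) = prob_measures_on S"
proof -
  have "prob_measures_on S \<in>
      {{\<gamma> \<in> prob_measures_on S. (\<integral>x. q x \<partial>\<gamma>) \<in> V} | (q :: 'a \<Rightarrow> real) V.
          continuous_on S q \<and> open V}"
    by (rule CollectI, rule exI[of _ "\<lambda>_. 0"], rule exI[of _ UNIV]) auto
  then show ?thesis
    unfolding weak_star_topology_def topology_generated_by_topspace by blast
qed

definition supp :: "'b::topological_space measure \<Rightarrow> 'b set" where
  "supp \<gamma> = {x \<in> space \<gamma>. \<forall>N. open N \<longrightarrow> x \<in> N \<longrightarrow> emeasure \<gamma> (N \<inter> space \<gamma>) > 0}"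

definition W ::
  "('a::euclidean_space \<Rightarrow> 'u::metric_space \<Rightarrow> 'a) \<Rightarrow> 'u set \<Rightarrow> 'a set \<Rightarrow> ('a \<times> 'u) measure set" where
  "W f U Y =
     {\<gamma> \<in> prob_measures_on (Y \<times> U). \<forall>\<phi>\<in>C1. (\<integral>(y, u). grad \<phi> y \<bullet> f y u \<partial>\<gamma>) = 0}"

definition W1 ::
  "('a::euclidean_space \<Rightarrow> 'u::metric_space \<Rightarrow> 'a) \<Rightarrow> 'u set \<Rightarrow> 'a set \<Rightarrow> 'a
    \<Rightarrow> ('a \<times> 'u) measure set" where
  "W1 f U Y y0 =
     {\<gamma> \<in> W f U Y. \<exists>\<xi> \<in> finite_measures_on (Y \<times> U). \<forall>\<phi>\<in>C1.
        (\<integral>(y, u). \<phi> y - \<phi> y0 \<partial>\<gamma>) = (\<integral>(y, u). grad \<phi> y \<bullet> f y u \<partial>\<xi>)}"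

definition W2 ::
  "('a::euclidean_space \<Rightarrow> 'u::metric_space \<Rightarrow> 'a) \<Rightarrow> 'u set \<Rightarrow> 'a set \<Rightarrow> 'a
    \<Rightarrow> ('a \<times> 'u) measure set" where
  "W2 f U Y y0 =
     {\<gamma> \<in> W f U Y. \<exists>\<xi> :: nat \<Rightarrow> ('a \<times> 'u) measure.
        (\<forall>l. \<xi> l \<in> finite_measures_on (Y \<times> U)) \<and>
        (\<forall>\<phi>\<in>C1. (\<lambda>l. \<integral>(y, u). grad \<phi> y \<bullet> f y u \<partial>\<xi> l)
                  \<longlonglongrightarrow> (\<integral>(y, u). \<phi> y - \<phi> y0 \<partial>\<gamma>))}"

definition k_star ::
  "('a::euclidean_space \<Rightarrow> 'u::metric_space \<Rightarrow> 'a) \<Rightarrow> ('a \<Rightarrow> 'u \<Rightarrow> real) \<Rightarrow> 'u set \<Rightarrow> 'a set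
    \<Rightarrow> 'a \<Rightarrow> ereal" where
  "k_star f k U Y y0 = (INF \<gamma> \<in> W1 f U Y y0. ereal (\<integral>(y, u). k y u \<partial>\<gamma>))"

definition d_star ::
  "('a::euclidean_space \<Rightarrow> 'u::metric_space \<Rightarrow> 'a) \<Rightarrow> ('a \<Rightarrow> 'u \<Rightarrow> real) \<Rightarrow> 'u set \<Rightarrow> 'a set
    \<Rightarrow> 'a \<Rightarrow> ereal" where
  "d_star f k U Y y0 =
     (SUP (\<mu>, \<psi>, \<eta>) \<in> {(\<mu>, \<psi>, \<eta>). \<psi> \<in> C1 \<and> \<eta> \<in> C1 \<and>
         (\<forall>y\<in>Y. \<forall>u\<in>U. k y u + (\<psi> y0 - \<psi> y) + grad \<eta> y \<bullet> f y u - \<mu> \<ge> 0 \<and>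
                         grad \<psi> y \<bullet> f y u \<ge> 0)}. ereal \<mu>)"

definition level_set :: "('a \<Rightarrow> 'c) \<Rightarrow> 'c \<Rightarrow> 'a set" where
  "level_set F z = {y. F y = z}"

definition W_level ::
  "('a::euclidean_space \<Rightarrow> 'u::metric_space \<Rightarrow> 'a) \<Rightarrow> 'u set \<Rightarrow> 'a set \<Rightarrow> ('a \<Rightarrow> 'c) \<Rightarrow> 'c
    \<Rightarrow> ('a \<times> 'u) measure set" where
  "W_level f U Y F z = {\<gamma> \<in> W f U Y. supp \<gamma> \<subseteq> level_set F z \<times> U}"

definition level_cost ::
  "('a \<Rightarrow> 'u \<Rightarrow> real) \<Rightarrow> 'u set \<Rightarrow> ('a \<Rightarrow> 'c) \<Rightarrow> 'c \<Rightarrow> ('a \<times> 'u) measure \<Rightarrow> real" where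
  "level_cost k U F z \<gamma> = (LINT p:level_set F z \<times> U|\<gamma>. k (fst p) (snd p))"

text \<open>The theorem states separately that this infimum is a minimum.\<close>

definition k_level ::
  "('a::euclidean_space \<Rightarrow> 'u::metric_space \<Rightarrow> 'a) \<Rightarrow> ('a \<Rightarrow> 'u \<Rightarrow> real) \<Rightarrow> 'u set \<Rightarrow> 'a set
    \<Rightarrow> ('a \<Rightarrow> 'c) \<Rightarrow> 'c \<Rightarrow> ereal" where
  "k_level f k U Y F z = (INF \<gamma> \<in> W_level f U Y F z. ereal (level_cost k U F z \<gamma>))"

end

theory Submission
  imports Defs "HOL-Probability.Probability"
begin

text \<open>
  Fix \<open>z\<close>, write \<open>A\<close> for the level set \<open>F = z\<close> and let \<open>y0\<close> lie in \<open>A\<close>. The values and the sets of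
  measures are compared through two facts about an arbitrary continuous cost \<open>q\<close>.

  \<^emph>\<open>Closed trajectories\<close> (\<open>loop_occupation_measure\<close>, \<open>W1_bound_le_cost\<close>). By steering (\<open>IV\<close>), a trajectory from
  \<open>y0\<close> on \<open>[0, T]\<close> can be led back to \<open>y0\<close> in a further time at most \<open>T0\<close>. The normalised occupation
  measure \<open>\<gamma>\<close> of a closed trajectory of length \<open>T\<close> lies in \<open>W\<close>, because the integral of
  \<open>grad \<phi> \<bullet> f\<close> along the trajectory is the increment of \<open>\<phi>\<close>; and it lies in \<open>W1\<close>, because
  the integral of \<open>\<phi> (y t) - \<phi> y0\<close> over \<open>[0, T]\<close> equals that of \<open>(T - s) * (grad \<phi> (y s) \<bullet> f (y s) (u s))\<close>,
  so that the occupation measure with density \<open>(T - s) / T\<close> serves as \<open>\<xi>\<close>. Hence the infimum of the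
  integral of \<open>q\<close> over \<open>W1\<close> is at most the average cost of any trajectory, up to \<open>O(1 / T)\<close>.

  \<^emph>\<open>Smooth subsolutions\<close> (\<open>smooth_subsolution_exists\<close>). If every trajectory that starts in \<open>A\<close> costs at
  least \<open>m\<close> on \<open>[0, T]\<close>, then for each \<open>d > 0\<close> there is \<open>\<eta> \<in> C1\<close> with
  \<open>q + grad \<eta> \<bullet> f \<ge> m / T - d\<close> on \<open>A \<times> U\<close>. Formally \<open>\<eta>\<close> is the average over \<open>s \<in> [0, T]\<close> of the value
  functions \<open>V s\<close> with horizon \<open>s\<close>: averaging the dynamic programming inequality
  \<open>V s \<le> h * q + V (s - h)\<close> (the second value being taken at the state reached after time \<open>h\<close>)
  telescopes to \<open>V T / T \<le> q + grad \<eta> \<bullet> f\<close>. To obtain a genuine \<open>C1\<close> function on the whole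
  space, the value functions are those of an explicit Euler scheme, which are globally Lipschitz, and
  their average is mollified.

  By steering again, the starting point in \<open>A\<close> matters only up to a bounded cost. The two facts
  therefore combine (\<open>dual_function_of_W1_bound\<close>): a lower bound \<open>c\<close> for the integral of \<open>q\<close> on \<open>W1\<close> yields
  functions \<open>\<eta>\<close> with \<open>q + grad \<eta> \<bullet> f \<ge> c - d\<close> on \<open>A \<times> U\<close>. Integrating this against a member of \<open>W\<close>
  concentrated on \<open>A \<times> U\<close>, which annihilates the gradient term, shows that \<open>W1\<close> and the measures of \<open>W\<close>
  concentrated on \<open>A \<times> U\<close> have the same infimum, for \<^emph>\<open>every\<close> continuous \<open>q\<close>.

  For \<open>q = k\<close> this identifies \<open>k_star\<close> with \<open>k_level\<close>, and the average values are squeezed to the same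
  number. The function \<open>G = |F - z|^2\<close> is conserved by \<open>III\<close> and vanishes exactly on \<open>A\<close>. It enters twice:
  \<open>\<psi> = - C * G\<close> with a large \<open>C\<close> extends the inequality for \<open>\<eta>\<close> from \<open>A\<close> to \<open>Y\<close> at no cost and thus
  produces dual feasible triplets; and testing the definition of \<open>W2\<close> with \<open>G\<close> forces its members
  to be concentrated on \<open>A \<times> U\<close>. As \<open>W1\<close> is convex, equality of the infima for all \<open>q\<close> makes \<open>W1\<close> weak-star
  dense in these measures (\<open>W1_approximates\<close>), which gives the statements on \<open>cl W1\<close> and, through countably
  many monomials, on \<open>W2\<close>. The minimum is attained by weak-star sequential compactness of the probability
  measures on \<open>Y \<times> U\<close> (\<open>prob_measures_sequentially_compact\<close>).
\<close>


section \<open>Measurability of pairs and continuously differentiable functions\<close>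

text \<open>The Borel sets of \<open>'a \<times> 'u\<close> may exceed the product sigma-algebra, since \<open>'u\<close> need not be
second countable. On the compact set \<open>U\<close> this does not matter: among pairs with second component in \<open>U\<close>,
every open set is a countable union of rectangles whose second factors are balls from finite nets of \<open>U\<close>.\<close>

lemma borel_measurable_Pair_compact:
  fixes g :: "'s \<Rightarrow> 'a::second_countable_topology" and h :: "'s \<Rightarrow> 'u::metric_space"
  assumes U: "compact U"
    and g: "g \<in> borel_measurable M" and h: "h \<in> borel_measurable M"
    and hU: "\<And>s. s \<in> space M \<Longrightarrow> h s \<in> U"
  shows "(\<lambda>s. (g s, h s)) \<in> borel_measurable M"
proof (rule borel_measurableI)
  fix O' :: "('a \<times> 'u) set"
  assume O: "open O'"
  obtain B :: "'a set set" where B: "countable B" "topological_basis B"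
    using ex_countable_basis by blast
  have "\<exists>D. finite D \<and> D \<subseteq> U \<and> U \<subseteq> (\<Union>d\<in>D. ball d (inverse (real (Suc n))))" for n
  proof (rule compactE_image[OF U, of U "\<lambda>d. ball d (inverse (real (Suc n)))"])
    show "U \<subseteq> (\<Union>d\<in>U. ball d (inverse (real (Suc n))))"
      by (auto simp del: of_nat_Suc intro: bexI)
  qed (simp, blast)
  then obtain D where D: "\<And>n. finite (D n)" "\<And>n. U \<subseteq> (\<Union>d\<in>D n. ball d (inverse (real (Suc n))))"
    by metis
  define I where "I = {(b, n, d). b \<in> B \<and> d \<in> D n \<and> b \<times> ball d (inverse (real (Suc n))) \<subseteq> O'}"
  have "I \<subseteq> B \<times> (SIGMA n:UNIV. D n)"
    unfolding I_def by auto
  moreover have "countable (B \<times> (SIGMA n:UNIV. D n))"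
    using B(1) D(1) by (intro countable_SIGMA) (auto intro: countable_finite)
  ultimately have I: "countable I"
    by (rule countable_subset)
  have "(\<lambda>s. (g s, h s)) -` O' \<inter> space M =
    (\<Union>(b, n, d)\<in>I. (g -` b \<inter> space M) \<inter> (h -` ball d (inverse (real (Suc n))) \<inter> space M))" (is "?l = ?r")
  proof
    show "?r \<subseteq> ?l" unfolding I_def by auto
    show "?l \<subseteq> ?r"
    proof
      fix s assume "s \<in> ?l"
      then have s: "(g s, h s) \<in> O'" "s \<in> space M" by auto
      then obtain G H where GH: "open G" "open H" "g s \<in> G" "h s \<in> H" "G \<times> H \<subseteq> O'"
        using O open_prod_elim by (metis mem_Sigma_iff)
      obtain b where b: "b \<in> B" "g s \<in> b" "b \<subseteq> G"
        using B(2) GH topological_basisE by blast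
      obtain e where e: "e > 0" "ball (h s) e \<subseteq> H"
        using GH open_contains_ball by blast
      obtain n where n: "inverse (real (Suc n)) < e / 2"
        using reals_Archimedean[of "e/2"] e by auto
      obtain d where d: "d \<in> D n" "h s \<in> ball d (inverse (real (Suc n)))"
        using D(2)[of n] hU[OF s(2)] by auto
      have "ball d (inverse (real (Suc n))) \<subseteq> ball (h s) e"
      proof
        fix x assume "x \<in> ball d (inverse (real (Suc n)))"
        then show "x \<in> ball (h s) e"
          using d n dist_triangle[of "h s" x d] by (auto simp: dist_commute)
      qed
      then have "(b, n, d) \<in> I"
        using b d e GH unfolding I_def by blast
      then show "s \<in> ?r"
        using b d s by force
    qed
  qed
  also have "\<dots> \<in> sets M"
  proof (rule sets.countable_UN''[OF I], clarsimp simp: I_def simp del: of_nat_Suc)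
    fix b n d assume "b \<in> B"
    then have "open b" using B(2) topological_basis_open by blast
    then show "g -` b \<inter> space M \<inter> (h -` ball d (inverse (real (Suc n))) \<inter> space M) \<in> sets M"
      using g h by (intro sets.Int measurable_sets[where A=borel]) auto
  qed
  finally show "(\<lambda>s. (g s, h s)) -` O' \<inter> space M \<in> sets M" .
qed

lemma grad_eqI:
  assumes "(\<phi> has_derivative (\<lambda>h. D \<bullet> h)) (at y)"
  shows "grad \<phi> y = D"
  unfolding grad_def
proof (rule the_equality)
  show "GDERIV \<phi> y :> D"
    using assms unfolding gderiv_def by (simp add: inner_commute)
  fix D' assume "GDERIV \<phi> y :> D'"
  then have "(\<phi> has_derivative (\<lambda>h. D' \<bullet> h)) (at y)"
    unfolding gderiv_def by (simp add: inner_commute)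
  then have "(\<lambda>h. D' \<bullet> h) = (\<lambda>h. D \<bullet> h)"
    using assms has_derivative_unique by blast
  then have "(D' - D) \<bullet> (D' - D) = 0"
    by (metis inner_diff_left right_minus_eq)
  then show "D' = D" by simp
qed

lemma has_derivative_grad:
  fixes \<phi> :: "'a::euclidean_space \<Rightarrow> real"
  assumes "\<phi> differentiable (at y)"
  shows "(\<phi> has_derivative (\<lambda>h. grad \<phi> y \<bullet> h)) (at y)"
proof -
  obtain D where D: "(\<phi> has_derivative D) (at y)"
    using assms unfolding differentiable_def by auto
  then have lin: "linear D"
    using has_derivative_linear by blast
  define d where "d = (\<Sum>b\<in>Basis. D b *\<^sub>R b)"
  have "D h = d \<bullet> h" for h
  proof -
    have "D h = D (\<Sum>b\<in>Basis. (h \<bullet> b) *\<^sub>R b)" by (simp add: euclidean_representation)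
    also have "\<dots> = (\<Sum>b\<in>Basis. (h \<bullet> b) * D b)"
      using lin by (simp add: linear_sum linear_scale)
    finally show ?thesis
      unfolding d_def by (simp add: inner_sum_right inner_commute[of _ h] mult.commute)
  qed
  then have "D = (\<lambda>h. d \<bullet> h)"
    by (rule ext)
  with D have "(\<phi> has_derivative (\<lambda>h. d \<bullet> h)) (at y)"
    by simp
  then show ?thesis
    by (simp add: grad_eqI)
qed

lemma C1_has_derivative:
  fixes \<phi> :: "'a::euclidean_space \<Rightarrow> real"
  assumes "\<phi> \<in> C1"
  shows "(\<phi> has_derivative (\<lambda>h. grad \<phi> y \<bullet> h)) (at y)"
  using assms has_derivative_grad unfolding C1_def by blast

lemma C1_I:
  assumes d: "\<And>y. (\<phi> has_derivative (\<lambda>h. g y \<bullet> h)) (at y)" and "continuous_on UNIV g"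
  shows "\<phi> \<in> C1" "grad \<phi> = g"
proof -
  show "grad \<phi> = g" using grad_eqI[OF d] by auto
  then show "\<phi> \<in> C1" using assms unfolding C1_def differentiable_def by auto
qed

lemma C1_continuous:
  fixes \<phi> :: "'a::euclidean_space \<Rightarrow> real"
  assumes "\<phi> \<in> C1" shows "continuous_on S \<phi>"
  by (meson C1_has_derivative assms continuous_at_imp_continuous_on has_derivative_continuous)

lemma C1_grad_continuous:
  assumes "\<phi> \<in> C1" shows "continuous_on S (grad \<phi>)"
  using assms unfolding C1_def by (auto intro: continuous_on_subset)

lemma C1_scale:
  fixes \<phi> :: "'a::euclidean_space \<Rightarrow> real"
  assumes "\<phi> \<in> C1"
  shows "(\<lambda>y. c * \<phi> y) \<in> C1" "grad (\<lambda>y. c * \<phi> y) = (\<lambda>y. c *\<^sub>R grad \<phi> y)"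
proof -
  have "((\<lambda>y. c * \<phi> y) has_derivative (\<lambda>h. (c *\<^sub>R grad \<phi> y) \<bullet> h)) (at y)" for y
    using C1_has_derivative[OF assms, of y] by (auto intro!: derivative_eq_intros)
  moreover have "continuous_on UNIV (\<lambda>y. c *\<^sub>R grad \<phi> y)"
    by (intro continuous_intros C1_grad_continuous assms)
  ultimately show "(\<lambda>y. c * \<phi> y) \<in> C1" "grad (\<lambda>y. c * \<phi> y) = (\<lambda>y. c *\<^sub>R grad \<phi> y)"
    using C1_I[of "\<lambda>y. c * \<phi> y" "\<lambda>y. c *\<^sub>R grad \<phi> y"] by auto
qed

text \<open>The squared distance of \<open>F\<close> from \<open>z\<close>; if \<open>F\<close> is conserved by the system, so is this function,
by the formula for its gradient.\<close>

lemma C1_dist_square: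
  fixes F :: "'a::euclidean_space \<Rightarrow> real ^ 'k"
  assumes "\<forall>i. (\<lambda>y. F y $ i) \<in> C1"
  shows "(\<lambda>y. \<Sum>i\<in>UNIV. (F y $ i - z $ i)\<^sup>2) \<in> C1"
    and "grad (\<lambda>y. \<Sum>i\<in>UNIV. (F y $ i - z $ i)\<^sup>2) =
         (\<lambda>y. \<Sum>i\<in>UNIV. (2 * (F y $ i - z $ i)) *\<^sub>R grad (\<lambda>y. F y $ i) y)"
proof -
  have "((\<lambda>y. \<Sum>i\<in>UNIV. (F y $ i - z $ i)\<^sup>2) has_derivative
     (\<lambda>h. (\<Sum>i\<in>UNIV. (2 * (F y $ i - z $ i)) *\<^sub>R grad (\<lambda>y. F y $ i) y) \<bullet> h)) (at y)" for y
  proof -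
    have "((\<lambda>y. F y $ i) has_derivative (\<lambda>h. grad (\<lambda>y. F y $ i) y \<bullet> h)) (at y)" for i
      using assms C1_has_derivative by blast
    then show ?thesis
      by (auto intro!: derivative_eq_intros sum.cong simp: inner_sum_left algebra_simps)
  qed
  moreover have "continuous_on UNIV (\<lambda>y. \<Sum>i\<in>UNIV. (2 * (F y $ i - z $ i)) *\<^sub>R grad (\<lambda>y. F y $ i) y)"
    using assms by (intro continuous_intros C1_grad_continuous C1_continuous) auto
  ultimately show "(\<lambda>y. \<Sum>i\<in>UNIV. (F y $ i - z $ i)\<^sup>2) \<in> C1"
    and "grad (\<lambda>y. \<Sum>i\<in>UNIV. (F y $ i - z $ i)\<^sup>2) =
         (\<lambda>y. \<Sum>i\<in>UNIV. (2 * (F y $ i - z $ i)) *\<^sub>R grad (\<lambda>y. F y $ i) y)"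
    using C1_I[of "\<lambda>y. \<Sum>i\<in>UNIV. (F y $ i - z $ i)\<^sup>2"
        "\<lambda>y. \<Sum>i\<in>UNIV. (2 * (F y $ i - z $ i)) *\<^sub>R grad (\<lambda>y. F y $ i) y"] by auto
qed


section \<open>Trajectories\<close>

lemma solves_iff:
  fixes f :: "'a::euclidean_space \<Rightarrow> 'u \<Rightarrow> 'a"
  shows "solves f u y0 y \<longleftrightarrow>
    (\<forall>t\<ge>0. (\<lambda>s. f (y s) (u s)) absolutely_integrable_on {0..t} \<and>
            y t = y0 + integral {0..t} (\<lambda>s. f (y s) (u s)))"
  unfolding solves_def by (auto simp: set_lebesgue_integral_eq_integral(2))

lemma solves_continuous:
  fixes f :: "'a::euclidean_space \<Rightarrow> 'u \<Rightarrow> 'a"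
  assumes "solves f u y0 y" shows "continuous_on {0..T} y"
proof (cases "T \<ge> 0")
  case True
  then have "continuous_on {0..T} (\<lambda>t. y0 + integral {0..t} (\<lambda>s. f (y s) (u s)))"
    using assms unfolding solves_iff
    by (intro continuous_intros indefinite_integral_continuous_1)
      (auto simp: set_lebesgue_integral_eq_integral(1))
  then show ?thesis
    using assms unfolding solves_iff by (subst continuous_on_cong[OF refl]) auto
qed auto

lemma norm_integral_diff_le:
  fixes H :: "real \<Rightarrow> 'a::euclidean_space"
  assumes H: "H absolutely_integrable_on {0..T}" and s: "s \<in> {0..T}" and t: "t \<in> {0..T}"
    and B: "\<And>r. r \<in> {min s t..max s t} \<Longrightarrow> norm (H r) \<le> B"
  shows "norm (integral {0..s} H - integral {0..t} H) \<le> B * \<bar>s - t\<bar>"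
proof -
  have *: "norm (integral {0..b} H - integral {0..a} H) \<le> B * (b - a)"
    if "0 \<le> a" "a \<le> b" "b \<le> T" "\<And>r. r \<in> {a..b} \<Longrightarrow> norm (H r) \<le> B" for a b
  proof -
    have int: "H integrable_on {0..T}"
      using H set_lebesgue_integral_eq_integral(1) by blast
    then have int': "H integrable_on {0..b}" "H integrable_on {a..b}"
      using that by (auto intro: integrable_subinterval_real)
    have "integral {0..b} H - integral {0..a} H = integral {a..b} H"
      using Henstock_Kurzweil_Integration.integral_combine[OF that(1,2) int'(1)] by (auto simp: algebra_simps)
    moreover have "norm (integral {a..b} H) \<le> integral {a..b} (\<lambda>r. B)"
      using int' that by (intro integral_norm_bound_integral) auto
    ultimately show ?thesis using that by (simp add: mult.commute)
  qed
  show ?thesis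
  proof (cases "t \<le> s")
    case True then show ?thesis using *[of t s] s t B by auto
  next
    case False
    then have "norm (integral {0..t} H - integral {0..s} H) \<le> B * (t - s)"
      using *[of s t] s t B by auto
    then show ?thesis using False by (simp add: norm_minus_commute)
  qed
qed

text \<open>The curve \<open>y\<close> is only Lipschitz, so the classical chain rule does not apply pointwise. The difference between
\<open>\<phi> (y t)\<close> and the integral up to \<open>t\<close> nevertheless has derivative zero at \<^emph>\<open>every\<close> \<open>t\<close>: on a short interval
at \<open>t\<close> the gradient may be frozen at \<open>y t\<close> with error \<open>o(h)\<close> uniformly, and with a frozen gradient both
terms change by the same amount.\<close>

lemma chain_rule_integral:
  fixes \<phi> :: "'a::euclidean_space \<Rightarrow> real" and g :: "real \<Rightarrow> 'a"
  assumes \<phi>: "\<phi> \<in> C1" and T: "T \<ge> 0"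
    and g: "g absolutely_integrable_on {0..T}" and M: "\<And>s. s \<in> {0..T} \<Longrightarrow> norm (g s) \<le> M"
    and y: "\<And>t. t \<in> {0..T} \<Longrightarrow> y t = y0 + integral {0..t} g"
  shows "(\<lambda>s. grad \<phi> (y s) \<bullet> g s) absolutely_integrable_on {0..T}"
    and "integral {0..T} (\<lambda>s. grad \<phi> (y s) \<bullet> g s) = \<phi> (y T) - \<phi> y0"
proof -
  let ?G = "\<lambda>s. grad \<phi> (y s) \<bullet> g s"
  have M0: "M \<ge> 0" using order_trans[OF norm_ge_zero M[of 0]] T by simp
  have ylip: "norm (y s - y t) \<le> M * \<bar>s - t\<bar>" if "s \<in> {0..T}" "t \<in> {0..T}" for s t
  proof -
    have "norm (integral {0..s} g - integral {0..t} g) \<le> M * \<bar>s - t\<bar>"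
      by (rule norm_integral_diff_le[OF g that]) (use M that in \<open>auto simp: min_def max_def split: if_splits\<close>)
    then show ?thesis using that y[of s] y[of t] by simp
  qed
  have ycont: "continuous_on {0..T} y"
  proof (rule continuous_onI)
    fix t e :: real assume "t \<in> {0..T}" "e > 0"
    show "\<exists>d>0. \<forall>s\<in>{0..T}. dist s t < d \<longrightarrow> dist (y s) (y t) \<le> e"
    proof (intro exI[of _ "e / (M + 1)"] conjI ballI impI)
      fix s assume "s \<in> {0..T}" "dist s t < e / (M + 1)"
      then have "\<bar>s - t\<bar> * (M + 1) < e" using M0 by (simp add: dist_real_def field_simps)
      moreover have "norm (y s - y t) \<le> M * \<bar>s - t\<bar>" using ylip \<open>s \<in> _\<close> \<open>t \<in> _\<close> by blast
      ultimately show "dist (y s) (y t) \<le> e"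
        by (smt (verit) dist_norm mult.commute mult_left_mono abs_ge_zero)
    qed (use \<open>e > 0\<close> M0 in auto)
  qed
  have gradc: "continuous_on {0..T} (\<lambda>s. grad \<phi> (y s))"
    by (rule continuous_on_compose2[OF C1_grad_continuous[OF \<phi>, of UNIV] ycont]) auto
  obtain C where C: "\<And>s. s \<in> {0..T} \<Longrightarrow> norm (grad \<phi> (y s)) \<le> C"
    using compact_imp_bounded[OF compact_continuous_image[OF gradc compact_Icc]]
    unfolding bounded_iff by blast
  show G: "?G absolutely_integrable_on {0..T}"
  proof (rule measurable_bounded_by_integrable_imp_absolutely_integrable[where g="\<lambda>_. C * M"])
    show "?G \<in> borel_measurable (lebesgue_on {0..T})"
      using absolutely_integrable_imp_borel_measurable[OF g]
        continuous_imp_measurable_on_sets_lebesgue[OF gradc] by (intro borel_measurable_inner) auto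
    show "norm (?G x) \<le> C * M" if "x \<in> {0..T}" for x
      using C[OF that] M[OF that] Cauchy_Schwarz_ineq2[of "grad \<phi> (y x)" "g x"]
      by (smt (verit) mult_mono norm_ge_zero real_norm_def)
  qed auto
  define \<psi> where "\<psi> t = \<phi> (y t) - integral {0..t} ?G" for t
  have "(\<psi> has_derivative (\<lambda>h. 0)) (at t within {0..T})" if t: "t \<in> {0..T}" for t
  proof (rule has_derivativeI_sandwich[of 1 _ _ _ _ "\<lambda>s. norm (\<psi> s - \<psi> t) / norm (s - t)"])
    show "((\<lambda>s. norm (\<psi> s - \<psi> t) / norm (s - t)) \<longlongrightarrow> 0) (at t within {0..T})"
    proof (rule tendstoI)
      fix e :: real assume e: "e > 0"
      \<comment> \<open>both error terms below are at most \<open>e' * M * |s - t|\<close>\<close>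
      define e' where "e' = e / (2 * M + 2)"
      have e': "e' > 0" using e M0 by (simp add: e'_def)
      have "e' * (2 * M) < e" using e M0 by (simp add: e'_def field_simps)
      have "continuous (at t within {0..T}) (\<lambda>s. grad \<phi> (y s))"
        using gradc t by (simp add: continuous_on_eq_continuous_within)
      then obtain d1 where d1: "d1 > 0"
        "\<And>s. s \<in> {0..T} \<Longrightarrow> dist s t < d1 \<Longrightarrow> dist (grad \<phi> (y s)) (grad \<phi> (y t)) < e'"
        using e' unfolding continuous_within_eps_delta by blast
      obtain d2 where d2: "d2 > 0" "\<And>v. norm (v - y t) < d2 \<Longrightarrow>
          norm (\<phi> v - \<phi> (y t) - grad \<phi> (y t) \<bullet> (v - y t)) \<le> e' * norm (v - y t)"
        using C1_has_derivative[OF \<phi>, of "y t"] e' unfolding has_derivative_at_alt by blast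
      define d where "d = min d1 (d2 / (M + 1))"
      have "d > 0" using d1 d2 M0 by (simp add: d_def)
      have "norm (\<psi> s - \<psi> t) / norm (s - t) < e" if s: "s \<in> {0..T}" "s \<noteq> t" "dist s t < d" for s
      proof -
        have yst: "norm (y s - y t) \<le> M * \<bar>s - t\<bar>" using ylip s t by blast
        have "(M + 1) * \<bar>s - t\<bar> < d2" using s M0 by (simp add: d_def dist_real_def field_simps)
        then have "norm (y s - y t) < d2" using yst by (smt (verit) mult_right_mono abs_ge_zero)
        then have 1: "\<bar>\<phi> (y s) - \<phi> (y t) - grad \<phi> (y t) \<bullet> (y s - y t)\<bar> \<le> e' * norm (y s - y t)"
          using d2(2)[of "y s"] by simp
        \<comment> \<open>the error made by freezing the gradient at time \<open>t\<close>\<close>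
        let ?H = "\<lambda>r. (grad \<phi> (y t) - grad \<phi> (y r)) \<bullet> g r"
        have H1: "(\<lambda>r. grad \<phi> (y t) \<bullet> g r) absolutely_integrable_on {0..T}"
          using absolutely_integrable_linear[OF g bounded_linear_inner_right, of "grad \<phi> (y t)"]
          by (simp add: o_def)
        have H: "?H absolutely_integrable_on {0..T}"
          using set_integral_diff(1)[OF H1 G] by (simp add: inner_diff_left)
        have IH: "integral {0..r} ?H = grad \<phi> (y t) \<bullet> integral {0..r} g - integral {0..r} ?G"
          if r: "r \<in> {0..T}" for r
        proof -
          have i: "g integrable_on {0..r}" "?G integrable_on {0..r}"
            using r integrable_subinterval_real[OF set_lebesgue_integral_eq_integral(1)[OF g], of 0 r]
              integrable_subinterval_real[OF set_lebesgue_integral_eq_integral(1)[OF G], of 0 r]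
            by auto
          have "integral {0..r} (\<lambda>s. grad \<phi> (y t) \<bullet> g s) = grad \<phi> (y t) \<bullet> integral {0..r} g"
            using integral_linear[OF i(1) bounded_linear_inner_right] by (simp add: o_def)
          moreover have "(\<lambda>s. grad \<phi> (y t) \<bullet> g s) integrable_on {0..r}"
            using integrable_linear[OF i(1) bounded_linear_inner_right] by (simp add: o_def)
          ultimately show ?thesis
            using i by (simp add: inner_diff_left Henstock_Kurzweil_Integration.integral_diff)
        qed
        have 2: "\<bar>integral {0..s} ?H - integral {0..t} ?H\<bar> \<le> e' * M * \<bar>s - t\<bar>"
        proof (rule norm_integral_diff_le[OF H s(1) t, unfolded real_norm_def])
          fix r assume r: "r \<in> {min s t..max s t}"
          then have "r \<in> {0..T}" "dist r t < d1"
            using s t by (auto simp: d_def dist_real_def min_def max_def split: if_splits)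
          then have "norm (grad \<phi> (y t) - grad \<phi> (y r)) \<le> e'" "norm (g r) \<le> M"
            using d1(2)[of r] M by (auto simp: dist_norm norm_minus_commute)
          then show "\<bar>?H r\<bar> \<le> e' * M"
            using Cauchy_Schwarz_ineq2[of "grad \<phi> (y t) - grad \<phi> (y r)" "g r"] e'
            by (smt (verit) mult_mono norm_ge_zero)
        qed
        have "\<psi> s - \<psi> t = (\<phi> (y s) - \<phi> (y t) - grad \<phi> (y t) \<bullet> (y s - y t)) +
            (integral {0..s} ?H - integral {0..t} ?H)"
          unfolding \<psi>_def IH[OF s(1)] IH[OF t] using y[OF s(1)] y[OF t] by (simp add: inner_diff_right inner_add_right)
        then have "\<bar>\<psi> s - \<psi> t\<bar> \<le> e' * (M * \<bar>s - t\<bar>) + e' * M * \<bar>s - t\<bar>"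
          using 1 2 yst e' mult_left_mono[OF yst, of e'] by linarith
        also have "\<dots> = e' * (2 * M) * \<bar>s - t\<bar>" by (simp add: algebra_simps)
        also have "\<dots> < e * \<bar>s - t\<bar>" using \<open>e' * (2 * M) < e\<close> s by simp
        finally show ?thesis using s by (simp add: divide_less_eq)
      qed
      then show "\<forall>\<^sub>F s in at t within {0..T}. dist (norm (\<psi> s - \<psi> t) / norm (s - t)) 0 < e"
        unfolding eventually_at using \<open>d > 0\<close> by (auto intro!: exI[of _ d])
    qed
  qed auto
  then have "\<psi> T = \<psi> 0"
    using has_derivative_zero_unique[of "{0..T}" \<psi> 0 "T"] T by auto
  then show "integral {0..T} ?G = \<phi> (y T) - \<phi> y0"
    using y[of 0] T by (simp add: \<psi>_def)
qed

text \<open>Used both for the velocity and for the running cost of a trajectory that follows one control up to time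
\<open>\<tau>\<close> and another one afterwards.\<close>

lemma concat_integral:
  fixes g1 g2 :: "real \<Rightarrow> 'b::euclidean_space"
  assumes g1: "g1 absolutely_integrable_on {0..\<tau>}" and g2: "g2 absolutely_integrable_on {0..s}"
    and "0 \<le> \<tau>" "0 \<le> s" and g: "\<And>t. g t = (if t < \<tau> then g1 t else g2 (t - \<tau>))"
  shows "g absolutely_integrable_on {0..\<tau> + s}"
    and "integral {0..\<tau> + s} g = integral {0..\<tau>} g1 + integral {0..s} g2"
proof -
  have a: "g absolutely_integrable_on {0..\<tau>}"
    by (rule absolutely_integrable_spike[OF g1, of "{\<tau>}"]) (auto simp: g)
  have ia: "integral {0..\<tau>} g = integral {0..\<tau>} g1"
    by (rule integral_spike[of "{\<tau>}"]) (auto simp: g)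
  have sh: "(\<lambda>t. g2 (t - \<tau>)) absolutely_integrable_on {\<tau>..\<tau> + s}"
    using g2 integrable_on_shift_Icc_real[of g2 "-\<tau>" \<tau> "\<tau> + s"]
      integrable_on_shift_Icc_real[of "\<lambda>t. norm (g2 t)" "-\<tau>" \<tau> "\<tau> + s"]
    unfolding absolutely_integrable_on_def by (simp add: o_def)
  have b: "g absolutely_integrable_on {\<tau>..\<tau> + s}"
    by (rule absolutely_integrable_spike[OF sh, of "{}"]) (auto simp: g)
  have ib: "integral {\<tau>..\<tau> + s} g = integral {0..s} g2"
  proof -
    have "integral {\<tau>..\<tau> + s} g = integral {\<tau>..\<tau> + s} (\<lambda>t. g2 (t - \<tau>))"
      by (rule integral_cong) (auto simp: g)
    also have "\<dots> = integral {0..s} g2"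
      using integral_shift_Icc_real[of \<tau> "\<tau> + s" g2 "-\<tau>"] by (simp add: o_def add.commute)
    finally show ?thesis .
  qed
  show c: "g absolutely_integrable_on {0..\<tau> + s}"
    by (rule absolutely_integrable_on_combine[OF a b]) (use assms in auto)
  show "integral {0..\<tau> + s} g = integral {0..\<tau>} g1 + integral {0..s} g2"
    using Henstock_Kurzweil_Integration.integral_combine[of 0 \<tau> "\<tau> + s" g] c assms ia ib
      set_lebesgue_integral_eq_integral(1)[OF c] by auto
qed

definition concat_at :: "real \<Rightarrow> (real \<Rightarrow> 'b) \<Rightarrow> (real \<Rightarrow> 'b) \<Rightarrow> real \<Rightarrow> 'b" where
  "concat_at \<tau> p q = (\<lambda>t. if t < \<tau> then p t else q (t - \<tau>))"

lemma solves_concat: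
  fixes f :: "'a::euclidean_space \<Rightarrow> 'u \<Rightarrow> 'a"
  assumes 1: "solves f u1 y0 y1" and 2: "solves f u2 (y1 \<tau>) y2" and \<tau>: "\<tau> \<ge> 0"
  shows "solves f (concat_at \<tau> u1 u2) y0 (concat_at \<tau> y1 y2)"
  unfolding solves_iff
proof (intro allI impI)
  fix t :: real assume t: "t \<ge> 0"
  let ?g = "\<lambda>s. f (concat_at \<tau> y1 y2 s) (concat_at \<tau> u1 u2 s)"
  have g: "?g s = (if s < \<tau> then f (y1 s) (u1 s) else f (y2 (s - \<tau>)) (u2 (s - \<tau>)))" for s
    by (simp add: concat_at_def)
  show "?g absolutely_integrable_on {0..t} \<and> concat_at \<tau> y1 y2 t = y0 + integral {0..t} ?g"
  proof (cases "t < \<tau>")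
    case True
    have h: "(\<lambda>s. f (y1 s) (u1 s)) absolutely_integrable_on {0..t}" using 1 t unfolding solves_iff by blast
    have "?g absolutely_integrable_on {0..t}"
      by (rule absolutely_integrable_spike[OF h, of "{}"]) (use True in \<open>auto simp: concat_at_def\<close>)
    moreover have "integral {0..t} ?g = integral {0..t} (\<lambda>s. f (y1 s) (u1 s))"
      by (rule integral_cong) (use True in \<open>auto simp: concat_at_def\<close>)
    ultimately show ?thesis
      using 1 t True unfolding solves_iff by (simp add: concat_at_def)
  next
    case False
    define s where "s = t - \<tau>"
    have s: "s \<ge> 0" "t = \<tau> + s" using False by (auto simp: s_def)
    have h: "(\<lambda>s. f (y1 s) (u1 s)) absolutely_integrable_on {0..\<tau>}" using 1 \<tau> unfolding solves_iff by blast
    have h2: "(\<lambda>s. f (y2 s) (u2 s)) absolutely_integrable_on {0..s}" using 2 s unfolding solves_iff by blast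
    have "y1 \<tau> = y0 + integral {0..\<tau>} (\<lambda>s. f (y1 s) (u1 s))" using 1 \<tau> unfolding solves_iff by blast
    moreover have "y2 s = y1 \<tau> + integral {0..s} (\<lambda>s. f (y2 s) (u2 s))" using 2 s unfolding solves_iff by blast
    ultimately show ?thesis
      using concat_integral[OF h h2 \<tau> s(1) g] s by (simp add: concat_at_def)
  qed
qed

lemma lebesgue_measurable_shift: "(\<lambda>t::real. t - \<tau>) \<in> lebesgue \<rightarrow>\<^sub>M lebesgue"
  using lebesgue_affine_measurable[of "\<lambda>_. 1" "-\<tau>"] by (simp add: Basis_real_def)

lemma control_nonempty: "control U u \<Longrightarrow> u 0 \<in> U"
  by (auto simp: control_def)

text \<open>A control is measurable on \<open>[0, \<infinity>)\<close> only; it is first extended to the line by a constant, so that it can be shifted.\<close>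

lemma control_concat:
  assumes 1: "control U u1" and 2: "control U u2" and \<tau>: "\<tau> \<ge> 0"
  shows "control U (concat_at \<tau> u1 u2)"
proof -
  obtain c where c: "c \<in> U" using 1 control_nonempty by blast
  define w where "w i = (\<lambda>t. if t \<in> {0::real..} then (i::real\<Rightarrow>_) t else c)" for i
  have iff: "i \<in> lebesgue_on {0..} \<rightarrow>\<^sub>M borel \<longleftrightarrow> w i \<in> lebesgue \<rightarrow>\<^sub>M borel" for i
    unfolding w_def by (rule measurable_restrict_space_iff) auto
  have w: "w u1 \<in> lebesgue \<rightarrow>\<^sub>M borel" "w u2 \<in> lebesgue \<rightarrow>\<^sub>M borel"
    using 1 2 iff by (auto simp: control_def)
  have "(\<lambda>t. w u2 (t - \<tau>)) \<in> lebesgue \<rightarrow>\<^sub>M borel"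
    using measurable_comp[OF lebesgue_measurable_shift w(2)] by (simp add: o_def)
  then have "(\<lambda>t. if t < \<tau> then w u1 t else w u2 (t - \<tau>)) \<in> lebesgue \<rightarrow>\<^sub>M borel"
    using w by (intro measurable_If) auto
  also have "(\<lambda>t. if t < \<tau> then w u1 t else w u2 (t - \<tau>)) = w (concat_at \<tau> u1 u2)"
    using \<tau> by (auto simp: w_def concat_at_def fun_eq_iff)
  finally show ?thesis
    using iff 1 2 by (auto simp: control_def concat_at_def)
qed


text \<open>Picard iteration. The weight \<open>exp (2 * L * t)\<close> makes the integral operator a contraction with factor \<open>1/2\<close>
on the whole half-line, so the iterates converge uniformly on every \<open>[0, T]\<close>. Constant controls suffice, because
longer trajectories are composed by concatenation.\<close>

lemma autonomous_solution_exists: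
  fixes g :: "'a::euclidean_space \<Rightarrow> 'a"
  assumes lip: "\<And>x y. norm (g x - g y) \<le> L * norm (x - y)" and L: "L > 0"
    and gc: "continuous_on UNIV g"
  shows "\<exists>y :: real \<Rightarrow> 'a. \<forall>t\<ge>0. continuous_on {0..t} y \<and> y t = x0 + integral {0..t} (\<lambda>s. g (y s))"
proof -
  define p where "p = rec_nat (\<lambda>t::real. x0) (\<lambda>_ q t. x0 + integral {0..t} (\<lambda>s. g (q s)))"
  have p0: "p 0 = (\<lambda>t. x0)" and pS: "p (Suc n) = (\<lambda>t. x0 + integral {0..t} (\<lambda>s. g (p n s)))" for n
    by (simp_all add: p_def)
  have pc: "continuous_on {0..T} (p n)" for n T
  proof (induction n)
    case (Suc n)
    have "continuous_on {0..T} (\<lambda>s. g (p n s))"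
      by (rule continuous_on_compose2[OF gc Suc]) auto
    then show ?case
      unfolding pS by (intro continuous_intros indefinite_integral_continuous_1 integrable_continuous_real)
  qed (simp add: p0)
  have gpc: "continuous_on {0..T} (\<lambda>s. g (p n s))" for n T
    by (rule continuous_on_compose2[OF gc pc]) auto
  define B where "B = norm (g x0) / (2 * L)"
  have B: "B \<ge> 0" using L by (simp add: B_def)
  have step: "norm (p (Suc n) t - p n t) \<le> B * (1/2) ^ n * exp (2 * L * t)" if "t \<ge> 0" for n t
    using that
  proof (induction n arbitrary: t)
    case 0
    have "2 * L * t \<le> exp (2 * L * t)"
      using exp_ge_add_one_self[of "2 * L * t"] by linarith
    then have "norm (g x0) * (2 * L * t) \<le> norm (g x0) * exp (2 * L * t)"
      by (intro mult_left_mono) auto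
    then have "norm (t *\<^sub>R g x0) \<le> B * exp (2 * L * t)"
      using 0 L by (simp add: B_def field_simps)
    then show ?case using 0 by (simp add: pS p0)
  next
    case (Suc n)
    have e: "((\<lambda>s. L * (B * (1/2) ^ n * exp (2 * L * s))) has_integral
        (B * (1/2) ^ Suc n * exp (2 * L * t) - B * (1/2) ^ Suc n * exp (2 * L * 0))) {0..t}"
      using Suc.prems
      by (intro fundamental_theorem_of_calculus)
        (auto intro!: derivative_eq_intros simp: has_real_derivative_iff_has_vector_derivative[symmetric])
    have "norm (p (Suc (Suc n)) t - p (Suc n) t) =
        norm (integral {0..t} (\<lambda>s. g (p (Suc n) s) - g (p n s)))"
      unfolding pS[of "Suc n"] pS[of n]
      using gpc[of t "Suc n"] gpc[of t n]
      by (simp add: Henstock_Kurzweil_Integration.integral_diff integrable_continuous_real pS)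
    also have "\<dots> \<le> integral {0..t} (\<lambda>s. L * (B * (1/2) ^ n * exp (2 * L * s)))"
    proof (rule integral_norm_bound_integral)
      show "(\<lambda>s. g (p (Suc n) s) - g (p n s)) integrable_on {0..t}"
        by (intro integrable_continuous_real continuous_intros gpc)
      show "(\<lambda>s. L * (B * (1/2) ^ n * exp (2 * L * s))) integrable_on {0..t}"
        using e by blast
      fix s assume "s \<in> {0..t}"
      then have "norm (p (Suc n) s - p n s) \<le> B * (1/2) ^ n * exp (2 * L * s)"
        using Suc.IH by auto
      then show "norm (g (p (Suc n) s) - g (p n s)) \<le> L * (B * (1/2) ^ n * exp (2 * L * s))"
        using lip[of "p (Suc n) s" "p n s"] L by (meson mult_left_mono order_trans less_imp_le)
    qed
    also have "\<dots> = B * (1/2) ^ Suc n * exp (2 * L * t) - B * (1/2) ^ Suc n * exp (2 * L * 0)"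
      using e by (rule integral_unique)
    also have "\<dots> \<le> B * (1/2) ^ Suc n * exp (2 * L * t)"
      using B by simp
    finally show ?case .
  qed
  define y where "y t = x0 + (\<Sum>n. p (Suc n) t - p n t)" for t
  have tele: "x0 + (\<Sum>i<n. p (Suc i) t - p i t) = p n t" for n t
    by (induction n) (simp_all add: p0 add.assoc[symmetric])
  have lim: "uniform_limit {0..T} p y sequentially" for T
  proof -
    have "uniform_limit {0..T} (\<lambda>n t. \<Sum>i<n. p (Suc i) t - p i t) (\<lambda>t. \<Sum>n. p (Suc n) t - p n t) sequentially"
    proof (rule Weierstrass_m_test)
      fix n t assume t: "t \<in> {0..T}"
      have "exp (2 * L * t) \<le> exp (2 * L * T)" using t L by simp
      then have "B * (1/2) ^ n * exp (2 * L * t) \<le> B * (1/2) ^ n * exp (2 * L * T)"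
        using B by (intro mult_left_mono) auto
      then show "norm (p (Suc n) t - p n t) \<le> B * (1/2) ^ n * exp (2 * L * T)"
        using step[of t n] t by auto
    next
      show "summable (\<lambda>n. B * (1/2) ^ n * exp (2 * L * T))"
        by (intro summable_mult summable_mult2 summable_geometric) auto
    qed
    from uniform_limit_add[OF uniform_limit_const[of "\<lambda>t. x0"] this]
    show ?thesis by (simp add: y_def[abs_def] tele)
  qed
  have yc: "continuous_on {0..T} y" for T
    by (rule uniform_limit_theorem[OF _ lim]) (auto simp: pc)
  have "y t = x0 + integral {0..t} (\<lambda>s. g (y s))" if t: "t \<ge> 0" for t
  proof -
    have glim: "uniform_limit {0..t} (\<lambda>n s. g (p n s)) (\<lambda>s. g (y s)) sequentially"
    proof (rule uniform_limitI)
      fix e :: real assume "e > 0"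
      then have "\<forall>\<^sub>F n in sequentially. \<forall>s\<in>{0..t}. dist (p n s) (y s) < e / L"
        using lim[of t] L by (intro uniform_limitD) auto
      then show "\<forall>\<^sub>F n in sequentially. \<forall>s\<in>{0..t}. dist (g (p n s)) (g (y s)) < e"
      proof (rule eventually_mono)
        fix n assume a: "\<forall>s\<in>{0..t}. dist (p n s) (y s) < e / L"
        show "\<forall>s\<in>{0..t}. dist (g (p n s)) (g (y s)) < e"
        proof
          fix s assume "s \<in> {0..t}"
          then have "L * norm (p n s - y s) < e" using a L by (auto simp: dist_norm field_simps)
          then show "dist (g (p n s)) (g (y s)) < e"
            using lip[of "p n s" "y s"] by (simp add: dist_norm)
        qed
      qed
    qed
    obtain I J where IJ: "\<And>n. ((\<lambda>s. g (p n s)) has_integral I n) {0..t}"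
      "((\<lambda>s. g (y s)) has_integral J) {0..t}" "I \<longlonglongrightarrow> J"
      by (rule uniform_limit_integral[OF glim gpc]) auto
    have "p (Suc n) t = x0 + I n" for n
      using IJ(1) by (simp add: pS integral_unique)
    then have "(\<lambda>n. p (Suc n) t) \<longlonglongrightarrow> x0 + J"
      using IJ(3) by (auto intro!: tendsto_intros)
    moreover have "(\<lambda>n. p (Suc n) t) \<longlonglongrightarrow> y t"
      using tendsto_uniform_limitI[OF lim[of t]] t by (intro LIMSEQ_Suc) auto
    ultimately show ?thesis
      using IJ(2) LIMSEQ_unique by (metis integral_unique)
  qed
  then show ?thesis using yc by blast
qed

text \<open>The Lipschitz constant is taken positive, which can always be arranged and allows division by it.\<close>

locale control_system =
  fixes U :: "'u::metric_space set" and f :: "'a::euclidean_space \<Rightarrow> 'u \<Rightarrow> 'a" and L :: real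
  assumes compact_U: "compact U"
    and f_cont: "continuous_on (UNIV \<times> U) (\<lambda>(y, u). f y u)"
    and f_lip: "\<And>u y y'. u \<in> U \<Longrightarrow> norm (f y u - f y' u) \<le> L * norm (y - y')"
    and L_pos: "L > 0"
begin

lemma f_section_continuous: "u \<in> U \<Longrightarrow> continuous_on S (\<lambda>y. f y u)"
proof -
  assume "u \<in> U"
  then have "continuous_on S (\<lambda>y. (\<lambda>(y, u). f y u) (y, u))"
    by (intro continuous_on_compose2[OF f_cont]) (auto intro!: continuous_intros)
  then show ?thesis by simp
qed

lemma constant_control_solution:
  assumes "u \<in> U" shows "\<exists>y. solves f (\<lambda>_. u) x y"
proof -
  obtain y :: "real \<Rightarrow> 'a" where y: "\<And>t. t \<ge> 0 \<Longrightarrow> continuous_on {0..t} y \<and> y t = x + integral {0..t} (\<lambda>s. f (y s) u)"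
    using autonomous_solution_exists[of "\<lambda>y. f y u" L x] f_lip[OF assms] L_pos f_section_continuous[OF assms] by blast
  have "(\<lambda>s. f (y s) u) absolutely_integrable_on {0..t}" if "t \<ge> 0" for t
  proof -
    have "continuous_on {0..t} (\<lambda>s. f (y s) u)"
      by (rule continuous_on_compose2[OF f_section_continuous[OF assms, of UNIV]])
        (use y that in auto)
    then show ?thesis by (rule absolutely_integrable_continuous_real)
  qed
  then show ?thesis unfolding solves_iff using y by blast
qed

lemma constant_control: "u \<in> U \<Longrightarrow> control U (\<lambda>_. u)"
  by (simp add: control_def)

lemma trajectory_pair_measurable:
  fixes y :: "real \<Rightarrow> 'a"
  assumes y: "continuous_on {0..T} y" and D: "y ` {0..T} \<subseteq> D" and u: "control U u"
  shows "(\<lambda>s. (y s, u s)) \<in> lebesgue_on {0..T} \<rightarrow>\<^sub>M restrict_space borel (D \<times> U)"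
proof (rule measurable_restrict_space2)
  have um: "u \<in> lebesgue_on {0..T} \<rightarrow>\<^sub>M borel"
  proof -
    have "u \<in> restrict_space (lebesgue_on {0..}) {0..T} \<rightarrow>\<^sub>M borel"
      by (rule measurable_restrict_space1) (use u in \<open>simp add: control_def\<close>)
    then show ?thesis by (simp add: restrict_restrict_space Int_absorb1)
  qed
  show "(\<lambda>s. (y s, u s)) \<in> lebesgue_on {0..T} \<rightarrow>\<^sub>M borel"
    by (rule borel_measurable_Pair_compact[OF compact_U])
      (use um u continuous_imp_measurable_on_sets_lebesgue[OF y] in \<open>auto simp: control_def\<close>)
  show "(\<lambda>s. (y s, u s)) \<in> space (lebesgue_on {0..T}) \<rightarrow> D \<times> U"
    using u D by (auto simp: control_def)
qed

lemma running_cost_integrable: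
  fixes q :: "'a \<Rightarrow> 'u \<Rightarrow> 'b::euclidean_space"
  assumes q: "continuous_on (D \<times> U) (\<lambda>(y, u). q y u)"
    and y: "continuous_on {0..T} y" and D: "y ` {0..T} \<subseteq> D" and u: "control U u"
  shows "(\<lambda>s. q (y s) (u s)) absolutely_integrable_on {0..T}"
    and "\<exists>M. \<forall>s\<in>{0..T}. norm (q (y s) (u s)) \<le> M"
proof -
  let ?D = "y ` {0..T}"
  have c: "compact (?D \<times> U)"
    using y compact_U by (intro compact_Times compact_continuous_image) auto
  have q': "continuous_on (?D \<times> U) (\<lambda>(y, u). q y u)"
    using q by (rule continuous_on_subset) (use D in auto)
  obtain M where M: "\<And>p. p \<in> ?D \<times> U \<Longrightarrow> norm (case p of (y, u) \<Rightarrow> q y u) \<le> M"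
    using compact_imp_bounded[OF compact_continuous_image[OF q' c]] unfolding bounded_iff by blast
  have M': "norm (q (y s) (u s)) \<le> M" if "s \<in> {0..T}" for s
    using M[of "(y s, u s)"] that u by (auto simp: control_def)
  then show "\<exists>M. \<forall>s\<in>{0..T}. norm (q (y s) (u s)) \<le> M" by blast
  have "(\<lambda>s. (\<lambda>(y, u). q y u) (y s, u s)) \<in> borel_measurable (lebesgue_on {0..T})"
    by (rule measurable_compose[OF trajectory_pair_measurable[OF y _ u, of ?D]])
      (auto intro!: borel_measurable_continuous_on_restrict q')
  then show "(\<lambda>s. q (y s) (u s)) absolutely_integrable_on {0..T}"
    by (intro measurable_bounded_by_integrable_imp_absolutely_integrable[where g="\<lambda>_. M"])
      (use M' in auto)
qed

lemma integral_grad_along_solution: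
  assumes u: "control U u" and s: "solves f u y0 y" and \<phi>: "\<phi> \<in> C1" and T: "T \<ge> 0"
  shows "integral {0..T} (\<lambda>s. grad \<phi> (y s) \<bullet> f (y s) (u s)) = \<phi> (y T) - \<phi> y0"
proof -
  obtain M where M: "\<forall>s\<in>{0..T}. norm (f (y s) (u s)) \<le> M"
    using running_cost_integrable(2)[OF f_cont solves_continuous[OF s] _ u, of T] by auto
  show ?thesis
    by (rule chain_rule_integral(2)[OF \<phi> T, of _ M]) (use s M T in \<open>auto simp: solves_iff\<close>)
qed

lemma concat_trajectory:
  assumes "control U u1" "solves f u1 y0 y1" "control U u2" "solves f u2 (y1 \<tau>) y2" "\<tau> \<ge> 0"
  shows "control U (concat_at \<tau> u1 u2)" "solves f (concat_at \<tau> u1 u2) y0 (concat_at \<tau> y1 y2)"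
    "concat_at \<tau> y1 y2 (\<tau> + t) = (if t \<ge> 0 then y2 t else y1 (\<tau> + t))"
  using assms control_concat solves_concat by (auto simp: concat_at_def)

end


section \<open>Mollification\<close>

text \<open>The square of a truncated paraboloid is just smooth enough: it is \<open>C1\<close> with Lipschitz gradient, which is what
the quadratic remainder estimate below needs.\<close>

definition bump :: "real \<Rightarrow> 'a::euclidean_space \<Rightarrow> real" where
  "bump \<epsilon> w = (max 0 (\<epsilon>\<^sup>2 - (norm w)\<^sup>2))\<^sup>2"

text \<open>The negative of the gradient of \<open>bump \<epsilon>\<close> at \<open>w\<close>.\<close>

definition bump_slope :: "real \<Rightarrow> 'a::euclidean_space \<Rightarrow> 'a" where
  "bump_slope \<epsilon> w = (4 * max 0 (\<epsilon>\<^sup>2 - (norm w)\<^sup>2)) *\<^sub>R w"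

definition mollify :: "real \<Rightarrow> ('a::euclidean_space \<Rightarrow> real) \<Rightarrow> 'a \<Rightarrow> real" where
  "mollify \<epsilon> \<Phi> y = (\<integral>w. \<Phi> (y + w) * bump \<epsilon> w \<partial>lborel) / (\<integral>w. bump \<epsilon> (w::'a) \<partial>lborel)"

lemma square_positive_part_taylor:
  fixes s t :: real
  shows "\<bar>(max 0 (s + t))\<^sup>2 - (max 0 s)\<^sup>2 - 2 * max 0 s * t\<bar> \<le> t\<^sup>2"
proof (cases "s \<ge> 0")
  case s: True
  show ?thesis
  proof (cases "s + t \<ge> 0")
    case True then show ?thesis using s by (simp add: power2_eq_square algebra_simps)
  next
    case False
    have "s * (s + 2 * t) \<le> 0" using False s by (intro mult_nonneg_nonpos) auto
    moreover have "0 \<le> (s + t) * (s + t)" "0 \<le> t * t" by auto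
    ultimately have "\<bar>s * s + 2 * s * t\<bar> \<le> t * t"
      by (simp add: abs_le_iff algebra_simps)
    then show ?thesis using False s by (simp add: power2_eq_square)
  qed
next
  case s: False
  show ?thesis
  proof (cases "s + t \<ge> 0")
    case True
    then have "(s + t)\<^sup>2 \<le> t\<^sup>2" using s by (intro power_mono) auto
    then show ?thesis using s True by simp
  qed (use s in auto)
qed

text \<open>The indicator records that both sides vanish when \<open>w\<close> is farther than \<open>\<epsilon> + 1\<close> from the origin; it is what makes the
estimate integrable in \<open>w\<close>.\<close>

lemma bump_taylor:
  fixes w v :: "'a::euclidean_space"
  assumes v: "norm v \<le> 1" and e: "\<epsilon> > 0"
  shows "\<bar>bump \<epsilon> (w - v) - bump \<epsilon> w - bump_slope \<epsilon> w \<bullet> v\<bar>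
    \<le> ((2 * \<epsilon> + 3)\<^sup>2 + 2 * \<epsilon>\<^sup>2) * (norm v)\<^sup>2 * indicator (cball 0 (\<epsilon> + 1)) w"
proof (cases "norm w \<le> \<epsilon> + 1")
  case True
  define s where "s = \<epsilon>\<^sup>2 - (norm w)\<^sup>2"
  define t where "t = 2 * (w \<bullet> v) - (norm v)\<^sup>2"
  \<comment> \<open>\<open>t\<close> is the exact increment of the paraboloid, so only the outer square has to be expanded\<close>
  have st: "\<epsilon>\<^sup>2 - (norm (w - v))\<^sup>2 = s + t"
    by (simp add: s_def t_def power2_norm_eq_inner inner_diff_left inner_diff_right inner_commute algebra_simps)
  have sm: "0 \<le> max 0 s" "max 0 s \<le> \<epsilon>\<^sup>2" by (auto simp: s_def)
  have "\<bar>t\<bar> \<le> (2 * \<epsilon> + 3) * norm v"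
  proof -
    have "\<bar>w \<bullet> v\<bar> \<le> (\<epsilon> + 1) * norm v"
      using Cauchy_Schwarz_ineq2[of w v] True by (meson mult_right_mono norm_ge_zero order_trans)
    moreover have "(norm v)\<^sup>2 \<le> norm v"
      using v mult_left_mono[of "norm v" 1 "norm v"] by (simp add: power2_eq_square)
    moreover have "(2 * \<epsilon> + 3) * norm v = 2 * ((\<epsilon> + 1) * norm v) + norm v" by (simp add: algebra_simps)
    ultimately show ?thesis unfolding t_def
      using zero_le_power2[of "norm v"] norm_ge_zero[of v] by linarith
  qed
  then have "t\<^sup>2 \<le> ((2 * \<epsilon> + 3) * norm v)\<^sup>2"
    by (rule power2_le_iff_abs_le[THEN iffD2, rotated]) (use e in simp)
  then have t2: "t\<^sup>2 \<le> (2 * \<epsilon> + 3)\<^sup>2 * (norm v)\<^sup>2" by (simp add: power_mult_distrib)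
  have "bump \<epsilon> (w - v) - bump \<epsilon> w - bump_slope \<epsilon> w \<bullet> v
     = ((max 0 (s + t))\<^sup>2 - (max 0 s)\<^sup>2 - 2 * max 0 s * t) - 2 * max 0 s * (norm v)\<^sup>2"
    unfolding bump_def bump_slope_def st s_def[symmetric] by (simp add: t_def algebra_simps)
  also have "\<bar>\<dots>\<bar> \<le> t\<^sup>2 + 2 * max 0 s * (norm v)\<^sup>2"
    using square_positive_part_taylor[of s t] sm by (smt (verit) mult_nonneg_nonneg zero_le_power2)
  also have "\<dots> \<le> (2 * \<epsilon> + 3)\<^sup>2 * (norm v)\<^sup>2 + 2 * \<epsilon>\<^sup>2 * (norm v)\<^sup>2"
    using t2 sm by (intro add_mono mult_right_mono) auto
  finally show ?thesis using True by (simp add: algebra_simps)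
next
  case False
  then have "norm (w - v) > \<epsilon>" using v norm_triangle_ineq2[of w v] by linarith
  then have "(norm (w - v))\<^sup>2 \<ge> \<epsilon>\<^sup>2" "(norm w)\<^sup>2 \<ge> \<epsilon>\<^sup>2"
    using e False by (auto intro!: power_mono)
  then show ?thesis using False by (simp add: bump_def bump_slope_def)
qed

lemma bump_eq_0: "\<epsilon> > 0 \<Longrightarrow> norm w > \<epsilon> \<Longrightarrow> bump \<epsilon> w = 0"
  and bump_slope_eq_0: "\<epsilon> > 0 \<Longrightarrow> norm w > \<epsilon> \<Longrightarrow> bump_slope \<epsilon> w = 0"
  using power_mono[of \<epsilon> "norm w" 2] by (auto simp: bump_def bump_slope_def)

lemma bump_continuous [continuous_intros]:
  "continuous_on S g \<Longrightarrow> continuous_on S (\<lambda>x. bump \<epsilon> (g x))"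
  unfolding bump_def by (intro continuous_intros)

lemma bump_slope_continuous [continuous_intros]:
  "continuous_on S g \<Longrightarrow> continuous_on S (\<lambda>x. bump_slope \<epsilon> (g x))"
  unfolding bump_slope_def by (intro continuous_intros)

lemma bump_nonneg: "bump \<epsilon> w \<ge> 0"
  by (simp add: bump_def)

lemma integrable_compact_support:
  fixes g :: "'a::euclidean_space \<Rightarrow> 'b::euclidean_space"
  assumes "continuous_on UNIV g" "\<And>w. norm w > R \<Longrightarrow> g w = 0"
  shows "integrable lborel g"
proof -
  have "integrable lborel (\<lambda>x. indicator (cball 0 R) x *\<^sub>R g x)"
    by (rule borel_integrable_compact) (use assms(1) in \<open>auto intro: continuous_on_subset\<close>)
  also have "(\<lambda>x. indicator (cball 0 R) x *\<^sub>R g x) = g"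
    using assms(2) by (auto simp: fun_eq_iff indicator_def not_le)
  finally show ?thesis .
qed

lemma bump_mass_pos:
  assumes e: "\<epsilon> > 0" shows "(\<integral>w. bump \<epsilon> (w::'a::euclidean_space) \<partial>lborel) > 0"
proof -
  let ?b = "\<lambda>w::'a. (3 * \<epsilon>\<^sup>2 / 4)\<^sup>2 * indicator (ball 0 (\<epsilon> / 2)) w"
  have "measure lborel (ball (0::'a) (\<epsilon> / 2)) > 0"
    using content_ball_pos[of "\<epsilon> / 2" "0::'a"] e by simp
  then have "0 < (3 * \<epsilon>\<^sup>2 / 4)\<^sup>2 * measure lborel (ball (0::'a) (\<epsilon> / 2))"
    using e by simp
  also have "\<dots> = (\<integral>w. ?b w \<partial>lborel)" by simp
  also have "\<dots> \<le> (\<integral>w. bump \<epsilon> (w::'a) \<partial>lborel)"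
  proof (rule integral_mono)
    show "integrable lborel ?b"
      using emeasure_bounded_finite[of "ball (0::'a) (\<epsilon> / 2)"] by (intro integrable_mult_right) simp
    show "integrable lborel (\<lambda>w. bump \<epsilon> (w::'a))"
      by (rule integrable_compact_support[of _ \<epsilon>]) (use e in \<open>auto intro!: continuous_intros bump_eq_0\<close>)
    fix w :: 'a
    show "?b w \<le> bump \<epsilon> w"
    proof (cases "norm w < \<epsilon> / 2")
      case True
      then have "(norm w)\<^sup>2 \<le> (\<epsilon> / 2)\<^sup>2" by (intro power_mono) auto
      then have "3 * \<epsilon>\<^sup>2 / 4 \<le> max 0 (\<epsilon>\<^sup>2 - (norm w)\<^sup>2)"
        using zero_le_power2[of "norm w"] unfolding power_divide max_def by (simp, linarith)
      then have "(3 * \<epsilon>\<^sup>2 / 4)\<^sup>2 \<le> bump \<epsilon> w" unfolding bump_def by (intro power_mono) auto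
      then show ?thesis using True by simp
    qed (simp add: bump_nonneg)
  qed
  finally show ?thesis .
qed

lemma lborel_integral_translate:
  fixes g :: "'a::euclidean_space \<Rightarrow> real"
  assumes "g \<in> borel_measurable borel"
  shows "(\<integral>w. g (v + w) \<partial>lborel) = (\<integral>w. g w \<partial>lborel)"
proof -
  have "(\<integral>w. g w \<partial>lborel) = (\<integral>w. g w \<partial>distr lborel borel ((+) v))"
    by (simp add: lborel_distr_plus)
  also have "\<dots> = (\<integral>w. g (v + w) \<partial>lborel)"
    using assms by (subst integral_distr) auto
  finally show ?thesis by simp
qed

lemma norm_lebesgue_integral_le:
  fixes r :: "'a \<Rightarrow> 'b::{banach, second_countable_topology}"
  assumes "integrable M r" "integrable M k" "\<And>w. norm (r w) \<le> k w"
  shows "norm (\<integral>w. r w \<partial>M) \<le> (\<integral>w. k w \<partial>M)"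
  by (rule order_trans[OF integral_norm_bound integral_mono]) (use assms in auto)

text \<open>Averaging over \<open>w\<close> preserves an inequality that holds for all small translates.\<close>

lemma mollify_mono:
  fixes \<Phi> :: "'a::euclidean_space \<Rightarrow> real"
  assumes e: "\<epsilon> > 0" and c: "continuous_on UNIV \<Phi>"
    and a: "\<And>w. norm w \<le> \<epsilon> \<Longrightarrow> a \<le> \<Phi> (y' + w) - \<Phi> (y + w)"
  shows "a \<le> mollify \<epsilon> \<Phi> y' - mollify \<epsilon> \<Phi> y"
proof -
  let ?c = "\<integral>w. bump \<epsilon> (w::'a) \<partial>lborel"
  have i: "integrable lborel (\<lambda>w. \<Phi> (y + w) * bump \<epsilon> w)" for y
    by (rule integrable_compact_support[of _ \<epsilon>])
      (use e in \<open>auto intro!: continuous_intros continuous_on_compose2[OF c] bump_eq_0\<close>)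
  have ib: "integrable lborel (\<lambda>w. bump \<epsilon> (w::'a))"
    by (rule integrable_compact_support[of _ \<epsilon>]) (use e in \<open>auto intro!: continuous_intros bump_eq_0\<close>)
  have "a * ?c = (\<integral>w. a * bump \<epsilon> (w::'a) \<partial>lborel)" by simp
  also have "\<dots> \<le> (\<integral>w. \<Phi> (y' + w) * bump \<epsilon> w - \<Phi> (y + w) * bump \<epsilon> w \<partial>lborel)"
  proof (rule integral_mono)
    fix w :: 'a
    show "a * bump \<epsilon> w \<le> \<Phi> (y' + w) * bump \<epsilon> w - \<Phi> (y + w) * bump \<epsilon> w"
    proof (cases "norm w \<le> \<epsilon>")
      case True
      then show ?thesis using mult_right_mono[OF a[OF True] bump_nonneg] by (simp add: algebra_simps)
    qed (use bump_eq_0[OF e, of w] in auto)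
  qed (use i ib in auto)
  also have "\<dots> = (\<integral>w. \<Phi> (y' + w) * bump \<epsilon> w \<partial>lborel) - (\<integral>w. \<Phi> (y + w) * bump \<epsilon> w \<partial>lborel)"
    using i by simp
  finally show ?thesis
    unfolding mollify_def using bump_mass_pos[OF e, where 'a='a]
    by (simp add: diff_divide_distrib[symmetric] pos_le_divide_eq)
qed

text \<open>After a translation, the increment by \<open>v\<close> falls on the kernel, whose Taylor remainder is quadratic in \<open>v\<close>. The
constant \<open>K\<close> depends on \<open>\<epsilon>\<close> and the dimension only, not on \<open>\<Phi>\<close>: for fixed \<open>\<epsilon>\<close>, a step of size \<open>h\<close> is
thus followed by the gradient up to an error of order \<open>h\<^sup>2\<close> times the supremum of \<open>|\<Phi>|\<close>.\<close>

lemma mollify_smooth: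
  fixes \<Phi> :: "'a::euclidean_space \<Rightarrow> real"
  assumes e: "\<epsilon> > 0" and lip: "\<And>x y. \<bar>\<Phi> x - \<Phi> y\<bar> \<le> \<Lambda> * norm (x - y)"
  defines "K \<equiv> ((2 * \<epsilon> + 3)\<^sup>2 + 2 * \<epsilon>\<^sup>2) * measure lborel (cball (0::'a) (\<epsilon> + 1))
    / (\<integral>w. bump \<epsilon> (w::'a) \<partial>lborel)"
  shows "mollify \<epsilon> \<Phi> \<in> C1"
    and "\<And>y v B. norm v \<le> 1 \<Longrightarrow> (\<And>w. norm w \<le> \<epsilon> + 1 \<Longrightarrow> \<bar>\<Phi> (y + w)\<bar> \<le> B) \<Longrightarrow>
      \<bar>mollify \<epsilon> \<Phi> (y + v) - mollify \<epsilon> \<Phi> y - grad (mollify \<epsilon> \<Phi>) y \<bullet> v\<bar> \<le> K * B * (norm v)\<^sup>2"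
proof -
  let ?c = "\<integral>w. bump \<epsilon> (w::'a) \<partial>lborel"
  have c0: "?c > 0" by (rule bump_mass_pos[OF e])
  have K0: "K \<ge> 0" unfolding K_def using c0 by (intro divide_nonneg_pos mult_nonneg_nonneg) auto
  have L0: "\<Lambda> \<ge> 0"
  proof -
    obtain b :: 'a where "b \<in> Basis" using nonempty_Basis by blast
    then show ?thesis using lip[of b 0] by (simp add: order_trans[OF abs_ge_zero])
  qed
  have cont: "continuous_on UNIV \<Phi>"
    by (rule lipschitz_on_continuous_on[of \<Lambda>], rule lipschitz_onI) (use lip L0 in \<open>auto simp: dist_norm\<close>)
  have cs: "continuous_on UNIV (\<lambda>w. \<Phi> (y + w))" for y
    by (intro continuous_on_compose2[OF cont] continuous_intros) auto
  have i0: "integrable lborel (\<lambda>w. \<Phi> (y + w) * bump \<epsilon> w)" for y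
    by (rule integrable_compact_support[of _ \<epsilon>])
      (use e in \<open>auto intro!: continuous_intros cs bump_eq_0\<close>)
  have i1: "integrable lborel (\<lambda>w. \<Phi> (y + w) * bump \<epsilon> (w - v))" if "norm v \<le> 1" for y v
  proof (rule integrable_compact_support[of _ "\<epsilon> + 1"])
    fix w :: 'a assume "norm w > \<epsilon> + 1"
    then have "norm (w - v) > \<epsilon>" using that norm_triangle_ineq2[of w v] by linarith
    then show "\<Phi> (y + w) * bump \<epsilon> (w - v) = 0" using bump_eq_0[OF e, of "w - v"] by simp
  qed (auto intro!: continuous_intros cs)
  have i2: "integrable lborel (\<lambda>w. \<Phi> (y + w) *\<^sub>R bump_slope \<epsilon> w)" for y
    by (rule integrable_compact_support[of _ \<epsilon>])
      (use e in \<open>auto intro!: continuous_intros cs bump_slope_eq_0\<close>)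
  define g where "g y = (\<integral>w. \<Phi> (y + w) *\<^sub>R bump_slope \<epsilon> w \<partial>lborel) /\<^sub>R ?c" for y
  have shift: "mollify \<epsilon> \<Phi> (y + v) = (\<integral>w. \<Phi> (y + w) * bump \<epsilon> (w - v) \<partial>lborel) / ?c" for y v
  proof -
    have m: "(\<lambda>w. \<Phi> (y + w) * bump \<epsilon> (w - v)) \<in> borel_measurable borel"
      by (intro borel_measurable_continuous_onI continuous_intros cs)
    show ?thesis
      unfolding mollify_def using lborel_integral_translate[OF m, of v] by (simp add: add.assoc)
  qed
  have taylor: "\<bar>mollify \<epsilon> \<Phi> (y + v) - mollify \<epsilon> \<Phi> y - g y \<bullet> v\<bar> \<le> K * B * (norm v)\<^sup>2"
    if v: "norm v \<le> 1" and B: "\<And>w. norm w \<le> \<epsilon> + 1 \<Longrightarrow> \<bar>\<Phi> (y + w)\<bar> \<le> B" for y v B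
  proof -
    let ?r = "\<lambda>w. \<Phi> (y + w) * (bump \<epsilon> (w - v) - bump \<epsilon> w - bump_slope \<epsilon> w \<bullet> v)"
    let ?k = "((2 * \<epsilon> + 3)\<^sup>2 + 2 * \<epsilon>\<^sup>2) * (norm v)\<^sup>2"
    have isl: "integrable lborel (\<lambda>w. \<Phi> (y + w) *\<^sub>R bump_slope \<epsilon> w \<bullet> v)"
      using i2 by (intro integrable_inner_left) auto
    have "(mollify \<epsilon> \<Phi> (y + v) - mollify \<epsilon> \<Phi> y - g y \<bullet> v) * ?c =
        (\<integral>w. \<Phi> (y + w) * bump \<epsilon> (w - v) \<partial>lborel) - (\<integral>w. \<Phi> (y + w) * bump \<epsilon> w \<partial>lborel)
        - (\<integral>w. \<Phi> (y + w) *\<^sub>R bump_slope \<epsilon> w \<partial>lborel) \<bullet> v"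
      unfolding shift g_def using c0 by (simp add: mollify_def field_simps)
    also have "(\<integral>w. \<Phi> (y + w) *\<^sub>R bump_slope \<epsilon> w \<partial>lborel) \<bullet> v =
        (\<integral>w. \<Phi> (y + w) *\<^sub>R bump_slope \<epsilon> w \<bullet> v \<partial>lborel)"
      using i2[of y] by (subst integral_inner_left) auto
    also have "(\<integral>w. \<Phi> (y + w) * bump \<epsilon> (w - v) \<partial>lborel) - (\<integral>w. \<Phi> (y + w) * bump \<epsilon> w \<partial>lborel)
        - (\<integral>w. \<Phi> (y + w) *\<^sub>R bump_slope \<epsilon> w \<bullet> v \<partial>lborel) = (\<integral>w. ?r w \<partial>lborel)"
      using i1[OF v, of y] i0[of y] isl by (simp add: right_diff_distrib)
    finally have eq: "(mollify \<epsilon> \<Phi> (y + v) - mollify \<epsilon> \<Phi> y - g y \<bullet> v) * ?c = (\<integral>w. ?r w \<partial>lborel)" .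
    have "norm (\<integral>w. ?r w \<partial>lborel) \<le> (\<integral>w. B * ?k * indicator (cball 0 (\<epsilon> + 1)) (w::'a) \<partial>lborel)"
    proof (rule norm_lebesgue_integral_le)
      show "integrable lborel ?r"
        using i1[OF v, of y] i0[of y] isl by (simp add: right_diff_distrib)
      show "integrable lborel (\<lambda>w::'a. B * ?k * indicator (cball 0 (\<epsilon> + 1)) w)"
        using emeasure_bounded_finite[of "cball (0::'a) (\<epsilon> + 1)"] by (intro integrable_mult_right) simp
      fix w :: 'a
      show "norm (?r w) \<le> B * ?k * indicator (cball 0 (\<epsilon> + 1)) w"
      proof (cases "norm w \<le> \<epsilon> + 1")
        case True
        have "norm (?r w) = \<bar>\<Phi> (y + w)\<bar> * \<bar>bump \<epsilon> (w - v) - bump \<epsilon> w - bump_slope \<epsilon> w \<bullet> v\<bar>"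
          by (simp add: abs_mult)
        also have "\<dots> \<le> B * (?k * indicator (cball 0 (\<epsilon> + 1)) w)"
          by (rule mult_mono[OF B[OF True] bump_taylor[OF v e]]) (use B[OF True] in \<open>auto intro: order_trans[OF abs_ge_zero]\<close>)
        finally show ?thesis by (simp add: mult.assoc)
      next
        case False
        then show ?thesis using bump_taylor[OF v e, of w] by simp
      qed
    qed
    also have "\<dots> = B * ?k * measure lborel (cball (0::'a) (\<epsilon> + 1))" by simp
    finally have "\<bar>mollify \<epsilon> \<Phi> (y + v) - mollify \<epsilon> \<Phi> y - g y \<bullet> v\<bar> * ?c
        \<le> B * ?k * measure lborel (cball (0::'a) (\<epsilon> + 1))"
      using c0 by (simp add: eq[symmetric] abs_mult)
    then show ?thesis
      unfolding K_def using c0 by (simp add: pos_le_divide_eq mult.commute mult.left_commute)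
  qed
  have der: "(mollify \<epsilon> \<Phi> has_derivative (\<lambda>h. g y \<bullet> h)) (at y)" for y
  proof -
    have "bounded (\<Phi> ` cball y (\<epsilon> + 1))"
      by (intro compact_imp_bounded compact_continuous_image continuous_on_subset[OF cont]) auto
    then obtain B where B: "\<And>x. x \<in> cball y (\<epsilon> + 1) \<Longrightarrow> \<bar>\<Phi> x\<bar> \<le> B"
      unfolding bounded_iff real_norm_def by blast
    have B0: "B \<ge> 0" using B[of y] e by (auto intro: order_trans[OF abs_ge_zero])
    show ?thesis
      unfolding has_derivative_at_alt
    proof (intro conjI allI impI bounded_linear_inner_right)
      fix d :: real assume d: "d > 0"
      define r where "r = min 1 (d / (K * B + 1))"
      have r: "r > 0" "r \<le> 1" "K * B * r \<le> d"
      proof -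
        have kb: "K * B \<ge> 0" using K0 B0 by simp
        show "r > 0" "r \<le> 1" using d kb by (auto simp: r_def)
        have "K * B * r \<le> K * B * (d / (K * B + 1))" using kb by (intro mult_left_mono) (auto simp: r_def)
        also have "\<dots> \<le> d" using kb d by (simp add: field_simps)
        finally show "K * B * r \<le> d" .
      qed
      show "\<exists>r>0. \<forall>x. norm (x - y) < r \<longrightarrow>
          norm (mollify \<epsilon> \<Phi> x - mollify \<epsilon> \<Phi> y - g y \<bullet> (x - y)) \<le> d * norm (x - y)"
      proof (intro exI[of _ r] conjI allI impI)
        fix x assume x: "norm (x - y) < r"
        have "\<bar>mollify \<epsilon> \<Phi> (y + (x - y)) - mollify \<epsilon> \<Phi> y - g y \<bullet> (x - y)\<bar> \<le> K * B * (norm (x - y))\<^sup>2"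
          by (rule taylor) (use x r B in \<open>auto simp: dist_norm\<close>)
        also have "\<dots> \<le> K * B * r * norm (x - y)"
          using mult_right_mono[OF mult_left_mono[of "norm (x - y)" r "K * B"], of "norm (x - y)"] x K0 B0
          by (simp add: power2_eq_square mult.assoc)
        also have "\<dots> \<le> d * norm (x - y)" using r by (intro mult_right_mono) auto
        finally show "norm (mollify \<epsilon> \<Phi> x - mollify \<epsilon> \<Phi> y - g y \<bullet> (x - y)) \<le> d * norm (x - y)" by simp
      qed (use r in auto)
    qed
  qed
  have gc: "continuous_on UNIV g"
  proof -
    let ?C = "(\<integral>w. norm (bump_slope \<epsilon> (w::'a)) \<partial>lborel)"
    have ibs: "integrable lborel (\<lambda>w. bump_slope \<epsilon> (w::'a))"
      by (rule integrable_compact_support[of _ \<epsilon>])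
      (use e in \<open>auto intro!: continuous_intros bump_slope_eq_0\<close>)
    have C0: "?C \<ge> 0" by simp
    have "norm (g x - g y) \<le> (\<Lambda> * ?C / ?c) * norm (x - y)" for x y
    proof -
      have "g x - g y = (\<integral>w. \<Phi> (x + w) *\<^sub>R bump_slope \<epsilon> w - \<Phi> (y + w) *\<^sub>R bump_slope \<epsilon> w \<partial>lborel) /\<^sub>R ?c"
        unfolding g_def using i2 by (simp add: scaleR_diff_right)
      moreover have "norm (\<integral>w. \<Phi> (x + w) *\<^sub>R bump_slope \<epsilon> w - \<Phi> (y + w) *\<^sub>R bump_slope \<epsilon> w \<partial>lborel)
          \<le> (\<integral>w. \<Lambda> * norm (x - y) * norm (bump_slope \<epsilon> (w::'a)) \<partial>lborel)"
      proof (rule norm_lebesgue_integral_le)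
        fix w :: 'a
        have "norm (\<Phi> (x + w) *\<^sub>R bump_slope \<epsilon> w - \<Phi> (y + w) *\<^sub>R bump_slope \<epsilon> w) =
          \<bar>\<Phi> (x + w) - \<Phi> (y + w)\<bar> * norm (bump_slope \<epsilon> w)"
          by (simp add: scaleR_diff_left[symmetric])
        also have "\<dots> \<le> \<Lambda> * norm (x - y) * norm (bump_slope \<epsilon> w)"
          using lip[of "x + w" "y + w"] by (intro mult_right_mono) auto
        finally show "norm (\<Phi> (x + w) *\<^sub>R bump_slope \<epsilon> w - \<Phi> (y + w) *\<^sub>R bump_slope \<epsilon> w)
           \<le> \<Lambda> * norm (x - y) * norm (bump_slope \<epsilon> w)" .
      qed (use i2 ibs in auto)
      ultimately show ?thesis
        using c0 by (simp add: field_simps)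
    qed
    then show ?thesis
      using L0 c0 C0 by (intro lipschitz_on_continuous_on[of "\<Lambda> * ?C / ?c"] lipschitz_onI) (auto simp: dist_norm)
  qed
  show "mollify \<epsilon> \<Phi> \<in> C1" by (rule C1_I(1)[OF der gc])
  have "grad (mollify \<epsilon> \<Phi>) = g" by (rule C1_I(2)[OF der gc])
  then show "\<And>y v B. norm v \<le> 1 \<Longrightarrow> (\<And>w. norm w \<le> \<epsilon> + 1 \<Longrightarrow> \<bar>\<Phi> (y + w)\<bar> \<le> B) \<Longrightarrow>
      \<bar>mollify \<epsilon> \<Phi> (y + v) - mollify \<epsilon> \<Phi> y - grad (mollify \<epsilon> \<Phi>) y \<bullet> v\<bar> \<le> K * B * (norm v)\<^sup>2"
    using taylor by simp
qed


section \<open>Smooth subsolutions from Euler value functions\<close>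

lemma INF_lipschitz:
  fixes g g' :: "'i \<Rightarrow> real"
  assumes I: "I \<noteq> {}" and b: "\<And>i. i \<in> I \<Longrightarrow> m \<le> g i" "\<And>i. i \<in> I \<Longrightarrow> m' \<le> g' i"
    and c: "\<And>i. i \<in> I \<Longrightarrow> \<bar>g i - g' i\<bar> \<le> c"
  shows "\<bar>(INF i\<in>I. g i) - (INF i\<in>I. g' i)\<bar> \<le> c"
proof -
  have bd: "bdd_below (g ` I)" "bdd_below (g' ` I)"
    using b by (auto intro!: bdd_belowI2)
  have "(INF i\<in>I. g' i) - c \<le> (INF i\<in>I. g i)"
  proof (rule cINF_greatest[OF I])
    fix i assume i: "i \<in> I"
    show "(INF i\<in>I. g' i) - c \<le> g i" using cINF_lower[OF bd(2) i] c[OF i] by linarith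
  qed
  moreover have "(INF i\<in>I. g i) - c \<le> (INF i\<in>I. g' i)"
  proof (rule cINF_greatest[OF I])
    fix i assume i: "i \<in> I"
    show "(INF i\<in>I. g i) - c \<le> g' i" using cINF_lower[OF bd(1) i] c[OF i] by linarith
  qed
  ultimately show ?thesis by linarith
qed

text \<open>The infimal convolution of \<open>q\<close> with \<open>\<kappa> * dist\<close>, cut off at height \<open>M\<close>. It is defined and bounded for all
states, also outside \<open>A\<close>, where the Euler scheme and the mollification need a cost. Taking the steepness \<open>\<kappa> = 2 * M / d\<close>, with \<open>d\<close> a
modulus of uniform continuity for \<open>\<delta>\<close>, keeps the minorant within \<open>\<delta>\<close> of \<open>q\<close> on \<open>A\<close>.\<close>

lemma lipschitz_minorant:
  fixes q :: "'a::metric_space \<Rightarrow> 'u::metric_space \<Rightarrow> real"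
  assumes A: "compact A" "A \<noteq> {}" and U: "compact U" "U \<noteq> {}"
    and q: "continuous_on (A \<times> U) (\<lambda>(y, u). q y u)" and \<delta>: "\<delta> > 0"
  obtains p \<kappa> M where "M \<ge> 0" "\<kappa> \<ge> 0"
    "\<And>y u. u \<in> U \<Longrightarrow> \<bar>p y u\<bar> \<le> M"
    "\<And>y y' u. u \<in> U \<Longrightarrow> \<bar>p y u - p y' u\<bar> \<le> \<kappa> * dist y y'"
    "\<And>y u. y \<in> A \<Longrightarrow> u \<in> U \<Longrightarrow> p y u \<le> q y u"
    "\<And>y u. y \<in> A \<Longrightarrow> u \<in> U \<Longrightarrow> q y u \<le> p y u + \<delta>"
proof -
  have AU: "compact (A \<times> U)" using A U by (auto intro: compact_Times)
  obtain M where M: "\<And>y u. y \<in> A \<Longrightarrow> u \<in> U \<Longrightarrow> \<bar>q y u\<bar> \<le> M"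
  proof -
    from compact_imp_bounded[OF compact_continuous_image[OF q AU]] obtain M where
      "\<forall>x\<in>(\<lambda>(y, u). q y u) ` (A \<times> U). norm x \<le> M" unfolding bounded_iff by blast
    then show ?thesis using that by (metis (no_types, lifting) SigmaI case_prod_conv image_eqI real_norm_def)
  qed
  have M0: "M \<ge> 0"
    using A(2) U(2) M by (meson abs_ge_zero all_not_in_conv order_trans)
  obtain d where d: "d > 0" "\<And>x x'. x \<in> A \<times> U \<Longrightarrow> x' \<in> A \<times> U \<Longrightarrow> dist x' x < d \<Longrightarrow>
      dist (case x' of (y, u) \<Rightarrow> q y u) (case x of (y, u) \<Rightarrow> q y u) < \<delta>"
    using compact_uniformly_continuous[OF q AU] \<delta> unfolding uniformly_continuous_on_def by metis
  define \<kappa> where "\<kappa> = 2 * M / d"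
  have \<kappa>: "\<kappa> \<ge> 0" using M0 d by (simp add: \<kappa>_def)
  define r where "r y u = (INF w\<in>A. q w u + \<kappa> * dist y w)" for y u
  define p where "p y u = min M (r y u)" for y u
  have lb: "- M \<le> q w u + \<kappa> * dist y w" if "w \<in> A" "u \<in> U" for w u y
    using M[OF that] \<kappa> by (smt (verit) mult_nonneg_nonneg zero_le_dist)
  have bdd: "bdd_below ((\<lambda>w. q w u + \<kappa> * dist y w) ` A)" if "u \<in> U" for u y
    using lb that by (auto intro!: bdd_belowI2)
  have rlb: "- M \<le> r y u" if "u \<in> U" for y u
    unfolding r_def by (rule cINF_greatest[OF A(2)]) (use lb that in auto)
  have rlip: "\<bar>r y u - r y' u\<bar> \<le> \<kappa> * dist y y'" if "u \<in> U" for y y' u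
    unfolding r_def
  proof (rule INF_lipschitz[OF A(2), of "-M" _ "-M"])
    fix w assume "w \<in> A"
    have "\<bar>dist y w - dist y' w\<bar> \<le> dist y y'"
      using dist_triangle[of y w y'] dist_triangle[of y' w y] by (simp add: dist_commute abs_le_iff)
    then show "\<bar>q w u + \<kappa> * dist y w - (q w u + \<kappa> * dist y' w)\<bar> \<le> \<kappa> * dist y y'"
      using \<kappa> by (simp add: right_diff_distrib[symmetric] abs_mult mult_left_mono)
  qed (use lb that in auto)
  show ?thesis
  proof (rule that[of M \<kappa> p, OF M0 \<kappa>])
    fix y u assume u: "u \<in> U"
    show "\<bar>p y u\<bar> \<le> M" using rlb[OF u, of y] M0 by (auto simp: p_def)
  next
    fix y y' u assume u: "u \<in> U"
    show "\<bar>p y u - p y' u\<bar> \<le> \<kappa> * dist y y'" using rlip[OF u, of y y'] by (auto simp: p_def min_def)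
  next
    fix y u assume y: "y \<in> A" and u: "u \<in> U"
    have "r y u \<le> q y u + \<kappa> * dist y y" unfolding r_def by (rule cINF_lower[OF bdd[OF u] y])
    then show "p y u \<le> q y u" by (simp add: p_def)
    have "q y u - \<delta> \<le> r y u"
      unfolding r_def
    proof (rule cINF_greatest[OF A(2)])
      fix w assume w: "w \<in> A"
      show "q y u - \<delta> \<le> q w u + \<kappa> * dist y w"
      proof (cases "dist y w < d")
        case True
        then have "dist (q y u) (q w u) < \<delta>"
          using d(2)[of "(w, u)" "(y, u)"] w y u by (simp add: dist_Pair_Pair)
        moreover have "0 \<le> \<kappa> * dist y w" using \<kappa> by simp
        ultimately show ?thesis unfolding dist_real_def by linarith
      next
        case False
        then have "\<kappa> * d \<le> \<kappa> * dist y w" using \<kappa> by (intro mult_left_mono) auto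
        moreover have "\<kappa> * d = 2 * M" using d by (simp add: \<kappa>_def)
        ultimately show ?thesis using M[OF y u] M[OF w u] \<delta> by linarith
      qed
    qed
    then show "q y u \<le> p y u + \<delta>" using M[OF y u] \<delta> by (auto simp: p_def)
  qed
qed

text \<open>The optimal cost of \<open>n\<close> steps of length \<open>h\<close> of the explicit Euler scheme. Unlike the value function of the
system itself, it satisfies the dynamic programming principle by definition and needs no trajectories.\<close>

primrec euler_value ::
  "('a::real_vector \<Rightarrow> 'u \<Rightarrow> 'a) \<Rightarrow> 'u set \<Rightarrow> ('a \<Rightarrow> 'u \<Rightarrow> real) \<Rightarrow> real \<Rightarrow> nat \<Rightarrow> 'a \<Rightarrow> real" where
  "euler_value f U q h 0 y = 0"
| "euler_value f U q h (Suc n) y = (INF u\<in>U. h * q y u + euler_value f U q h n (y + h *\<^sub>R f y u))"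

context control_system
begin

context
  fixes q :: "'a \<Rightarrow> 'u \<Rightarrow> real" and M \<kappa> h :: real
  assumes U_nonempty: "U \<noteq> {}" and h: "h > 0"
    and q_bound: "\<And>y u. u \<in> U \<Longrightarrow> \<bar>q y u\<bar> \<le> M"
    and q_lip: "\<And>y y' u. u \<in> U \<Longrightarrow> \<bar>q y u - q y' u\<bar> \<le> \<kappa> * dist y y'"
    and \<kappa>: "\<kappa> \<ge> 0"
begin

abbreviation "V \<equiv> euler_value f U q h"

lemma euler_value_bound: "\<bar>V n y\<bar> \<le> real n * h * M"
proof (induction n arbitrary: y)
  case (Suc n)
  have b: "\<bar>h * q y u + V n (y + h *\<^sub>R f y u)\<bar> \<le> real (Suc n) * h * M" if "u \<in> U" for u
  proof -
    have "\<bar>h * q y u\<bar> \<le> h * M" using q_bound[OF that, of y] h by (simp add: abs_mult)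
    then show ?thesis using Suc[of "y + h *\<^sub>R f y u"] by (simp add: algebra_simps)
  qed
  obtain u where u: "u \<in> U" using U_nonempty by blast
  have "- (real (Suc n) * h * M) \<le> V (Suc n) y"
    unfolding euler_value.simps
  proof (rule cINF_greatest[OF U_nonempty])
    fix u assume "u \<in> U"
    then show "- (real (Suc n) * h * M) \<le> h * q y u + V n (y + h *\<^sub>R f y u)" using b[of u] by linarith
  qed
  moreover have "V (Suc n) y \<le> h * q y u + V n (y + h *\<^sub>R f y u)"
    unfolding euler_value.simps
  proof (rule cINF_lower[OF _ u], rule bdd_belowI2[of _ "- (real (Suc n) * h * M)"])
    fix u assume "u \<in> U"
    then show "- (real (Suc n) * h * M) \<le> h * q y u + V n (y + h *\<^sub>R f y u)" using b[of u] by linarith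
  qed
  ultimately show ?case using b[OF u] by linarith
qed simp

lemma euler_value_lower: "- (h * M + real n * h * M) \<le> h * q y u + V n (y + h *\<^sub>R f y u)" if "u \<in> U"
proof -
  have "\<bar>h * q y u\<bar> \<le> h * M" using q_bound[OF that, of y] h by (simp add: abs_mult)
  then show ?thesis using euler_value_bound[of n "y + h *\<^sub>R f y u"] by linarith
qed

lemma euler_value_le:
  assumes "u \<in> U" shows "V (Suc n) y \<le> h * q y u + V n (y + h *\<^sub>R f y u)"
  unfolding euler_value.simps
  by (rule cINF_lower[OF _ assms], rule bdd_belowI2[OF euler_value_lower])

lemma euler_value_lipschitz:
  "\<bar>V n x - V n y\<bar> \<le> real n * h * \<kappa> * (1 + h * L) ^ n * norm (x - y)"
proof (induction n arbitrary: x y)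
  case (Suc n)
  show ?case
    unfolding euler_value.simps
  proof (rule INF_lipschitz[OF U_nonempty euler_value_lower euler_value_lower])
    fix u assume u: "u \<in> U"
    let ?x = "x + h *\<^sub>R f x u" and ?y = "y + h *\<^sub>R f y u"
    let ?P = "(1 + h * L) ^ n"
    have P1: "1 \<le> ?P" using h L_pos by (auto intro!: one_le_power)
    have P: "1 \<le> ?P" "1 \<le> ?P * (1 + h * L)"
      using P1 h L_pos mult_mono[of 1 ?P 1 "1 + h * L"] by auto
    have eq: "?x - ?y = (x - y) + h *\<^sub>R (f x u - f y u)" by (simp add: algebra_simps)
    have "norm (?x - ?y) \<le> norm (x - y) + h * norm (f x u - f y u)"
      unfolding eq using norm_triangle_ineq[of "x - y" "h *\<^sub>R (f x u - f y u)"] h by simp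
    also have "\<dots> \<le> norm (x - y) + h * (L * norm (x - y))"
      using f_lip[OF u] h by (intro add_left_mono mult_left_mono) auto
    finally have d: "norm (?x - ?y) \<le> (1 + h * L) * norm (x - y)" by (simp add: algebra_simps)
    have "\<bar>V n ?x - V n ?y\<bar> \<le> real n * h * \<kappa> * ?P * norm (?x - ?y)" by (rule Suc)
    also have "\<dots> \<le> real n * h * \<kappa> * ?P * ((1 + h * L) * norm (x - y))"
      using d h \<kappa> P by (intro mult_left_mono) auto
    finally have 1: "\<bar>V n ?x - V n ?y\<bar> \<le> real n * h * \<kappa> * (?P * (1 + h * L)) * norm (x - y)"
      by (simp add: mult.assoc)
    have "\<bar>h * q x u - h * q y u\<bar> = h * \<bar>q x u - q y u\<bar>"
      using h by (simp add: right_diff_distrib[symmetric] abs_mult)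
    also have "\<dots> \<le> h * (\<kappa> * norm (x - y))"
      using q_lip[OF u] h by (intro mult_left_mono) (auto simp: dist_norm)
    also have "\<dots> = h * \<kappa> * norm (x - y) * 1" by simp
    also have "\<dots> \<le> h * \<kappa> * norm (x - y) * (?P * (1 + h * L))"
      using P h \<kappa> by (intro mult_left_mono) auto
    finally have 2: "\<bar>h * q x u - h * q y u\<bar> \<le> h * \<kappa> * norm (x - y) * (?P * (1 + h * L))" .
    have "\<bar>h * q x u + V n ?x - (h * q y u + V n ?y)\<bar>
        \<le> real n * h * \<kappa> * (?P * (1 + h * L)) * norm (x - y) + h * \<kappa> * norm (x - y) * (?P * (1 + h * L))"
      using 1 2 by linarith
    also have "\<dots> = real (Suc n) * h * \<kappa> * (1 + h * L) ^ Suc n * norm (x - y)"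
      by (simp add: algebra_simps)
    finally show "\<bar>h * q x u + V n ?x - (h * q y u + V n ?y)\<bar>
        \<le> real (Suc n) * h * \<kappa> * (1 + h * L) ^ Suc n * norm (x - y)" .
  qed
qed simp

text \<open>A Lipschitz constant that depends on the horizon \<open>T\<close> but not on the step size.\<close>

lemma euler_value_lipschitz':
  assumes n: "n \<le> N"
  defines "T \<equiv> real N * h"
  shows "\<bar>V n x - V n y\<bar> \<le> T * \<kappa> * exp (L * T) * norm (x - y)"
proof -
  have nT: "real n * h \<le> T" and T0: "T \<ge> 0" using n h by (simp_all add: T_def)
  have "(1 + h * L) ^ n \<le> exp (h * L) ^ n"
    using h L_pos by (intro power_mono) auto
  also have "\<dots> = exp (real n * h * L)" by (simp add: exp_of_nat_mult[symmetric] mult.assoc)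
  also have "\<dots> \<le> exp (L * T)" using nT L_pos by (simp add: mult.commute)
  finally have "(1 + h * L) ^ n \<le> exp (L * T)" .
  then have "real n * h * \<kappa> * (1 + h * L) ^ n * norm (x - y) \<le> T * \<kappa> * exp (L * T) * norm (x - y)"
    using nT T0 h \<kappa> L_pos by (intro mult_right_mono mult_mono) auto
  then show ?thesis using euler_value_lipschitz[of n x y] by linarith
qed

text \<open>Near-optimal Euler controls, applied as piecewise constant controls to the system, do almost as well. In every step the
true trajectory restarts from its own position, which differs from the Euler position by \<open>O(h\<^sup>2)\<close>; the Lipschitz constant
\<open>\<Lambda>\<close> of the remaining value converts this into a cost, and no error propagation has to be followed. The trajectories stay
in \<open>A\<close>, where \<open>F\<close> bounds the velocity.\<close>

lemma euler_value_dominates_trajectory_cost: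
  fixes c :: "'a \<Rightarrow> 'u \<Rightarrow> real"
  assumes A: "forward_invariant f U A"
    and c: "continuous_on (A \<times> U) (\<lambda>(y, u). c y u)"
    and cq: "\<And>y u. y \<in> A \<Longrightarrow> u \<in> U \<Longrightarrow> c y u \<le> q y u + \<delta>"
    and F: "\<And>y u. y \<in> A \<Longrightarrow> u \<in> U \<Longrightarrow> norm (f y u) \<le> F"
    and \<Lambda>: "\<And>n x y. n \<le> N \<Longrightarrow> \<bar>V n x - V n y\<bar> \<le> \<Lambda> * norm (x - y)" "\<Lambda> \<ge> 0"
    and \<epsilon>: "\<epsilon> > 0" and y: "y \<in> A" and n: "n \<le> N"
  shows "\<exists>u \<xi>. control U u \<and> solves f u y \<xi> \<and>
    integral {0..real n * h} (\<lambda>s. c (\<xi> s) (u s)) \<le>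
      V n y + real n * (h * (\<delta> + \<kappa> * F * h) + \<Lambda> * (L * F * h * h) + \<epsilon>)"
  using y n
proof (induction n arbitrary: y)
  case 0
  obtain u where u: "u \<in> U" using U_nonempty by blast
  then obtain \<xi> where "solves f (\<lambda>_. u) y \<xi>" using constant_control_solution by blast
  then show ?case using constant_control[OF u] by (intro exI[of _ "\<lambda>_. u"] exI[of _ \<xi>]) simp
next
  case (Suc n)
  let ?E = "h * (\<delta> + \<kappa> * F * h) + \<Lambda> * (L * F * h * h) + \<epsilon>"
  have "\<exists>u\<in>U. h * q y u + V n (y + h *\<^sub>R f y u) < V (Suc n) y + \<epsilon>"
    unfolding euler_value.simps
    using \<epsilon> by (subst cINF_less_iff[symmetric]) (auto simp: U_nonempty intro!: bdd_belowI2[OF euler_value_lower])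
  then obtain u where u: "u \<in> U" and opt: "h * q y u + V n (y + h *\<^sub>R f y u) < V (Suc n) y + \<epsilon>" by blast
  obtain \<xi> where s1: "solves f (\<lambda>_. u) y \<xi>" using constant_control_solution[OF u] by blast
  have cu: "control U (\<lambda>_. u)" by (rule constant_control[OF u])
  have inA: "\<xi> t \<in> A" if "t \<ge> 0" for t
    using A s1 cu Suc.prems(1) that unfolding forward_invariant_def by blast
  have F0: "F \<ge> 0" using F[OF Suc.prems(1) u] norm_ge_zero order_trans by blast
  have fint: "(\<lambda>s. f (\<xi> s) u) integrable_on {0..t}" if "t \<ge> 0" for t
    using s1 that set_lebesgue_integral_eq_integral(1) unfolding solves_iff by blast
  have near: "norm (\<xi> t - y) \<le> F * h" if t: "t \<in> {0..h}" for t
  proof -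
    have "norm (\<xi> t - y) = norm (integral {0..t} (\<lambda>s. f (\<xi> s) u))"
      using s1 t unfolding solves_iff by auto
    also have "\<dots> \<le> integral {0..t} (\<lambda>s. F)"
      by (rule integral_norm_bound_integral) (use fint t F inA u in auto)
    also have "\<dots> \<le> F * h" using t F0 by (simp add: mult.commute mult_left_mono)
    finally show ?thesis .
  qed
  let ?x = "\<xi> h" and ?e = "y + h *\<^sub>R f y u"
  have step: "norm (?x - ?e) \<le> L * F * h * h"
  proof -
    have "?x = y + integral {0..h} (\<lambda>s. f (\<xi> s) u)" using s1 h unfolding solves_iff by simp
    then have "?x - ?e = integral {0..h} (\<lambda>s. f (\<xi> s) u - f y u)"
      using Henstock_Kurzweil_Integration.integral_diff[OF fint[of h] integrable_const_ivl[of "f y u" 0 h]] h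
      by simp
    also have "norm \<dots> \<le> integral {0..h} (\<lambda>s. L * (F * h))"
    proof (rule integral_norm_bound_integral)
      fix s assume "s \<in> {0..h}"
      then show "norm (f (\<xi> s) u - f y u) \<le> L * (F * h)"
        using f_lip[OF u, of "\<xi> s" y] near[of s] L_pos by (meson mult_left_mono order_trans less_imp_le)
    qed (use fint[of h] h in \<open>auto intro!: Henstock_Kurzweil_Integration.integrable_diff\<close>)
    finally show ?thesis using h by (simp add: mult.commute mult.left_commute)
  qed
  have V_step: "V n ?x \<le> V n ?e + \<Lambda> * (L * F * h * h)"
    using \<Lambda>(1)[of n ?x ?e] mult_left_mono[OF step \<Lambda>(2)] Suc.prems(2) by linarith
  have cint: "(\<lambda>s. c (\<xi> s) u) absolutely_integrable_on {0..h}"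
    using running_cost_integrable(1)[OF c solves_continuous[OF s1] _ cu, of h] inA by (auto simp: image_subset_iff)
  have cost1: "integral {0..h} (\<lambda>s. c (\<xi> s) u) \<le> h * q y u + h * (\<delta> + \<kappa> * F * h)"
  proof -
    have "integral {0..h} (\<lambda>s. c (\<xi> s) u) \<le> integral {0..h} (\<lambda>s. q y u + (\<delta> + \<kappa> * F * h))"
    proof (rule integral_le)
      fix s assume s: "s \<in> {0..h}"
      have "\<bar>q (\<xi> s) u - q y u\<bar> \<le> \<kappa> * (F * h)"
        using q_lip[OF u, of "\<xi> s" y] mult_left_mono[OF near[OF s] \<kappa>] by (simp add: dist_norm)
      then show "c (\<xi> s) u \<le> q y u + (\<delta> + \<kappa> * F * h)"
        using cq[OF inA u, of s] s by (auto simp: mult.assoc)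
    qed (use cint set_lebesgue_integral_eq_integral(1) in auto)
    then show ?thesis using h by (simp add: algebra_simps)
  qed
  obtain u2 \<xi>2 where s2: "control U u2" "solves f u2 ?x \<xi>2"
    and cost2: "integral {0..real n * h} (\<lambda>s. c (\<xi>2 s) (u2 s)) \<le> V n ?x + real n * ?E"
    using Suc.IH[of ?x] inA[of h] h Suc.prems(2) by auto
  have inA2: "\<xi>2 t \<in> A" if "t \<ge> 0" for t
    using A s2 inA[of h] h that unfolding forward_invariant_def by force
  have c2int: "(\<lambda>s. c (\<xi>2 s) (u2 s)) absolutely_integrable_on {0..real n * h}"
    using running_cost_integrable(1)[OF c solves_continuous[OF s2(2)] _ s2(1), of "real n * h"] inA2 by (auto simp: image_subset_iff)
  let ?u = "concat_at h (\<lambda>_. u) u2" and ?\<xi> = "concat_at h \<xi> \<xi>2"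
  have cc: "c (?\<xi> t) (?u t) = (if t < h then c (\<xi> t) u else c (\<xi>2 (t - h)) (u2 (t - h)))" for t
    by (simp add: concat_at_def)
  have "integral {0..h + real n * h} (\<lambda>s. c (?\<xi> s) (?u s)) =
      integral {0..h} (\<lambda>s. c (\<xi> s) u) + integral {0..real n * h} (\<lambda>s. c (\<xi>2 s) (u2 s))"
    by (rule concat_integral(2)[OF cint c2int _ _ cc]) (use h in auto)
  also have "\<dots> \<le> V (Suc n) y + real (Suc n) * ?E"
    using cost1 cost2 V_step opt by (simp add: algebra_simps)
  finally have "integral {0..real (Suc n) * h} (\<lambda>s. c (?\<xi> s) (?u s)) \<le> V (Suc n) y + real (Suc n) * ?E"
    by (simp add: algebra_simps)
  then show ?case
    using concat_trajectory[OF cu s1 s2] h by (intro exI[of _ ?u] exI[of _ ?\<xi>]) auto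
qed

text \<open>The dynamic programming inequalities for the horizons \<open>1, ..., N\<close>, added up. The horizons on the left are those on the
right shifted by one, so only the value with horizon \<open>N\<close> remains, the one with horizon \<open>0\<close> being \<open>0\<close>.\<close>

lemma euler_value_sum_le:
  assumes u: "u \<in> U"
  shows "(\<Sum>n<N. V n y) + V N y \<le> real N * h * q y u + (\<Sum>n<N. V n (y + h *\<^sub>R f y u))"
proof (induction N)
  case (Suc N)
  then show ?case using euler_value_le[OF u, of N y] by (simp add: algebra_simps del: euler_value.simps(2))
qed simp

end

text \<open>Replace the cost by a Lipschitz minorant \<open>p\<close> and let \<open>\<Phi>\<close> be the sum of the Euler values with horizons \<open>n * h < T = N * h\<close>. By \<open>euler_value_sum_le\<close>,
\<open>V N x \<le> T * p x u + (\<Phi> (x + h * f x u) - \<Phi> x)\<close> for all \<open>x\<close>; mollification turns the last difference into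
\<open>h * (grad \<bullet> f)\<close>, and division by \<open>T\<close> gives the claim for \<open>\<eta> = \<Phi> / N\<close>, up to errors. The
parameters are chosen in the order \<open>T\<close>, \<open>\<epsilon>\<close>, \<open>h\<close>: the errors of translating by at most \<open>\<epsilon>\<close> are
\<open>O(\<epsilon>)\<close> for fixed \<open>T\<close>, uniformly in \<open>h\<close>, while the Taylor error of the mollified function and the
error of the Euler scheme are \<open>O(h)\<close> for fixed \<open>T\<close> and \<open>\<epsilon>\<close>.\<close>

theorem smooth_subsolution_exists:
  fixes c :: "'a \<Rightarrow> 'u \<Rightarrow> real"
  assumes A: "compact A" "forward_invariant f U A"
    and c: "continuous_on (A \<times> U) (\<lambda>(y, u). c y u)"
    and T: "T > 0" and d: "d > 0"
    and lower: "\<And>y u \<xi>. y \<in> A \<Longrightarrow> control U u \<Longrightarrow> solves f u y \<xi> \<Longrightarrow>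
      m \<le> integral {0..T} (\<lambda>s. c (\<xi> s) (u s))"
  shows "\<exists>\<eta>\<in>C1. \<forall>y\<in>A. \<forall>u\<in>U. m / T - d \<le> c y u + grad \<eta> y \<bullet> f y u"
proof (cases "A = {} \<or> U = {}")
  case True
  have "((\<lambda>_. 0) has_derivative (\<lambda>h. (0::'a) \<bullet> h)) (at y)" for y :: 'a
    by simp
  then have "(\<lambda>_::'a. 0) \<in> C1" by (rule C1_I(1)[where g="\<lambda>_. 0"]) auto
  then show ?thesis using True by blast
next
  case False
  then have ne: "A \<noteq> {}" "U \<noteq> {}" by auto
  obtain p \<kappa> M where M: "M \<ge> 0" and \<kappa>: "\<kappa> \<ge> 0"
    and pM: "\<And>y u. u \<in> U \<Longrightarrow> \<bar>p y u\<bar> \<le> M"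
    and plip: "\<And>y y' u. u \<in> U \<Longrightarrow> \<bar>p y u - p y' u\<bar> \<le> \<kappa> * dist y y'"
    and pc: "\<And>y u. y \<in> A \<Longrightarrow> u \<in> U \<Longrightarrow> p y u \<le> c y u"
    and cp: "\<And>y u. y \<in> A \<Longrightarrow> u \<in> U \<Longrightarrow> c y u \<le> p y u + d / 4"
  proof -
    have "d / 4 > 0" using d by simp
    then show ?thesis
      by (rule lipschitz_minorant[OF A(1) ne(1) compact_U ne(2) c]) (rule that; assumption)
  qed
  obtain F where F: "\<And>y u. y \<in> A \<Longrightarrow> u \<in> U \<Longrightarrow> norm (f y u) \<le> F"
  proof -
    have AU: "compact (A \<times> U)" using A compact_U by (auto intro: compact_Times)
    have "continuous_on (A \<times> U) (\<lambda>(y, u). f y u)" using f_cont by (rule continuous_on_subset) auto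
    from compact_imp_bounded[OF compact_continuous_image[OF this AU]] obtain F where
      "\<forall>x\<in>(\<lambda>(y, u). f y u) ` (A \<times> U). norm x \<le> F" unfolding bounded_iff by blast
    then show ?thesis using that by (metis (no_types, lifting) SigmaI case_prod_conv image_eqI)
  qed
  have F0: "F \<ge> 0" using F ne by (meson all_not_in_conv norm_ge_zero order_trans)
  define \<Lambda> where "\<Lambda> = T * \<kappa> * exp (L * T)"
  have \<Lambda>: "\<Lambda> \<ge> 0" using T \<kappa> by (simp add: \<Lambda>_def)
  \<comment> \<open>the translation error, divided by \<open>T\<close>, is \<open>\<epsilon> * (\<Lambda> / T + \<kappa> + \<Lambda> * L)\<close>\<close>
  define \<epsilon> where "\<epsilon> = d / (4 * (\<Lambda> / T + \<kappa> + \<Lambda> * L + 1))"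
  have den: "\<Lambda> / T + \<kappa> + \<Lambda> * L \<ge> 0" using \<Lambda> T \<kappa> L_pos by simp
  have \<epsilon>: "\<epsilon> > 0" using d den by (simp add: \<epsilon>_def)
  have \<epsilon>d: "\<epsilon> * (\<Lambda> / T + \<kappa> + \<Lambda> * L) \<le> d / 4"
  proof -
    have "d / (4 * (D + 1)) * D \<le> d / 4" if "D \<ge> 0" for D
      using that d by (simp add: field_simps)
    from this[OF den] show ?thesis by (simp add: \<epsilon>_def)
  qed
  define K where "K = ((2 * \<epsilon> + 3)\<^sup>2 + 2 * \<epsilon>\<^sup>2) * measure lborel (cball (0::'a) (\<epsilon> + 1))
    / (\<integral>w. bump \<epsilon> (w::'a) \<partial>lborel)"
  have K: "K \<ge> 0" unfolding K_def using bump_mass_pos[OF \<epsilon>, where 'a='a]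
    by (intro divide_nonneg_pos mult_nonneg_nonneg) auto
  \<comment> \<open>\<open>h * X\<close> collects the remaining errors: two from the Euler scheme and one from the Taylor expansion\<close>
  define X where "X = \<kappa> * F + \<Lambda> * (L * F) + K * T * M * F\<^sup>2"
  have X: "X \<ge> 0" using \<kappa> F0 \<Lambda> L_pos K T M by (simp add: X_def)
  obtain N where N: "real N > max (T * F) (4 * T * X / d)" using reals_Archimedean2 by blast
  then have N1: "real N > T * F" "real N > 4 * T * X / d" by auto
  have N0: "real N > 0" using N1(1) T F0 by (smt (verit) mult_nonneg_nonneg)
  define h where "h = T / real N"
  have h: "h > 0" and Nh: "real N * h = T" using T N0 by (auto simp: h_def)
  have hF: "h * F \<le> 1" using N1(1) N0 by (simp add: h_def field_simps)
  have hX: "h * X \<le> d / 4" using N1(2) N0 d by (simp add: h_def field_simps)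
  let ?V = "euler_value f U p h"
  note ev = ne(2) h pM plip \<kappa>
  have Vlip: "\<bar>?V n x - ?V n y\<bar> \<le> \<Lambda> * norm (x - y)" if "n \<le> N" for n x y
    using euler_value_lipschitz'[where q=p and M=M and \<kappa>=\<kappa> and h=h, OF ev that] by (simp add: \<Lambda>_def Nh)
  define \<Phi> where "\<Phi> y = (\<Sum>n<N. ?V n y)" for y
  have \<Phi>lip: "\<bar>\<Phi> x - \<Phi> y\<bar> \<le> real N * \<Lambda> * norm (x - y)" for x y
  proof -
    have "\<bar>\<Phi> x - \<Phi> y\<bar> \<le> (\<Sum>n<N. \<bar>?V n x - ?V n y\<bar>)"
      unfolding \<Phi>_def sum_subtractf[symmetric] by (rule sum_abs)
    also have "\<dots> \<le> (\<Sum>n<N. \<Lambda> * norm (x - y))" by (rule sum_mono) (use Vlip in auto)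
    finally show ?thesis by simp
  qed
  have \<Phi>bound: "\<bar>\<Phi> x\<bar> \<le> real N * (T * M)" for x
  proof -
    have "\<bar>\<Phi> x\<bar> \<le> (\<Sum>n<N. \<bar>?V n x\<bar>)" unfolding \<Phi>_def by (rule sum_abs)
    also have "\<dots> \<le> (\<Sum>n<N. T * M)"
    proof (rule sum_mono)
      fix n assume "n \<in> {..<N}"
      then have "real n * h * M \<le> T * M" unfolding Nh[symmetric] using h M by (intro mult_right_mono) auto
      then show "\<bar>?V n x\<bar> \<le> T * M" using euler_value_bound[where q=p and M=M and \<kappa>=\<kappa> and h=h, OF ev, where n=n and y=x] by linarith
    qed
    finally show ?thesis by simp
  qed
  define \<eta>0 where "\<eta>0 = mollify \<epsilon> \<Phi>"
  have \<eta>C1: "\<eta>0 \<in> C1" unfolding \<eta>0_def by (rule mollify_smooth(1)[OF \<epsilon> \<Phi>lip])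
  have taylor: "\<bar>\<eta>0 (y + v) - \<eta>0 y - grad \<eta>0 y \<bullet> v\<bar> \<le> K * (real N * (T * M)) * (norm v)\<^sup>2"
    if "norm v \<le> 1" for y v
    unfolding \<eta>0_def K_def by (rule mollify_smooth(2)[OF \<epsilon> \<Phi>lip that \<Phi>bound])
  have \<Phi>c: "continuous_on UNIV \<Phi>"
    by (rule lipschitz_on_continuous_on[of "real N * \<Lambda>"], rule lipschitz_onI)
      (use \<Phi>lip \<Lambda> in \<open>auto simp: dist_norm\<close>)
  have Vlow: "m / T - d / 4 - h * (\<kappa> * F + \<Lambda> * (L * F)) \<le> ?V N y / T" if y: "y \<in> A" for y
  proof -
    have "m \<le> ?V N y + real N * (h * (d / 4 + \<kappa> * F * h) + \<Lambda> * (L * F * h * h))"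
    proof (rule field_le_epsilon)
      fix e :: real assume e: "e > 0"
      then have e': "e / real N > 0" using N0 by simp
      obtain u \<xi> where "control U u" "solves f u y \<xi>"
        "integral {0..real N * h} (\<lambda>s. c (\<xi> s) (u s)) \<le>
          ?V N y + real N * (h * (d / 4 + \<kappa> * F * h) + \<Lambda> * (L * F * h * h) + e / real N)"
        using euler_value_dominates_trajectory_cost[where q=p and M=M and \<kappa>=\<kappa> and h=h, OF ev A(2) c cp F Vlip \<Lambda> e' y order_refl] by blast
      moreover from this have "m \<le> integral {0..real N * h} (\<lambda>s. c (\<xi> s) (u s))"
        using lower[OF y] unfolding Nh by blast
      moreover have "real N * (h * (d / 4 + \<kappa> * F * h) + \<Lambda> * (L * F * h * h) + e / real N)
        = real N * (h * (d / 4 + \<kappa> * F * h) + \<Lambda> * (L * F * h * h)) + e"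
        using N0 by (simp add: distrib_left)
      ultimately show "m \<le> ?V N y + real N * (h * (d / 4 + \<kappa> * F * h) + \<Lambda> * (L * F * h * h)) + e"
        by linarith
    qed
    also have "real N * (h * (d / 4 + \<kappa> * F * h) + \<Lambda> * (L * F * h * h))
        = (real N * h) * (d / 4 + h * (\<kappa> * F + \<Lambda> * (L * F)))" by (simp add: algebra_simps)
    finally have "m \<le> ?V N y + T * (d / 4 + h * (\<kappa> * F + \<Lambda> * (L * F)))" unfolding Nh .
    then have "m / T \<le> (?V N y + T * (d / 4 + h * (\<kappa> * F + \<Lambda> * (L * F)))) / T"
      using T by (simp add: divide_right_mono)
    also have "\<dots> = ?V N y / T + (d / 4 + h * (\<kappa> * F + \<Lambda> * (L * F)))" using T by (simp add: add_divide_distrib)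
    finally show ?thesis by linarith
  qed
  have main: "m / T - d \<le> c y u + grad (\<lambda>y. 1 / real N * \<eta>0 y) y \<bullet> f y u" if y: "y \<in> A" and u: "u \<in> U" for y u
  proof -
    let ?v = "h *\<^sub>R f y u"
    let ?a = "?V N y - \<Lambda> * \<epsilon> - T * (p y u + \<kappa> * \<epsilon>) - real N * \<Lambda> * (h * (L * \<epsilon>))"
    have "?a \<le> \<eta>0 (y + ?v) - \<eta>0 y"
      unfolding \<eta>0_def
    proof (rule mollify_mono[OF \<epsilon> \<Phi>c])
      fix w :: 'a assume w: "norm w \<le> \<epsilon>"
      let ?x = "y + w"
      have dp: "\<Phi> ?x + ?V N ?x \<le> T * p ?x u + \<Phi> (?x + h *\<^sub>R f ?x u)"
        using euler_value_sum_le[where q=p and M=M and \<kappa>=\<kappa> and h=h, OF ev u, where N=N and y="?x"] by (simp add: \<Phi>_def Nh)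
      have eq: "(?x + h *\<^sub>R f ?x u) - (y + ?v + w) = h *\<^sub>R (f ?x u - f y u)"
        by (simp add: scaleR_diff_right)
      have "norm ((?x + h *\<^sub>R f ?x u) - (y + ?v + w)) = h * norm (f ?x u - f y u)"
        unfolding eq using h by simp
      also have "\<dots> \<le> h * (L * \<epsilon>)"
      proof -
        have "L * norm w \<le> L * \<epsilon>" using w L_pos by simp
        then have "norm (f ?x u - f y u) \<le> L * \<epsilon>" using f_lip[OF u, of ?x y] by simp
        then show ?thesis using h by simp
      qed
      finally have "norm ((?x + h *\<^sub>R f ?x u) - (y + ?v + w)) \<le> h * (L * \<epsilon>)" .
      then have "real N * \<Lambda> * norm ((?x + h *\<^sub>R f ?x u) - (y + ?v + w)) \<le> real N * \<Lambda> * (h * (L * \<epsilon>))"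
        using \<Lambda> by (intro mult_left_mono) auto
      then have 1: "\<Phi> (?x + h *\<^sub>R f ?x u) \<le> \<Phi> (y + ?v + w) + real N * \<Lambda> * (h * (L * \<epsilon>))"
        using \<Phi>lip[of "?x + h *\<^sub>R f ?x u" "y + ?v + w"] by linarith
      have "\<kappa> * norm w \<le> \<kappa> * \<epsilon>" using w \<kappa> by (intro mult_left_mono) auto
      then have "p ?x u \<le> p y u + \<kappa> * \<epsilon>" using plip[OF u, of ?x y] by (simp add: dist_norm)
      then have 2: "T * p ?x u \<le> T * (p y u + \<kappa> * \<epsilon>)" using T by (intro mult_left_mono) auto
      have "\<Lambda> * norm w \<le> \<Lambda> * \<epsilon>" using w \<Lambda> by (intro mult_left_mono) auto
      then have 3: "?V N y - \<Lambda> * \<epsilon> \<le> ?V N ?x" using Vlip[of N ?x y] by simp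
      show "?a \<le> \<Phi> (y + ?v + w) - \<Phi> (y + w)" using dp 1 2 3 by linarith
    qed
    moreover have nv: "norm ?v \<le> h * F" using F[OF y u] h by simp
    then have "norm ?v \<le> 1" using hF by linarith
    then have "\<eta>0 (y + ?v) - \<eta>0 y \<le> grad \<eta>0 y \<bullet> ?v + K * (real N * (T * M)) * (norm ?v)\<^sup>2"
      using taylor[of ?v y] by linarith
    moreover have "K * (real N * (T * M)) * (norm ?v)\<^sup>2 \<le> K * (real N * (T * M)) * (h * F)\<^sup>2"
      using nv K T M by (intro mult_left_mono power_mono) auto
    ultimately have "?a \<le> h * (grad \<eta>0 y \<bullet> f y u) + K * (real N * (T * M)) * (h * F)\<^sup>2" by simp
    then have "?a / T \<le> (h * (grad \<eta>0 y \<bullet> f y u) + K * (real N * (T * M)) * (h * F)\<^sup>2) / T"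
      using T by (simp add: divide_right_mono)
    also have "\<dots> = grad \<eta>0 y \<bullet> f y u / real N + h * (K * T * M * F\<^sup>2)"
      unfolding Nh[symmetric] using h N0 by (simp add: field_simps power2_eq_square)
    finally have e1: "?a / T \<le> grad \<eta>0 y \<bullet> f y u / real N + h * (K * T * M * F\<^sup>2)" .
    have e2: "?a / T = ?V N y / T - \<epsilon> * (\<Lambda> / T + \<kappa> + \<Lambda> * L) - p y u"
    proof -
      have "real N * \<Lambda> * (h * (L * \<epsilon>)) = (real N * h) * (\<Lambda> * L * \<epsilon>)"
        by (simp add: algebra_simps)
      then have "?a = ?V N y - \<Lambda> * \<epsilon> - T * (p y u + \<kappa> * \<epsilon>) - T * (\<Lambda> * L * \<epsilon>)"
        unfolding Nh by simp
      then show ?thesis using T by (simp add: field_simps)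
    qed
    have e3: "h * X = h * (\<kappa> * F + \<Lambda> * (L * F)) + h * (K * T * M * F\<^sup>2)" by (simp add: X_def algebra_simps)
    have "grad (\<lambda>y. 1 / real N * \<eta>0 y) y \<bullet> f y u = grad \<eta>0 y \<bullet> f y u / real N"
      unfolding C1_scale(2)[OF \<eta>C1] by simp
    then show ?thesis
      using d e1 e2 e3 hX \<epsilon>d Vlow[OF y] pc[OF y u] by linarith
  qed
  show ?thesis
    by (rule bexI[OF _ C1_scale(1)[OF \<eta>C1, of "1 / real N"]]) (intro ballI main)
qed

end


section \<open>Combinations and compactness of measures\<close>

lemma measure_combination:
  fixes M N :: "'a measure" and a b :: ennreal
  assumes MN: "sets N = sets M"
  obtains K where "sets K = sets M"
    "\<And>g. g \<in> borel_measurable M \<Longrightarrow>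
      (\<integral>\<^sup>+x. g x \<partial>K) = a * (\<integral>\<^sup>+x. g x \<partial>M) + b * (\<integral>\<^sup>+x. g x \<partial>N)"
proof -
  define \<mu> where "\<mu> A = a * emeasure M A + b * emeasure N A" for A
  define K where "K = measure_of (space M) (sets M) \<mu>"
  have sK: "sets K = sets M" and spK: "space K = space M" by (auto simp: K_def)
  have e: "emeasure K A = \<mu> A" if "A \<in> sets M" for A
    unfolding K_def
  proof (rule emeasure_measure_of_sigma)
    show "sigma_algebra (space M) (sets M)" ..
    show "positive (sets M) \<mu>" by (simp add: positive_def \<mu>_def)
    show "countably_additive (sets M) \<mu>"
    proof (rule countably_additiveI)
      fix A :: "nat \<Rightarrow> _" assume *: "range A \<subseteq> sets M" "disjoint_family A" "(\<Union>i. A i) \<in> sets M"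
      have "(\<Sum>i. \<mu> (A i)) = (\<Sum>i. a * emeasure M (A i)) + (\<Sum>i. b * emeasure N (A i))"
        unfolding \<mu>_def by (rule suminf_add[symmetric]) auto
      also have "\<dots> = a * (\<Sum>i. emeasure M (A i)) + b * (\<Sum>i. emeasure N (A i))"
        by simp
      also have "\<dots> = \<mu> (\<Union>i. A i)"
        using suminf_emeasure[of A M] suminf_emeasure[of A N] * MN by (simp add: \<mu>_def)
      finally show "(\<Sum>i. \<mu> (A i)) = \<mu> (\<Union>i. A i)" .
    qed
  qed fact
  have "(\<integral>\<^sup>+x. g x \<partial>K) = a * (\<integral>\<^sup>+x. g x \<partial>M) + b * (\<integral>\<^sup>+x. g x \<partial>N)"
    if "g \<in> borel_measurable M" for g
    using that
  proof (induction rule: borel_measurable_induct)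
    case (cong f g)
    have "space N = space M" by (rule sets_eq_imp_space_eq[OF MN])
    then show ?case using cong spK by (simp cong: nn_integral_cong_simp)
  next
    case (set A)
    then show ?case using e sK MN by (simp add: \<mu>_def)
  next
    case (mult u c)
    then show ?case
      using sK MN by (simp add: nn_integral_cmult distrib_left mult.left_commute cong: measurable_cong_sets)
  next
    case (add u v)
    have "u \<in> borel_measurable K" "v \<in> borel_measurable K" "u \<in> borel_measurable N" "v \<in> borel_measurable N"
      using add sK MN by (auto cong: measurable_cong_sets)
    then show ?case using add by (simp add: nn_integral_add distrib_left ac_simps)
  next
    case (seq F)
    have m: "F i \<in> borel_measurable K" "F i \<in> borel_measurable N" for i
      using seq sK MN by (auto cong: measurable_cong_sets)
    have inc: "incseq (\<lambda>i. integral\<^sup>N M (F i))" "incseq (\<lambda>i. integral\<^sup>N N (F i))"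
      using \<open>incseq F\<close> by (auto simp: incseq_def le_fun_def intro!: nn_integral_mono)
    have "(\<integral>\<^sup>+x. (SUP i. F i) x \<partial>K) = (SUP i. integral\<^sup>N K (F i))"
      using nn_integral_monotone_convergence_SUP[OF \<open>incseq F\<close>, of K] m by (simp add: image_image)
    also have "\<dots> = (SUP i. a * integral\<^sup>N M (F i) + b * integral\<^sup>N N (F i))"
      using seq by simp
    also have "\<dots> = (SUP i. a * integral\<^sup>N M (F i)) + (SUP i. b * integral\<^sup>N N (F i))"
      using inc by (intro ennreal_SUP_add) (auto simp: incseq_def intro!: mult_left_mono)
    also have "\<dots> = a * (SUP i. integral\<^sup>N M (F i)) + b * (SUP i. integral\<^sup>N N (F i))"
      by (simp add: SUP_mult_left_ennreal)
    also have "\<dots> = a * (\<integral>\<^sup>+x. (SUP i. F i) x \<partial>M) + b * (\<integral>\<^sup>+x. (SUP i. F i) x \<partial>N)"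
      using nn_integral_monotone_convergence_SUP[OF \<open>incseq F\<close>, of M]
        nn_integral_monotone_convergence_SUP[OF \<open>incseq F\<close>, of N] m \<open>\<And>i. F i \<in> borel_measurable M\<close> by (simp add: image_image)
    finally show ?case .
  qed
  with sK show ?thesis by (rule that)
qed

text \<open>Bounded integrands are shifted to be nonnegative, where the Bochner integral is the nonnegative integral of
\<open>measure_combination\<close>.\<close>

lemma finite_measure_combination:
  fixes M N :: "'a measure" and a b :: real
  assumes MN: "sets N = sets M" and fin: "finite_measure M" "finite_measure N" and ab: "a \<ge> 0" "b \<ge> 0"
  obtains K where "sets K = sets M" "finite_measure K"
    "measure K (space M) = a * measure M (space M) + b * measure N (space M)"
    "\<And>g::'a \<Rightarrow> real. g \<in> borel_measurable M \<Longrightarrow> (\<exists>B. \<forall>x\<in>space M. \<bar>g x\<bar> \<le> B) \<Longrightarrow>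
      (\<integral>x. g x \<partial>K) = a * (\<integral>x. g x \<partial>M) + b * (\<integral>x. g x \<partial>N)"
proof -
  obtain K where K: "sets K = sets M" "\<And>g. g \<in> borel_measurable M \<Longrightarrow>
      (\<integral>\<^sup>+x. g x \<partial>K) = ennreal a * (\<integral>\<^sup>+x. g x \<partial>M) + ennreal b * (\<integral>\<^sup>+x. g x \<partial>N)"
    using measure_combination[OF MN] by metis
  interpret M: finite_measure M by fact
  interpret N: finite_measure N by fact
  have sp: "space K = space M" "space N = space M"
    using sets_eq_imp_space_eq[OF K(1)] sets_eq_imp_space_eq[OF MN] by auto
  have "emeasure K (space M) = ennreal a * emeasure M (space M) + ennreal b * emeasure N (space M)"
    using K(2)[of "indicator (space M)"] K(1) MN by (simp del: nn_integral_indicator_singleton)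
  also have "\<dots> = ennreal (a * measure M (space M) + b * measure N (space M))"
    using ab by (simp add: M.emeasure_eq_measure N.emeasure_eq_measure ennreal_mult)
  finally have em: "emeasure K (space M) = ennreal (a * measure M (space M) + b * measure N (space M))" .
  have mK: "measure K (space M) = a * measure M (space M) + b * measure N (space M)"
    unfolding measure_def[of K] em by (rule enn2real_ennreal) (use ab in simp)
  have fK: "finite_measure K" by (rule finite_measureI) (simp add: sp em)
  interpret K: finite_measure K by fact
  have nonneg: "integrable M g \<and> integrable N g \<and> integrable K g \<and> (\<integral>x. g x \<partial>K) = a * (\<integral>x. g x \<partial>M) + b * (\<integral>x. g x \<partial>N)"
    if g: "g \<in> borel_measurable M" and B: "\<And>x. x \<in> space M \<Longrightarrow> g x \<le> B" "\<And>x. x \<in> space M \<Longrightarrow> 0 \<le> g x" for g B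
  proof -
    have gm: "g \<in> borel_measurable K" "g \<in> borel_measurable N" using g K(1) MN by (auto cong: measurable_cong_sets)
    have i: "integrable M g" "integrable N g" "integrable K g"
      using g gm B sp by (auto intro!: M.integrable_const_bound[of _ B] N.integrable_const_bound[of _ B] K.integrable_const_bound[of _ B] AE_I2)
    have "ennreal (\<integral>x. g x \<partial>K) = (\<integral>\<^sup>+x. ennreal (g x) \<partial>K)"
      by (rule sym, rule nn_integral_eq_integral[OF i(3)]) (use B sp in auto)
    also have "\<dots> = ennreal a * (\<integral>\<^sup>+x. ennreal (g x) \<partial>M) + ennreal b * (\<integral>\<^sup>+x. ennreal (g x) \<partial>N)"
      using g by (intro K(2)) auto
    also have "(\<integral>\<^sup>+x. ennreal (g x) \<partial>M) = ennreal (\<integral>x. g x \<partial>M)"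
      by (rule nn_integral_eq_integral[OF i(1)]) (use B sp in auto)
    also have "(\<integral>\<^sup>+x. ennreal (g x) \<partial>N) = ennreal (\<integral>x. g x \<partial>N)"
      by (rule nn_integral_eq_integral[OF i(2)]) (use B sp in auto)
    finally have e: "ennreal (\<integral>x. g x \<partial>K) = ennreal a * ennreal (\<integral>x. g x \<partial>M) + ennreal b * ennreal (\<integral>x. g x \<partial>N)" .
    have nn: "(\<integral>x. g x \<partial>K) \<ge> 0" "(\<integral>x. g x \<partial>M) \<ge> 0" "(\<integral>x. g x \<partial>N) \<ge> 0"
      using B sp by (auto intro!: integral_nonneg_AE AE_I2)
    have "ennreal (\<integral>x. g x \<partial>K) = ennreal (a * (\<integral>x. g x \<partial>M) + b * (\<integral>x. g x \<partial>N))"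
      unfolding e using ab nn by (simp add: ennreal_mult)
    then have "(\<integral>x. g x \<partial>K) = a * (\<integral>x. g x \<partial>M) + b * (\<integral>x. g x \<partial>N)"
      using ab nn by (subst (asm) ennreal_inj) auto
    then show ?thesis using i by blast
  qed
  show ?thesis
  proof (rule that[OF K(1) fK mK])
    fix g :: "'a \<Rightarrow> real" assume g: "g \<in> borel_measurable M" and "\<exists>B. \<forall>x\<in>space M. \<bar>g x\<bar> \<le> B"
    then obtain B where B: "\<And>x. x \<in> space M \<Longrightarrow> \<bar>g x\<bar> \<le> B" by blast
    have 1: "integrable M (\<lambda>x. g x + B)" "integrable N (\<lambda>x. g x + B)" "integrable K (\<lambda>x. g x + B)"
      "(\<integral>x. g x + B \<partial>K) = a * (\<integral>x. g x + B \<partial>M) + b * (\<integral>x. g x + B \<partial>N)"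
      using nonneg[of "\<lambda>x. g x + B" "2 * B"] g B by (auto simp: abs_le_iff) (fastforce)+
    have i: "integrable M g" "integrable N g" "integrable K g"
      using Bochner_Integration.integrable_diff[OF 1(1) M.integrable_const[of B]]
        Bochner_Integration.integrable_diff[OF 1(2) N.integrable_const[of B]]
        Bochner_Integration.integrable_diff[OF 1(3) K.integrable_const[of B]] by auto
    have "(\<integral>x. g x \<partial>K) + B * measure K (space M) = a * ((\<integral>x. g x \<partial>M) + B * measure M (space M)) + b * ((\<integral>x. g x \<partial>N) + B * measure N (space M))"
      using 1(4) i sp by (simp add: mult.commute)
    then show "(\<integral>x. g x \<partial>K) = a * (\<integral>x. g x \<partial>M) + b * (\<integral>x. g x \<partial>N)"
      unfolding mK by (simp add: algebra_simps)
  qed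
qed


text \<open>The ternary digits below are \<open>0\<close> or \<open>1\<close> and their differences \<open>-1\<close>, \<open>0\<close> or \<open>1\<close>. As \<open>3/2 * (1/3)^(n+1) < (1/3)^n\<close>, a
difference in one digit cannot be compensated by the later ones.\<close>

lemma sum_thirds_tail_le:
  fixes a :: "nat \<Rightarrow> real"
  assumes a: "\<And>j. \<bar>a j\<bar> \<le> 1"
  shows "summable (\<lambda>j. a j * (1/3)^j)"
    and "\<bar>\<Sum>j. a (j + n) * (1/3)^(j + n)\<bar> \<le> (3/2) * (1/3)^n"
proof -
  have b: "norm (a (j + n) * (1/3)^(j + n)) \<le> (1/3)^n * (1/3)^j" for j n
    using a[of "j + n"] by (simp add: abs_mult power_add mult_left_le_one_le mult.commute)
  have g: "summable (\<lambda>j. (1/3::real)^n * (1/3)^j)" for n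
    by (intro summable_mult summable_geometric) simp
  show "summable (\<lambda>j. a j * (1/3)^j)"
    by (rule summable_comparison_test'[OF g[of 0], of 0]) (use b[of _ 0] in simp)
  have sn: "summable (\<lambda>j. norm (a (j + n) * (1/3)^(j + n)))"
    by (rule summable_comparison_test'[OF g[of n], of 0]) (use b[of _ n] in simp)
  have "norm (\<Sum>j. a (j + n) * (1/3)^(j + n)) \<le> (\<Sum>j. norm (a (j + n) * (1/3)^(j + n)))"
    by (rule summable_norm[OF sn])
  also have "\<dots> \<le> (\<Sum>j. (1/3)^n * (1/3)^j)"
    by (rule suminf_le[OF b sn g])
  also have "\<dots> = (3/2) * (1/3)^n"
    by (subst suminf_mult) (auto simp: suminf_geometric)
  finally show "\<bar>\<Sum>j. a (j + n) * (1/3)^(j + n)\<bar> \<le> (3/2) * (1/3)^n" by simp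
qed

text \<open>A point is coded by the ternary number whose digits tell in which balls of a countable family it lies. The code need not be
continuous, but its inverse is uniformly continuous: nearby codes agree in many digits, hence the points lie in a common small
ball.\<close>

lemma compact_real_code:
  fixes K :: "'b::metric_space set"
  assumes K: "compact K" "K \<noteq> {}"
  obtains s :: "'b \<Rightarrow> real" where "s \<in> borel_measurable borel" "\<And>x. \<bar>s x\<bar> \<le> 3/2"
    "\<And>\<epsilon>. \<epsilon> > 0 \<Longrightarrow> \<exists>\<delta>>0. \<forall>x\<in>K. \<forall>x'\<in>K. \<bar>s x - s x'\<bar> < \<delta> \<longrightarrow> dist x x' < \<epsilon>"
proof -
  have "\<exists>D. finite D \<and> D \<subseteq> K \<and> K \<subseteq> (\<Union>d\<in>D. ball d (inverse (real (Suc n))))" for n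
  proof (rule compactE_image[OF K(1), of K "\<lambda>d. ball d (inverse (real (Suc n)))"])
    show "K \<subseteq> (\<Union>d\<in>K. ball d (inverse (real (Suc n))))"
      by (auto simp del: of_nat_Suc intro: bexI)
  qed (simp, blast)
  then obtain D where D: "\<And>n. finite (D n)" "\<And>n. K \<subseteq> (\<Union>d\<in>D n. ball d (inverse (real (Suc n))))"
    by metis
  define C where "C n = (\<lambda>d. ball d (inverse (real (Suc n)))) ` D n" for n
  define B where "B = from_nat_into (\<Union>n. C n)"
  have cC: "countable (\<Union>n. C n)" using D(1) by (auto simp: C_def intro: countable_finite)
  have neC: "(\<Union>n. C n) \<noteq> {}" using K(2) D(2)[of 0] by (auto simp: C_def)
  have B_open: "open (B j)" for j
  proof -
    have "B j \<in> (\<Union>n. C n)" unfolding B_def by (rule from_nat_into[OF neC])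
    then show ?thesis by (auto simp: C_def)
  qed
  have B_surj: "\<exists>j. B j = b" if "b \<in> C n" for b n
    unfolding B_def using from_nat_into_surj[OF cC, of b] that by blast
  define s where "s x = (\<Sum>j. indicator (B j) x * (1/3::real)^j)" for x
  have ind: "\<bar>indicator (B j) x\<bar> \<le> (1::real)" for j x by (simp add: indicator_def)
  show ?thesis
  proof (rule that)
    have [measurable]: "B j \<in> sets borel" for j using B_open by simp
    show "s \<in> borel_measurable borel" unfolding s_def by measurable
    show "\<bar>s x\<bar> \<le> 3/2" for x
      using sum_thirds_tail_le(2)[of "\<lambda>j. indicator (B j) x" 0, OF ind] by (simp add: s_def)
    fix \<epsilon> :: real assume "\<epsilon> > 0"
    then obtain n where n: "inverse (real (Suc n)) < \<epsilon> / 2" using reals_Archimedean[of "\<epsilon>/2"] by auto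
    have "\<exists>N. \<forall>b\<in>C n. \<exists>j<N. B j = b"
    proof -
      obtain J where J: "\<And>b. b \<in> C n \<Longrightarrow> B (J b) = b" using B_surj by metis
      have fin: "finite (C n)" using D(1) by (simp add: C_def)
      have "\<forall>b\<in>C n. J b < Suc (Max (insert 0 (J ` C n)))"
        using fin by (auto simp: less_Suc_eq_le intro!: Max_ge)
      then show ?thesis using J by blast
    qed
    then obtain N where N: "\<And>b. b \<in> C n \<Longrightarrow> \<exists>j<N. B j = b" by blast
    show "\<exists>\<delta>>0. \<forall>x\<in>K. \<forall>x'\<in>K. \<bar>s x - s x'\<bar> < \<delta> \<longrightarrow> dist x x' < \<epsilon>"
    proof (intro exI[of _ "(1/2) * (1/3)^N"] conjI ballI impI)
      fix x x' assume x: "x \<in> K" "x' \<in> K" and close: "\<bar>s x - s x'\<bar> < (1/2) * (1/3)^N"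
      have agree: "x \<in> B j \<longleftrightarrow> x' \<in> B j" if "j < N" for j
      proof (rule ccontr)
        assume ne: "\<not> (x \<in> B j \<longleftrightarrow> x' \<in> B j)"
        define k where "k = (LEAST j. \<not> (x \<in> B j \<longleftrightarrow> x' \<in> B j))"
        have k: "\<not> (x \<in> B k \<longleftrightarrow> x' \<in> B k)" "\<And>i. i < k \<Longrightarrow> (x \<in> B i \<longleftrightarrow> x' \<in> B i)"
          unfolding k_def using LeastI[of "\<lambda>j. \<not> (x \<in> B j \<longleftrightarrow> x' \<in> B j)", OF ne]
            not_less_Least by blast+
        have "k \<le> j" unfolding k_def by (rule Least_le) fact
        then have kN: "k < N" using that by simp
        define a where "a j = (indicator (B j) x - indicator (B j) x' :: real)" for j
        have a1: "\<bar>a j\<bar> \<le> 1" for j by (simp add: a_def indicator_def)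
        have a0: "a i = 0" if "i < k" for i using k(2)[OF that] by (simp add: a_def indicator_def)
        have ak: "\<bar>a k\<bar> = 1" using k(1) by (auto simp: a_def indicator_def)
        have "s x - s x' = (\<Sum>j. a j * (1/3)^j)"
          unfolding s_def a_def left_diff_distrib
          by (rule suminf_diff) (rule sum_thirds_tail_le(1)[OF ind])+
        also have "\<dots> = (\<Sum>j. a (j + Suc k) * (1/3)^(j + Suc k)) + (\<Sum>j<Suc k. a j * (1/3)^j)"
          by (rule suminf_split_initial_segment[OF sum_thirds_tail_le(1)[OF a1]])
        also have "(\<Sum>j<Suc k. a j * (1/3)^j) = a k * (1/3)^k"
          using a0 by simp
        finally have "\<bar>a k * (1/3)^k\<bar> \<le> \<bar>s x - s x'\<bar> + \<bar>\<Sum>j. a (j + Suc k) * (1/3)^(j + Suc k)\<bar>"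
          by linarith
        also have "\<bar>\<Sum>j. a (j + Suc k) * (1/3)^(j + Suc k)\<bar> \<le> (3/2) * (1/3)^Suc k"
          by (rule sum_thirds_tail_le(2)[OF a1])
        finally have "(1/3)^k \<le> \<bar>s x - s x'\<bar> + (1/2) * (1/3)^k" using ak by (simp add: abs_mult)
        then have "(1/2) * (1/3)^k < (1/2) * (1/3::real)^N" using close by linarith
        moreover have "(1/3::real)^N \<le> (1/3)^k" using kN by (intro power_decreasing) auto
        ultimately show False by linarith
      qed
      obtain d where d: "d \<in> D n" "x \<in> ball d (inverse (real (Suc n)))" using D(2)[of n] x by auto
      then obtain j where "j < N" "B j = ball d (inverse (real (Suc n)))" using N by (auto simp: C_def)
      then have "x' \<in> ball d (inverse (real (Suc n)))" using agree[of j] d by simp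
      then show "dist x x' < \<epsilon>" using d n dist_triangle[of x x' d] by (auto simp: dist_commute)
    qed simp
  qed
qed

lemma continuous_on_integrable:
  fixes q :: "'b::topological_space \<Rightarrow> real"
  assumes K: "compact K" and q: "continuous_on K q"
    and \<gamma>: "sets \<gamma> = sets (restrict_space borel K)" "finite_measure \<gamma>"
  shows "q \<in> borel_measurable \<gamma>" "integrable \<gamma> q" "\<exists>B. \<forall>x\<in>space \<gamma>. \<bar>q x\<bar> \<le> B" "space \<gamma> = K"
proof -
  show sp: "space \<gamma> = K" using sets_eq_imp_space_eq[OF \<gamma>(1)] by (simp add: space_restrict_space)
  have "q \<in> borel_measurable (restrict_space borel K)" by (rule borel_measurable_continuous_on_restrict[OF q])
  then show m: "q \<in> borel_measurable \<gamma>" using \<gamma>(1) by (simp cong: measurable_cong_sets)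
  have "bounded (q ` K)" by (rule compact_imp_bounded[OF compact_continuous_image[OF q K]])
  then show b: "\<exists>B. \<forall>x\<in>space \<gamma>. \<bar>q x\<bar> \<le> B" unfolding bounded_iff sp by auto
  then obtain B where "\<And>x. x \<in> space \<gamma> \<Longrightarrow> \<bar>q x\<bar> \<le> B" by blast
  then show "integrable \<gamma> q"
    using m by (intro finite_measure.integrable_const_bound[OF \<gamma>(2), of _ B]) auto
qed

text \<open>The measures are transported to the line, where Helly's selection theorem holds, by the code \<open>s\<close> of
\<open>compact_real_code\<close>; there they are tight, and a weak limit is transported back. For the latter,
the inverse of \<open>s\<close> is extended continuously to a map \<open>g\<close> from the closure \<open>S\<close> of the set of codes onto \<open>K\<close>; this uses that \<open>K\<close> is
compact, since the ambient space need not be complete. A continuous function \<open>q\<close> on \<open>K\<close> becomes the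
continuous function \<open>q \<circ> g\<close> on \<open>S\<close>, although \<open>s\<close> itself is only Borel.\<close>

theorem prob_measures_sequentially_compact:
  fixes K :: "'b::metric_space set"
  assumes K: "compact K" and \<gamma>: "\<And>n. \<gamma> n \<in> prob_measures_on K"
  obtains r \<mu> where "strict_mono (r :: nat \<Rightarrow> nat)" "\<mu> \<in> prob_measures_on K"
    "\<And>q :: 'b \<Rightarrow> real. continuous_on K q \<Longrightarrow> (\<lambda>n. \<integral>x. q x \<partial>\<gamma> (r n)) \<longlonglongrightarrow> (\<integral>x. q x \<partial>\<mu>)"
proof -
  have sets_\<gamma>: "sets (\<gamma> n) = sets (restrict_space borel K)" and ps: "prob_space (\<gamma> n)" for n
    using \<gamma> by (auto simp: prob_measures_on_def)
  have sp: "space (\<gamma> n) = K" for n using sets_eq_imp_space_eq[OF sets_\<gamma>] by (simp add: space_restrict_space)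
  have ne: "K \<noteq> {}" using prob_space.not_empty[OF ps[of 0]] sp by simp
  obtain s :: "'b \<Rightarrow> real" where s: "s \<in> borel_measurable borel" "\<And>x. \<bar>s x\<bar> \<le> 3/2"
    "\<And>\<epsilon>. \<epsilon> > 0 \<Longrightarrow> \<exists>\<delta>>0. \<forall>x\<in>K. \<forall>x'\<in>K. \<bar>s x - s x'\<bar> < \<delta> \<longrightarrow> dist x x' < \<epsilon>"
    using compact_real_code[OF K ne] by blast
  define S where "S = closure (s ` K)"
  have Sne: "S \<noteq> {}" "closed S" using ne by (auto simp: S_def)
  have Sb: "S \<subseteq> {-3/2..3/2}"
    unfolding S_def
  proof (rule closure_minimal)
    show "s ` K \<subseteq> {-3/2..3/2}"
    proof
      fix c assume "c \<in> s ` K"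
      then obtain x where "c = s x" by blast
      then show "c \<in> {-3/2..3/2}" using s(2)[of x] by (auto simp: abs_le_iff)
    qed
  qed simp
  have approx: "\<exists>x\<in>K. \<bar>s x - c\<bar> < e" if "c \<in> S" "e > 0" for c e
    using that closure_approachable[of c "s ` K"] by (auto simp: S_def dist_real_def)
  have "\<exists>x\<in>K. \<forall>\<epsilon>>0. \<exists>\<delta>>0. \<forall>x'\<in>K. \<bar>s x' - c\<bar> < \<delta> \<longrightarrow> dist x' x < \<epsilon>" if c: "c \<in> S" for c
  proof -
    have "\<exists>x\<in>K. \<bar>s x - c\<bar> < inverse (real (Suc n))" for n
      by (rule approx[OF c]) simp
    then obtain X where X: "\<And>n. X n \<in> K" "\<And>n. \<bar>s (X n) - c\<bar> < inverse (real (Suc n))" by metis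
    obtain x r where x: "x \<in> K" and r: "strict_mono (r :: nat \<Rightarrow> nat)" "(X \<circ> r) \<longlonglongrightarrow> x"
      using K X(1) unfolding compact_eq_seq_compact_metric seq_compact_def by metis
    show ?thesis
    proof (intro bexI[OF _ x] allI impI)
      fix \<epsilon> :: real assume e: "\<epsilon> > 0"
      then obtain \<delta> where d: "\<delta> > 0" "\<And>x x'. x \<in> K \<Longrightarrow> x' \<in> K \<Longrightarrow> \<bar>s x - s x'\<bar> < \<delta> \<Longrightarrow> dist x x' < \<epsilon> / 2"
        using s(3)[of "\<epsilon> / 2"] by auto
      obtain n1 where n1: "\<And>n. n \<ge> n1 \<Longrightarrow> dist ((X \<circ> r) n) x < \<epsilon> / 2"
        using r(2) e unfolding lim_sequentially by (meson half_gt_zero)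
      obtain n2 where n2: "inverse (real (Suc n2)) < \<delta> / 2" using reals_Archimedean[of "\<delta>/2"] d by auto
      define n where "n = max n1 n2"
      have "n2 \<le> r n" using seq_suble[OF r(1), of n] by (simp add: n_def)
      then have "inverse (real (Suc (r n))) \<le> inverse (real (Suc n2))" by (intro le_imp_inverse_le) auto
      then have rn: "\<bar>s (X (r n)) - c\<bar> < \<delta> / 2" using X(2)[of "r n"] n2 by linarith
      show "\<exists>\<delta>>0. \<forall>x'\<in>K. \<bar>s x' - c\<bar> < \<delta> \<longrightarrow> dist x' x < \<epsilon>"
      proof (intro exI[of _ "\<delta> / 2"] conjI ballI impI)
        fix x' assume x': "x' \<in> K" "\<bar>s x' - c\<bar> < \<delta> / 2"
        then have "dist x' (X (r n)) < \<epsilon> / 2" using d(2)[OF x'(1) X(1)] rn by (auto simp: abs_if split: if_splits)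
        then show "dist x' x < \<epsilon>" using n1[of n] dist_triangle[of x' x "X (r n)"] by (simp add: n_def)
      qed (use d in auto)
    qed
  qed
  then obtain g where gK: "\<And>c. c \<in> S \<Longrightarrow> g c \<in> K"
    and g: "\<And>c \<epsilon>. c \<in> S \<Longrightarrow> \<epsilon> > 0 \<Longrightarrow> \<exists>\<delta>>0. \<forall>x'\<in>K. \<bar>s x' - c\<bar> < \<delta> \<longrightarrow> dist x' (g c) < \<epsilon>"
    by metis
  have sS: "s x \<in> S" if "x \<in> K" for x using that closure_subset[of "s ` K"] by (auto simp: S_def)
  have gs: "g (s x) = x" if xK: "x \<in> K" for x
  proof (rule ccontr)
    assume "g (s x) \<noteq> x"
    then obtain \<delta> where "\<delta> > 0" "\<forall>x'\<in>K. \<bar>s x' - s x\<bar> < \<delta> \<longrightarrow> dist x' (g (s x)) < dist x (g (s x))"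
      using g[OF sS[OF xK], of "dist x (g (s x))"] by auto
    then show False using xK by force
  qed
  have gc: "continuous_on S g"
  proof (rule continuous_onI)
    fix c \<epsilon> :: real assume c: "c \<in> S" and e: "\<epsilon> > 0"
    obtain \<delta> where d: "\<delta> > 0" "\<And>x'. x' \<in> K \<Longrightarrow> \<bar>s x' - c\<bar> < \<delta> \<Longrightarrow> dist x' (g c) < \<epsilon> / 2"
      using g[OF c, of "\<epsilon> / 2"] e by auto
    show "\<exists>d>0. \<forall>c'\<in>S. dist c' c < d \<longrightarrow> dist (g c') (g c) \<le> \<epsilon>"
    proof (intro exI[of _ "\<delta> / 2"] conjI ballI impI)
      fix c' assume c': "c' \<in> S" "dist c' c < \<delta> / 2"
      obtain \<delta>' where d': "\<delta>' > 0" "\<And>x'. x' \<in> K \<Longrightarrow> \<bar>s x' - c'\<bar> < \<delta>' \<Longrightarrow> dist x' (g c') < \<epsilon> / 2"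
        using g[OF c'(1), of "\<epsilon> / 2"] e by auto
      obtain x' where x': "x' \<in> K" "\<bar>s x' - c'\<bar> < min \<delta>' (\<delta> / 2)"
        using approx[OF c'(1), of "min \<delta>' (\<delta> / 2)"] d d' by auto
      then have "dist x' (g c') < \<epsilon> / 2" using d' by auto
      moreover have "\<bar>s x' - c\<bar> < \<delta>" using x' c' unfolding dist_real_def by linarith
      then have "dist x' (g c) < \<epsilon> / 2" using d x' by auto
      ultimately show "dist (g c') (g c) \<le> \<epsilon>" using dist_triangle3[of "g c'" "g c" x'] by simp
    qed (use d in simp)
  qed
  define M where "M n = distr (\<gamma> n) borel s" for n
  have sm: "s \<in> \<gamma> n \<rightarrow>\<^sub>M borel" for n
    using measurable_restrict_space1[OF s(1), of K] sets_\<gamma> by (simp cong: measurable_cong_sets)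
  have rd: "real_distribution (M n)" for n
    unfolding M_def real_distribution_def real_distribution_axioms_def
    using prob_space.prob_space_distr[OF ps sm] by simp
  have "tight M"
    unfolding tight_def
  proof (intro conjI allI impI rd)
    fix \<epsilon> :: real assume e: "\<epsilon> > 0"
    have "measure (M n) {-2<..2} = 1" for n
    proof -
      have "s -` {-2<..2} \<inter> space (\<gamma> n) = space (\<gamma> n)"
      proof -
        have "-2 < s x \<and> s x \<le> 2" for x using s(2)[of x] by (auto simp: abs_le_iff)
        then show ?thesis by auto
      qed
      then show ?thesis
        unfolding M_def using sm prob_space.prob_space[OF ps] by (subst measure_distr) auto
    qed
    then show "\<exists>a b. a < b \<and> (\<forall>n. 1 - \<epsilon> < measure (M n) {a<..b})"
      using e by (intro exI[of _ "-2"] exI[of _ 2]) auto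
  qed
  then obtain r M0 where r: "strict_mono r" and M0: "real_distribution M0" and conv: "weak_conv_m (M \<circ> r) M0"
    using tight_imp_convergent_subsubsequence[of M id] by (auto simp: strict_mono_id)
  interpret M0: real_distribution M0 by fact
  have rd': "real_distribution ((M \<circ> r) n)" for n using rd by simp
  have lim: "(\<lambda>n. \<integral>x. h (s x) \<partial>\<gamma> (r n)) \<longlonglongrightarrow> (\<integral>c. h c \<partial>M0)"
    if h: "continuous_on UNIV h" and hB: "\<And>c. \<bar>h c\<bar> \<le> B" for h :: "real \<Rightarrow> real" and B
  proof -
    have hm: "h \<in> borel_measurable borel" by (rule borel_measurable_continuous_onI[OF h])
    have "(\<lambda>n. integral\<^sup>L ((M \<circ> r) n) h) \<longlonglongrightarrow> integral\<^sup>L M0 h"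
      using h hB by (intro weak_conv_imp_integral_bdd_continuous_conv[OF rd' M0 conv, of h B])
        (auto simp: continuous_on_eq_continuous_at)
    moreover have "integral\<^sup>L ((M \<circ> r) n) h = (\<integral>x. h (s x) \<partial>\<gamma> (r n))" for n
      unfolding M_def o_def by (rule integral_distr[OF sm hm])
    ultimately show ?thesis by simp
  qed
  have S_AE: "AE c in M0. c \<in> S"
  proof -
    \<comment> \<open>a bounded continuous function that vanishes exactly on \<open>S\<close>: the weak limit does not charge the complement\<close>
    let ?h = "\<lambda>c. min 1 (infdist c S)"
    have hc: "continuous_on UNIV ?h" by (intro continuous_intros)
    have hb: "\<bar>?h c\<bar> \<le> 1" for c using infdist_nonneg[of c S] by auto
    have "(\<integral>x. ?h (s x) \<partial>\<gamma> n) = 0" for n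
    proof -
      have "(\<integral>x. ?h (s x) \<partial>\<gamma> n) = (\<integral>x. 0 \<partial>\<gamma> n)"
        by (rule Bochner_Integration.integral_cong) (use sS sp in auto)
      then show ?thesis by simp
    qed
    then have "(\<lambda>n. 0) \<longlonglongrightarrow> (\<integral>c. ?h c \<partial>M0)" using lim[OF hc hb] by simp
    then have z: "(\<integral>c. ?h c \<partial>M0) = 0" by (simp add: LIMSEQ_const_iff)
    have hm: "?h \<in> borel_measurable M0"
      using borel_measurable_continuous_onI[OF hc] by (simp cong: measurable_cong_sets)
    have "integrable M0 ?h"
      by (rule M0.integrable_const_bound[OF _ hm, of 1]) (use hb in auto)
    then have "AE c in M0. ?h c = 0"
      using z infdist_nonneg by (subst (asm) integral_nonneg_eq_0_iff_AE) auto
    then show ?thesis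
      by eventually_elim (use Sne in \<open>auto simp: in_closed_iff_infdist_zero min_def split: if_splits\<close>)
  qed
  obtain x0 where x0: "x0 \<in> K" using ne by blast
  define g' where "g' c = (if c \<in> S then g c else x0)" for c
  have gm: "g' \<in> borel \<rightarrow>\<^sub>M restrict_space borel K"
  proof (rule measurable_restrict_space2)
    show "g' \<in> space borel \<rightarrow> K" using gK x0 by (auto simp: g'_def)
    have "g \<in> borel_measurable (restrict_space borel S)" by (rule borel_measurable_continuous_on_restrict[OF gc])
    then show "g' \<in> borel \<rightarrow>\<^sub>M borel"
      unfolding g'_def[abs_def] using Sne by (subst measurable_restrict_space_iff[symmetric]) auto
  qed
  then have gm0: "g' \<in> M0 \<rightarrow>\<^sub>M restrict_space borel K" by (simp cong: measurable_cong_sets)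
  define \<mu> where "\<mu> = distr M0 (restrict_space borel K) g'"
  show ?thesis
  proof (rule that[OF r])
    show "\<mu> \<in> prob_measures_on K"
      unfolding prob_measures_on_def \<mu>_def using M0.prob_space_distr[OF gm0] by simp
    fix q :: "'b \<Rightarrow> real" assume q: "continuous_on K q"
    have qg: "continuous_on S (\<lambda>c. q (g c))" by (rule continuous_on_compose2[OF q gc]) (use gK in auto)
    have "bounded (q ` K)" by (rule compact_imp_bounded[OF compact_continuous_image[OF q K]])
    then obtain B where B: "\<And>x. x \<in> K \<Longrightarrow> \<bar>q x\<bar> \<le> B" unfolding bounded_iff by auto
    have B0: "0 \<le> B" using B[OF x0] by linarith
    obtain h where h: "continuous_on UNIV h" "\<And>c. c \<in> S \<Longrightarrow> h c = q (g c)" "\<And>c. norm (h c) \<le> B"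
      using Tietze[OF qg, of UNIV B] Sne B B0 gK by auto
    have qm: "q \<in> borel_measurable (restrict_space borel K)" by (rule borel_measurable_continuous_on_restrict[OF q])
    have hm: "h \<in> borel_measurable borel" by (rule borel_measurable_continuous_onI[OF h(1)])
    have "(\<integral>x. q x \<partial>\<mu>) = (\<integral>c. q (g' c) \<partial>M0)" unfolding \<mu>_def by (rule integral_distr[OF gm0 qm])
    also have "\<dots> = (\<integral>c. h c \<partial>M0)"
    proof (rule integral_cong_AE)
      show "AE c in M0. q (g' c) = h c" using S_AE by eventually_elim (simp add: g'_def h)
      show "(\<lambda>c. q (g' c)) \<in> borel_measurable M0" by (rule measurable_compose[OF gm0 qm])
    qed (use hm in simp)
    finally have e: "(\<integral>x. q x \<partial>\<mu>) = (\<integral>c. h c \<partial>M0)" .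
    have "(\<integral>x. h (s x) \<partial>\<gamma> n) = (\<integral>x. q x \<partial>\<gamma> n)" for n
      by (rule Bochner_Integration.integral_cong) (use h(2) sS gs sp in auto)
    then show "(\<lambda>n. \<integral>x. q x \<partial>\<gamma> (r n)) \<longlonglongrightarrow> (\<integral>x. q x \<partial>\<mu>)"
      using lim[OF h(1), of B] h(3) e by simp
  qed
qed


section \<open>Occupation measures of closed trajectories\<close>

text \<open>The chain rule for the function \<open>(T - t) * \<phi> y\<close> along the curve \<open>(t, y t)\<close> in space-time. It is the integration by parts
that produces the measure \<open>\<xi>\<close> in the definition of \<open>W1\<close>.\<close>

lemma time_weighted_chain_rule:
  fixes \<phi> :: "'a::euclidean_space \<Rightarrow> real" and g :: "real \<Rightarrow> 'a"
  assumes \<phi>: "\<phi> \<in> C1" and T: "T \<ge> 0"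
    and g: "g absolutely_integrable_on {0..T}" and M: "\<And>s. s \<in> {0..T} \<Longrightarrow> norm (g s) \<le> M"
    and y: "\<And>t. t \<in> {0..T} \<Longrightarrow> y t = y0 + integral {0..t} g"
  shows "integral {0..T} (\<lambda>s. (T - s) * (grad \<phi> (y s) \<bullet> g s)) =
    integral {0..T} (\<lambda>s. \<phi> (y s)) - T * \<phi> y0"
proof -
  let ?\<Psi> = "\<lambda>p::real \<times> 'a. (T - fst p) * \<phi> (snd p)"
  let ?D = "\<lambda>p::real \<times> 'a. (- \<phi> (snd p), (T - fst p) *\<^sub>R grad \<phi> (snd p))"
  let ?g = "\<lambda>s. (1::real, g s)"
  have der: "(?\<Psi> has_derivative (\<lambda>h. ?D p \<bullet> h)) (at p)" for p
  proof -
    have "((\<lambda>p::real \<times> 'a. \<phi> (snd p)) has_derivative (\<lambda>h. grad \<phi> (snd p) \<bullet> snd h)) (at p)"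
      using has_derivative_compose[OF has_derivative_snd[OF has_derivative_ident] C1_has_derivative[OF \<phi>]]
      by (cases p) auto
    then show ?thesis
      by (auto intro!: derivative_eq_intros simp: inner_prod_def algebra_simps)
  qed
  have cont: "continuous_on UNIV ?D"
    by (intro continuous_intros continuous_on_compose2[OF C1_continuous[OF \<phi>, of UNIV]]
        continuous_on_compose2[OF C1_grad_continuous[OF \<phi>, of UNIV]]) auto
  have \<Psi>: "?\<Psi> \<in> C1" "grad ?\<Psi> = ?D"
    using C1_I[of ?\<Psi> ?D, OF der cont] by auto
  have bl: "bounded_linear (\<lambda>x::'a. (0::real, x))"
    by (intro bounded_linear_Pair bounded_linear_zero bounded_linear_ident)
  have split: "?g = (\<lambda>s. (1, 0) + (0, g s))" by simp
  have gi: "(\<lambda>s. (0::real, g s)) absolutely_integrable_on {0..T}"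
    using absolutely_integrable_linear[OF g bl] by (simp add: o_def)
  have g': "?g absolutely_integrable_on {0..T}"
    unfolding split by (rule set_integral_add(1)[OF _ gi]) auto
  have y': "(t, y t) = (0, y0) + integral {0..t} ?g" if t: "t \<in> {0..T}" for t
  proof -
    have int: "g integrable_on {0..t}"
      using integrable_subinterval_real[OF set_lebesgue_integral_eq_integral(1)[OF g], of 0 t] t by auto
    have "integral {0..t} ?g = integral {0..t} (\<lambda>s. (1::real, 0::'a)) + integral {0..t} (\<lambda>s. (0, g s))"
      unfolding split
      by (rule Henstock_Kurzweil_Integration.integral_add)
        (use integrable_linear[OF int bl] in \<open>auto simp: o_def\<close>)
    also have "integral {0..t} (\<lambda>s. (0::real, g s)) = (0, integral {0..t} g)"
      using integral_linear[OF int bl] by (simp add: o_def)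
    finally show ?thesis using y[OF t] t by simp
  qed
  have M': "norm (?g s) \<le> 1 + M" if "s \<in> {0..T}" for s
    using norm_Pair_le[of "1::real" "g s"] M[OF that] by simp
  note main = chain_rule_integral(2)[OF \<Psi>(1) T g' M' y', unfolded \<Psi>(2)]
  have yc: "continuous_on {0..T} y"
  proof -
    have "continuous_on {0..T} (\<lambda>t. y0 + integral {0..t} g)"
      by (intro continuous_intros indefinite_integral_continuous_1 set_lebesgue_integral_eq_integral(1)[OF g])
    then show ?thesis by (subst continuous_on_cong[OF refl]) (use y in auto)
  qed
  have \<phi>i: "(\<lambda>s. \<phi> (y s)) integrable_on {0..T}"
    by (intro integrable_continuous_real continuous_on_compose2[OF C1_continuous[OF \<phi>, of UNIV] yc]) auto
  have "(\<lambda>s. ?D (s, y s) \<bullet> ?g s) integrable_on {0..T}"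
    using chain_rule_integral(1)[OF \<Psi>(1) T g' M' y'] unfolding \<Psi>(2)
    by (rule set_lebesgue_integral_eq_integral(1))
  from integral_add[OF this \<phi>i]
  have "integral {0..T} (\<lambda>s. (T - s) * (grad \<phi> (y s) \<bullet> g s)) =
      integral {0..T} (\<lambda>s. ?D (s, y s) \<bullet> ?g s) + integral {0..T} (\<lambda>s. \<phi> (y s))"
    by (simp add: inner_prod_def)
  then show ?thesis using main by simp
qed

text \<open>The image on \<open>K\<close> of the measure with density \<open>w\<close> on \<open>[0, T]\<close> under \<open>t \<mapsto> (y t, u t)\<close>.\<close>

definition occupation_measure ::
  "('a::topological_space \<times> 'u::topological_space) set \<Rightarrow> (real \<Rightarrow> real) \<Rightarrow> real \<Rightarrow> (real \<Rightarrow> 'a) \<Rightarrow> (real \<Rightarrow> 'u)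
    \<Rightarrow> ('a \<times> 'u) measure" where
  "occupation_measure K w T y u =
     distr (density (lebesgue_on {0..T}) (\<lambda>t. ennreal (w t))) (restrict_space borel K) (\<lambda>t. (y t, u t))"

lemma occupation_measure:
  fixes y :: "real \<Rightarrow> 'a::topological_space" and u :: "real \<Rightarrow> 'u::topological_space"
  assumes p: "(\<lambda>t. (y t, u t)) \<in> lebesgue_on {0..T} \<rightarrow>\<^sub>M restrict_space borel K"
    and w: "continuous_on {0..T} w" "\<And>t. t \<in> {0..T} \<Longrightarrow> 0 \<le> w t"
  shows "occupation_measure K w T y u \<in> finite_measures_on K"
    and "\<And>q :: 'a \<times> 'u \<Rightarrow> real. continuous_on K q \<Longrightarrow> compact K \<Longrightarrow>
      (\<integral>x. q x \<partial>occupation_measure K w T y u) = integral {0..T} (\<lambda>t. w t * q (y t, u t))"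
proof -
  let ?L = "lebesgue_on {0..T}"
  let ?D = "density ?L (\<lambda>t. ennreal (w t))"
  have wm: "w \<in> borel_measurable ?L"
    by (rule continuous_imp_measurable_on_sets_lebesgue[OF w(1)]) simp
  have pD: "(\<lambda>t. (y t, u t)) \<in> ?D \<rightarrow>\<^sub>M restrict_space borel K" using p by simp
  have wi: "integrable ?L w"
    using absolutely_integrable_continuous_real[OF w(1)] by (simp add: set_integrable_def integrable_restrict_space)
  have "emeasure ?D (space ?D) = (\<integral>\<^sup>+t. ennreal (w t) \<partial>?L)"
    using wm by (subst emeasure_density) (auto simp: space_restrict_space intro!: nn_integral_cong)
  also have "\<dots> = ennreal (\<integral>t. w t \<partial>?L)"
    by (rule nn_integral_eq_integral[OF wi]) (use w(2) in \<open>auto simp: AE_restrict_space_iff\<close>)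
  finally have "finite_measure ?D" by (intro finite_measureI) simp
  then show "occupation_measure K w T y u \<in> finite_measures_on K"
    unfolding finite_measures_on_def occupation_measure_def
    using finite_measure.finite_measure_distr[OF _ pD] by simp
  fix q :: "'a \<times> 'u \<Rightarrow> real"
  assume q: "continuous_on K q" and K: "compact K"
  have qm: "q \<in> borel_measurable (restrict_space borel K)" by (rule borel_measurable_continuous_on_restrict[OF q])
  have qpm: "(\<lambda>t. q (y t, u t)) \<in> borel_measurable ?L" by (rule measurable_compose[OF p qm])
  have "bounded (q ` K)" by (rule compact_imp_bounded[OF compact_continuous_image[OF q K]])
  then obtain B where B: "\<And>x. x \<in> K \<Longrightarrow> \<bar>q x\<bar> \<le> B" unfolding bounded_iff by auto
  have pK: "(y t, u t) \<in> K" if "t \<in> {0..T}" for t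
    using measurable_space[OF p, of t] that by (simp add: space_restrict_space)
  have "(\<integral>x. q x \<partial>occupation_measure K w T y u) = (\<integral>t. q (y t, u t) \<partial>?D)"
    unfolding occupation_measure_def by (rule integral_distr[OF pD qm])
  also have "\<dots> = (\<integral>t. w t *\<^sub>R q (y t, u t) \<partial>?L)"
    by (rule integral_density) (use qpm wm w(2) in auto)
  also have "\<dots> = integral {0..T} (\<lambda>t. w t * q (y t, u t))"
  proof -
    have "integrable ?L (\<lambda>t. w t * q (y t, u t))"
    proof (rule Bochner_Integration.integrable_bound)
      show "integrable ?L (\<lambda>t. B * w t)" using wi by simp
      show "AE t in ?L. norm (w t * q (y t, u t)) \<le> norm (B * w t)"
      proof (rule AE_I2)
        fix t assume "t \<in> space ?L"
        then have "\<bar>q (y t, u t)\<bar> \<le> B" "0 \<le> w t" using B pK w(2) by auto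
        moreover from this have "0 \<le> B" by linarith
        ultimately have "\<bar>w t\<bar> * \<bar>q (y t, u t)\<bar> \<le> \<bar>w t\<bar> * \<bar>B\<bar>"
          by (intro mult_left_mono) auto
        then show "norm (w t * q (y t, u t)) \<le> norm (B * w t)"
          by (simp only: real_norm_def abs_mult mult.commute[of "\<bar>B\<bar>"])
      qed
    qed (use wm qpm in auto)
    then show ?thesis by (simp add: lebesgue_integral_eq_integral)
  qed
  finally show "(\<integral>x. q x \<partial>occupation_measure K w T y u) = integral {0..T} (\<lambda>t. w t * q (y t, u t))" .
qed

text \<open>\<open>A\<close> plays the role of a level set of the conserved quantities.\<close>

locale steerable_system = control_system U f L
  for U :: "'u::metric_space set" and f :: "'a::euclidean_space \<Rightarrow> 'u \<Rightarrow> 'a" and L +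
  fixes Y A :: "'a set" and T0 :: real
  assumes compact_Y: "compact Y" and compact_A: "compact A" and A_subset: "A \<subseteq> Y"
    and A_invariant: "forward_invariant f U A"
    and T0_pos: "T0 > 0"
    and steering: "\<And>y1 y2. y1 \<in> A \<Longrightarrow> y2 \<in> A \<Longrightarrow> steers_within f U T0 y1 y2"
begin

lemma compact_YU: "compact (Y \<times> U)"
  using compact_Y compact_U by (rule compact_Times)

lemma compact_AU: "compact (A \<times> U)"
  using compact_A compact_U by (rule compact_Times)

lemma stays_in_A: "y0 \<in> A \<Longrightarrow> control U u \<Longrightarrow> solves f u y0 y \<Longrightarrow> t \<ge> 0 \<Longrightarrow> y t \<in> A"
  using A_invariant unfolding forward_invariant_def by blast

lemma steer:
  assumes "y1 \<in> A" "y2 \<in> A"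
  obtains u y \<tau> where "control U u" "solves f u y1 y" "0 \<le> \<tau>" "\<tau> \<le> T0" "y \<tau> = y2"
  using steering[OF assms] unfolding steers_within_def by blast

lemma grad_dot_f_continuous:
  assumes "\<phi> \<in> C1" shows "continuous_on (Y \<times> U) (\<lambda>(y, u). grad \<phi> y \<bullet> f y u)"
proof -
  have "continuous_on (Y \<times> U) (\<lambda>p. grad \<phi> (fst p) \<bullet> (\<lambda>(y, u). f y u) p)"
    by (intro continuous_intros continuous_on_compose2[OF C1_grad_continuous[OF assms, of UNIV]]
        continuous_on_subset[OF f_cont]) auto
  then show ?thesis by (simp add: case_prod_unfold)
qed

lemma C1_fst_continuous:
  fixes \<phi> :: "'a \<Rightarrow> real"
  assumes "\<phi> \<in> C1" shows "continuous_on (Y \<times> U) (\<lambda>(y, u). \<phi> y - c)"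
  unfolding case_prod_unfold
  by (intro continuous_intros continuous_on_compose2[OF C1_continuous[OF assms, of UNIV]]) auto

lemma cost_integrable:
  fixes q :: "'a \<times> 'u \<Rightarrow> real"
  assumes "continuous_on (Y \<times> U) q" "y0 \<in> A" "control U u" "solves f u y0 y"
  shows "(\<lambda>s. q (y s, u s)) absolutely_integrable_on {0..T}"
proof -
  have "continuous_on (Y \<times> U) (\<lambda>(y, u). q (y, u))" using assms(1) by (simp add: case_prod_unfold)
  moreover have "y ` {0..T} \<subseteq> Y" using stays_in_A[OF assms(2-4)] A_subset by auto
  ultimately show ?thesis
    by (rule running_cost_integrable(1)[OF _ solves_continuous[OF assms(4)] _ assms(3)])
qed

lemma loop_occupation_measure:
  assumes y0: "y0 \<in> A" and u: "control U u" and s: "solves f u y0 y" and T: "T > 0" and loop: "y T = y0"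
  shows "\<exists>\<gamma>\<in>W1 f U Y y0. \<forall>q :: 'a \<times> 'u \<Rightarrow> real. continuous_on (Y \<times> U) q \<longrightarrow>
    (\<integral>x. q x \<partial>\<gamma>) * T = integral {0..T} (\<lambda>t. q (y t, u t))"
proof -
  have yY: "y ` {0..T} \<subseteq> Y" using stays_in_A[OF y0 u s] A_subset by auto
  have p: "(\<lambda>t. (y t, u t)) \<in> lebesgue_on {0..T} \<rightarrow>\<^sub>M restrict_space borel (Y \<times> U)"
    by (rule trajectory_pair_measurable[OF solves_continuous[OF s] yY u])
  define \<gamma> where "\<gamma> = occupation_measure (Y \<times> U) (\<lambda>t. 1 / T) T y u"
  define \<xi> where "\<xi> = occupation_measure (Y \<times> U) (\<lambda>t. (T - t) / T) T y u"
  have \<gamma>fin: "\<gamma> \<in> finite_measures_on (Y \<times> U)"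
    unfolding \<gamma>_def by (rule occupation_measure(1)[OF p]) (use T in auto)
  have \<xi>fin: "\<xi> \<in> finite_measures_on (Y \<times> U)"
    unfolding \<xi>_def by (rule occupation_measure(1)[OF p]) (use T in \<open>auto intro!: continuous_intros\<close>)
  have \<gamma>int: "(\<integral>x. q x \<partial>\<gamma>) = integral {0..T} (\<lambda>t. q (y t, u t)) / T"
    if "continuous_on (Y \<times> U) q" for q :: "'a \<times> 'u \<Rightarrow> real"
    unfolding \<gamma>_def using occupation_measure(2)[OF p _ _ that compact_YU, of "\<lambda>t. 1 / T"] T by simp
  have \<xi>int: "(\<integral>x. q x \<partial>\<xi>) = integral {0..T} (\<lambda>t. (T - t) * q (y t, u t)) / T"
    if "continuous_on (Y \<times> U) q" for q :: "'a \<times> 'u \<Rightarrow> real"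
  proof -
    have "(\<integral>x. q x \<partial>\<xi>) = integral {0..T} (\<lambda>t. (T - t) / T * q (y t, u t))"
      unfolding \<xi>_def by (rule occupation_measure(2)[OF p _ _ that compact_YU])
        (use T in \<open>auto intro!: continuous_intros\<close>)
    then show ?thesis by simp
  qed
  have prob: "\<gamma> \<in> prob_measures_on (Y \<times> U)"
  proof -
    have fm: "finite_measure \<gamma>" using \<gamma>fin by (simp add: finite_measures_on_def)
    have "(\<integral>x. 1 \<partial>\<gamma>) = (1::real)" using \<gamma>int[of "\<lambda>_. 1"] T by simp
    then have "measure \<gamma> (space \<gamma>) = 1" by simp
    then have "emeasure \<gamma> (space \<gamma>) = 1" using finite_measure.emeasure_eq_measure[OF fm] by simp
    then show ?thesis using \<gamma>fin by (auto simp: finite_measures_on_def prob_measures_on_def intro: prob_spaceI)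
  qed
  obtain M where M: "\<forall>s\<in>{0..T}. norm (f (y s) (u s)) \<le> M"
    using running_cost_integrable(2)[OF f_cont solves_continuous[OF s] _ u, of T] by auto
  have "\<gamma> \<in> W f U Y"
    unfolding W_def
  proof (intro CollectI conjI prob ballI)
    fix \<phi> :: "'a \<Rightarrow> real" assume \<phi>: "\<phi> \<in> C1"
    show "(\<integral>(y, u). grad \<phi> y \<bullet> f y u \<partial>\<gamma>) = 0"
      using \<gamma>int[OF grad_dot_f_continuous[OF \<phi>]] integral_grad_along_solution[OF u s \<phi>, of T] T loop by simp
  qed
  moreover have "(\<integral>(y, u). \<phi> y - \<phi> y0 \<partial>\<gamma>) = (\<integral>(y, u). grad \<phi> y \<bullet> f y u \<partial>\<xi>)"
    if \<phi>: "\<phi> \<in> C1" for \<phi> :: "'a \<Rightarrow> real"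
  proof -
    have "integral {0..T} (\<lambda>t. (T - t) * (grad \<phi> (y t) \<bullet> f (y t) (u t))) =
        integral {0..T} (\<lambda>t. \<phi> (y t)) - T * \<phi> y0"
      by (rule time_weighted_chain_rule[OF \<phi>, of T _ M]) (use s M T in \<open>auto simp: solves_iff\<close>)
    moreover have "integral {0..T} (\<lambda>t. \<phi> (y t) - \<phi> y0) = integral {0..T} (\<lambda>t. \<phi> (y t)) - T * \<phi> y0"
    proof -
      have "(\<lambda>t. \<phi> (y t)) integrable_on {0..T}"
        by (intro integrable_continuous_real continuous_on_compose2[OF C1_continuous[OF \<phi>, of UNIV] solves_continuous[OF s]]) auto
      from Henstock_Kurzweil_Integration.integral_diff[OF this integrable_const_ivl[of "\<phi> y0"]]
      show ?thesis using T by simp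
    qed
    ultimately show ?thesis
      using \<gamma>int[OF C1_fst_continuous[OF \<phi>, of "\<phi> y0"]] \<xi>int[OF grad_dot_f_continuous[OF \<phi>]] by simp
  qed
  ultimately have "\<gamma> \<in> W1 f U Y y0"
    unfolding W1_def using \<xi>fin by blast
  then show ?thesis using \<gamma>int T by (intro bexI[of _ \<gamma>]) auto
qed

lemma cost_integral_le:
  fixes q :: "'a \<times> 'u \<Rightarrow> real"
  assumes q: "continuous_on (Y \<times> U) q" and M: "\<And>x. x \<in> A \<times> U \<Longrightarrow> \<bar>q x\<bar> \<le> M"
    and y: "y0 \<in> A" "control U u" "solves f u y0 y" and s: "0 \<le> s" "s \<le> T"
  shows "\<bar>integral {0..T} (\<lambda>t. q (y t, u t)) - integral {0..s} (\<lambda>t. q (y t, u t))\<bar> \<le> M * (T - s)"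
proof -
  have "norm (integral {0..T} (\<lambda>t. q (y t, u t)) - integral {0..s} (\<lambda>t. q (y t, u t))) \<le> M * \<bar>T - s\<bar>"
  proof (rule norm_integral_diff_le[OF cost_integrable[OF q y]])
    fix r assume "r \<in> {min T s..max T s}"
    then have "y r \<in> A" "u r \<in> U" using stays_in_A[OF y] y(2) s by (auto simp: control_def)
    then show "norm (q (y r, u r)) \<le> M" using M by simp
  qed (use s in auto)
  then show ?thesis using s by simp
qed

lemma concat_cost:
  fixes q :: "'a \<times> 'u \<Rightarrow> real"
  assumes q: "continuous_on (Y \<times> U) q" and y0: "y0 \<in> A"
    and 1: "control U u1" "solves f u1 y0 y1" and 2: "control U u2" "solves f u2 (y1 \<tau>) y2"
    and s: "0 \<le> \<tau>" "0 \<le> s"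
  shows "integral {0..\<tau> + s} (\<lambda>t. q (concat_at \<tau> y1 y2 t, concat_at \<tau> u1 u2 t)) =
    integral {0..\<tau>} (\<lambda>t. q (y1 t, u1 t)) + integral {0..s} (\<lambda>t. q (y2 t, u2 t))"
  by (rule concat_integral(2)[OF cost_integrable[OF q y0 1] cost_integrable[OF q stays_in_A[OF y0 1 s(1)] 2] s])
    (simp add: concat_at_def)

text \<open>Close the trajectory by steering it back to \<open>y0\<close>: this changes its length by at most \<open>T0\<close> and its cost by at most \<open>M * T0\<close>.\<close>

lemma W1_bound_le_cost:
  fixes q :: "'a \<times> 'u \<Rightarrow> real"
  assumes q: "continuous_on (Y \<times> U) q" and M: "\<And>x. x \<in> A \<times> U \<Longrightarrow> \<bar>q x\<bar> \<le> M"
    and y0: "y0 \<in> A" and y: "control U u" "solves f u y0 y" and T: "T > 0"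
    and c: "\<And>\<gamma>. \<gamma> \<in> W1 f U Y y0 \<Longrightarrow> c \<le> (\<integral>x. q x \<partial>\<gamma>)"
  shows "c * T \<le> integral {0..T} (\<lambda>t. q (y t, u t)) + 2 * M * T0"
proof -
  have yT: "y T \<in> A" using stays_in_A[OF y0 y] T by simp
  obtain u2 y2 \<tau> where 2: "control U u2" "solves f u2 (y T) y2" "0 \<le> \<tau>" "\<tau> \<le> T0" "y2 \<tau> = y0"
    by (rule steer[OF yT y0])
  let ?u = "concat_at T u u2" and ?y = "concat_at T y y2"
  have T': "T + \<tau> > 0" "T \<ge> 0" using T 2 by auto
  note cc = concat_trajectory[OF y 2(1,2) T'(2)]
  have "?y (T + \<tau>) = y0" using 2 cc(3)[of \<tau>] by simp
  then obtain \<gamma> where \<gamma>: "\<gamma> \<in> W1 f U Y y0"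
    "(\<integral>x. q x \<partial>\<gamma>) * (T + \<tau>) = integral {0..T + \<tau>} (\<lambda>t. q (?y t, ?u t))"
    using loop_occupation_measure[OF y0 cc(1,2) T'(1)] q by blast
  let ?v = "\<integral>x. q x \<partial>\<gamma>"
  let ?I = "integral {0..T} (\<lambda>t. q (y t, u t))" and ?J = "integral {0..\<tau>} (\<lambda>t. q (y2 t, u2 t))"
  \<comment> \<open>\<open>?v\<close> is the average cost over the closed trajectory, \<open>?J\<close> the cost of the way back\<close>
  have v: "?v * (T + \<tau>) = ?I + ?J"
    using \<gamma>(2) concat_cost[OF q y0 y 2(1,2) T'(2) 2(3)] by simp
  have I: "\<bar>?I\<bar> \<le> M * T" using cost_integral_le[OF q M y0 y, of 0 T] T by simp
  have J: "\<bar>?J\<bar> \<le> M * \<tau>" using cost_integral_le[OF q M yT 2(1,2), of 0 \<tau>] 2 by simp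
  have "\<bar>?v\<bar> * (T + \<tau>) \<le> M * (T + \<tau>)" using v I J T' by (simp add: abs_mult[symmetric] algebra_simps abs_le_iff)
      (smt (verit) abs_mult abs_of_pos distrib_left)
  then have vM: "\<bar>?v\<bar> \<le> M" using T' by simp
  have M0: "M \<ge> 0" using vM by linarith
  have "c * T \<le> ?v * T" using c[OF \<gamma>(1)] T by simp
  also have "\<dots> = ?I + ?J - ?v * \<tau>" using v by (simp add: algebra_simps)
  also have "\<dots> \<le> ?I + 2 * (M * \<tau>)"
  proof -
    have "\<bar>?v * \<tau>\<bar> \<le> M * \<tau>" using vM 2 by (simp add: abs_mult mult_right_mono)
    then show ?thesis using J by linarith
  qed
  also have "M * \<tau> \<le> M * T0" using 2 M0 by (simp add: mult_left_mono)
  finally show ?thesis by simp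
qed

lemma W1_nonempty:
  assumes y0: "y0 \<in> A" shows "W1 f U Y y0 \<noteq> {}"
proof -
  obtain u y \<tau> where "control U u" using steer[OF y0 y0] by blast
  then have u: "u 0 \<in> U" by (rule control_nonempty)
  obtain y where y: "solves f (\<lambda>_. u 0) y0 y" using constant_control_solution[OF u] by blast
  note cu = constant_control[OF u]
  have y1: "y 1 \<in> A" by (rule stays_in_A[OF y0 cu y]) simp
  obtain u2 y2 \<tau> where 2: "control U u2" "solves f u2 (y 1) y2" "0 \<le> \<tau>" "\<tau> \<le> T0" "y2 \<tau> = y0"
    by (rule steer[OF y1 y0])
  note cc = concat_trajectory[OF cu y 2(1,2)]
  have "concat_at 1 y y2 (1 + \<tau>) = y0" using 2 cc(3)[of \<tau>] by simp
  then show ?thesis using loop_occupation_measure[OF y0 cc(1,2), of "1 + \<tau>"] 2 by fastforce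
qed

text \<open>Precede the trajectory from \<open>y1\<close> by a way from \<open>y0\<close> to \<open>y1\<close> of duration \<open>\<tau> \<le> T0\<close>, and cut off its last piece
of the same duration.\<close>

lemma cost_bound_from_other_point:
  fixes q :: "'a \<times> 'u \<Rightarrow> real"
  assumes q: "continuous_on (Y \<times> U) q" and M: "\<And>x. x \<in> A \<times> U \<Longrightarrow> \<bar>q x\<bar> \<le> M"
    and y0: "y0 \<in> A" and T: "T \<ge> T0"
    and a: "\<And>u y. control U u \<Longrightarrow> solves f u y0 y \<Longrightarrow> a \<le> integral {0..T} (\<lambda>t. q (y t, u t))"
    and y1: "y1 \<in> A" and y: "control U u" "solves f u y1 y"
  shows "a - 2 * M * T0 \<le> integral {0..T} (\<lambda>t. q (y t, u t))"
proof -
  obtain u0 x \<tau> where x: "control U u0" "solves f u0 y0 x" "0 \<le> \<tau>" "\<tau> \<le> T0" "x \<tau> = y1"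
    by (rule steer[OF y0 y1])
  have y': "solves f u (x \<tau>) y" using y x by simp
  let ?s = "T - \<tau>"
  have s: "0 \<le> ?s" "?s \<le> T" using x T by auto
  have M0: "M \<ge> 0"
    using M[of "(y1, u 0)"] y1 control_nonempty[OF y(1)] by (auto intro: order_trans[OF abs_ge_zero])
  have "a \<le> integral {0..\<tau> + ?s} (\<lambda>t. q (concat_at \<tau> x y t, concat_at \<tau> u0 u t))"
    using a[OF concat_trajectory(1,2)[OF x(1,2) y(1) y' x(3)]] by simp
  also have "\<dots> = integral {0..\<tau>} (\<lambda>t. q (x t, u0 t)) + integral {0..?s} (\<lambda>t. q (y t, u t))"
    by (rule concat_cost[OF q y0 x(1,2) y(1) y' x(3) s(1)])
  finally have "a \<le> integral {0..\<tau>} (\<lambda>t. q (x t, u0 t)) + integral {0..?s} (\<lambda>t. q (y t, u t))" .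
  moreover have "\<bar>integral {0..\<tau>} (\<lambda>t. q (x t, u0 t))\<bar> \<le> M * \<tau>"
    using cost_integral_le[OF q M y0 x(1,2), of 0 \<tau>] x by simp
  moreover have "\<bar>integral {0..T} (\<lambda>t. q (y t, u t)) - integral {0..?s} (\<lambda>t. q (y t, u t))\<bar> \<le> M * \<tau>"
    using cost_integral_le[OF q M y1 y s] by simp
  moreover have "M * \<tau> \<le> M * T0" using x M0 by (simp add: mult_left_mono)
  ultimately show ?thesis by linarith
qed

lemma dual_function_of_cost_bound:
  fixes q :: "'a \<times> 'u \<Rightarrow> real"
  assumes q: "continuous_on (Y \<times> U) q" and M: "\<And>x. x \<in> A \<times> U \<Longrightarrow> \<bar>q x\<bar> \<le> M"
    and y0: "y0 \<in> A" and T: "T \<ge> T0" and d: "d > 0"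
    and a: "\<And>u y. control U u \<Longrightarrow> solves f u y0 y \<Longrightarrow> a \<le> integral {0..T} (\<lambda>t. q (y t, u t))"
  shows "\<exists>\<eta>\<in>C1. \<forall>y\<in>A. \<forall>u\<in>U. (a - 2 * M * T0) / T - d \<le> q (y, u) + grad \<eta> y \<bullet> f y u"
proof (rule smooth_subsolution_exists[OF compact_A A_invariant _ _ d])
  show "continuous_on (A \<times> U) (\<lambda>(y, u). q (y, u))"
    unfolding case_prod_eta by (rule continuous_on_subset[OF q]) (use A_subset in auto)
  show "T > 0" using T T0_pos by simp
  show "a - 2 * M * T0 \<le> integral {0..T} (\<lambda>s. q (\<xi> s, u s))"
    if "y \<in> A" "control U u" "solves f u y \<xi>" for y u \<xi>
    by (rule cost_bound_from_other_point[OF q M y0 T a that])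
qed

text \<open>Horizons \<open>T\<close> so long that the bounded costs of steering become negligible after division by \<open>T\<close>.\<close>

theorem dual_function_of_W1_bound:
  fixes q :: "'a \<times> 'u \<Rightarrow> real"
  assumes q: "continuous_on (Y \<times> U) q" and y0: "y0 \<in> A" and d: "d > 0"
    and c: "\<And>\<gamma>. \<gamma> \<in> W1 f U Y y0 \<Longrightarrow> c \<le> (\<integral>x. q x \<partial>\<gamma>)"
  shows "\<exists>\<eta>\<in>C1. \<forall>y\<in>A. \<forall>u\<in>U. c - d \<le> q (y, u) + grad \<eta> y \<bullet> f y u"
proof -
  have "continuous_on (A \<times> U) q" by (rule continuous_on_subset[OF q]) (use A_subset in auto)
  then have "bounded (q ` (A \<times> U))" by (intro compact_imp_bounded compact_continuous_image compact_AU)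
  then obtain M where M: "\<And>x. x \<in> A \<times> U \<Longrightarrow> \<bar>q x\<bar> \<le> M" unfolding bounded_iff by auto
  define T where "T = max T0 (8 * M * T0 / d)"
  have T: "T \<ge> T0" "T > 0" using T0_pos by (auto simp: T_def)
  have "8 * M * T0 / d \<le> T" by (simp add: T_def)
  then have TM: "4 * M * T0 / T \<le> d / 2" using T d by (simp add: field_simps)
  obtain \<eta> where \<eta>: "\<eta> \<in> C1" and low: "\<And>y u. y \<in> A \<Longrightarrow> u \<in> U \<Longrightarrow> ((c * T - 2 * M * T0) - 2 * M * T0) / T - d / 2 \<le> q (y, u) + grad \<eta> y \<bullet> f y u"
  proof -
  have "\<exists>\<eta>\<in>C1. \<forall>y\<in>A. \<forall>u\<in>U. ((c * T - 2 * M * T0) - 2 * M * T0) / T - d / 2 \<le> q (y, u) + grad \<eta> y \<bullet> f y u"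
  proof (rule dual_function_of_cost_bound[OF q M y0 T(1)])
    fix u y assume "control U u" "solves f u y0 y"
    from W1_bound_le_cost[OF q M y0 this T(2) c]
    show "c * T - 2 * M * T0 \<le> integral {0..T} (\<lambda>t. q (y t, u t))" by simp
  qed (use d in auto)
  then show ?thesis using that by blast
  qed
  have eq: "((c * T - 2 * M * T0) - 2 * M * T0) / T = c - 4 * M * T0 / T"
    using T by (simp add: field_simps)
  have "c - d \<le> q (y, u) + grad \<eta> y \<bullet> f y u" if "y \<in> A" "u \<in> U" for y u
    using low[OF that] TM unfolding eq by linarith
  then show ?thesis using \<eta> by blast
qed

end


section \<open>Measures concentrated on the level set\<close>

lemma INF_ereal_eqI:
  fixes g :: "'i \<Rightarrow> real"
  assumes "\<And>i. i \<in> I \<Longrightarrow> c \<le> g i" "\<And>e. e > 0 \<Longrightarrow> \<exists>i\<in>I. g i \<le> c + e"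
  shows "(INF i\<in>I. ereal (g i)) = ereal c"
proof (rule INF_eqI)
  fix x assume x: "\<And>i. i \<in> I \<Longrightarrow> x \<le> ereal (g i)"
  show "x \<le> ereal c"
  proof (rule ereal_le_epsilon2)
    fix e :: real assume "e > 0"
    then obtain i where "i \<in> I" "g i \<le> c + e" using assms(2) by blast
    then show "x \<le> ereal c + ereal e" using x[of i] by (auto intro: order_trans)
  qed
qed (use assms in auto)

lemma SUP_ereal_eqI:
  fixes g :: "'i \<Rightarrow> real"
  assumes "\<And>i. i \<in> I \<Longrightarrow> g i \<le> c" "\<And>e. e > 0 \<Longrightarrow> \<exists>i\<in>I. c - e \<le> g i"
  shows "(SUP i\<in>I. ereal (g i)) = ereal c"
proof (rule SUP_eqI)
  fix x assume x: "\<And>i. i \<in> I \<Longrightarrow> ereal (g i) \<le> x"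
  show "ereal c \<le> x"
  proof (rule ereal_le_epsilon2)
    fix e :: real assume "e > 0"
    then obtain i where i: "i \<in> I" "c - e \<le> g i" using assms(2) by blast
    then have "ereal c \<le> ereal (g i) + ereal e" by simp
    also have "\<dots> \<le> x + ereal e" using x[OF i(1)] by (rule add_right_mono)
    finally show "ereal c \<le> x + ereal e" .
  qed
qed (use assms in auto)

lemma real_INF_approx:
  fixes g :: "'i \<Rightarrow> real"
  assumes "I \<noteq> {}" "\<And>i. i \<in> I \<Longrightarrow> m \<le> g i"
  shows "\<And>i. i \<in> I \<Longrightarrow> (INF i\<in>I. g i) \<le> g i" "\<And>e. e > 0 \<Longrightarrow> \<exists>i\<in>I. g i < (INF i\<in>I. g i) + e"
proof -
  have b: "bdd_below (g ` I)" by (rule bdd_belowI2[OF assms(2)])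
  show "\<And>i. i \<in> I \<Longrightarrow> (INF i\<in>I. g i) \<le> g i" by (rule cINF_lower[OF b])
  show "\<exists>i\<in>I. g i < (INF i\<in>I. g i) + e" if "e > 0" for e
    using that cINF_less_iff[OF assms(1) b, of "(INF i\<in>I. g i) + e"] by simp
qed

lemma weak_star_neighbourhood:
  fixes S :: "'a::topological_space set"
  assumes "openin (weak_star_topology S) O'" "\<gamma> \<in> O'"
  shows "\<exists>(Q :: ('a \<Rightarrow> real) set) e. finite Q \<and> (\<forall>q\<in>Q. continuous_on S q) \<and> e > 0 \<and>
    {\<gamma>' \<in> prob_measures_on S. \<forall>q\<in>Q. \<bar>(\<integral>x. q x \<partial>\<gamma>') - (\<integral>x. q x \<partial>\<gamma>)\<bar> < e} \<subseteq> O'"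
proof -
  define N :: "('a \<Rightarrow> real) set \<Rightarrow> real \<Rightarrow> 'a measure set" where "N Q e = {\<gamma>' \<in> prob_measures_on S. \<forall>q\<in>Q. \<bar>(\<integral>x. q x \<partial>\<gamma>') - (\<integral>x. q x \<partial>\<gamma>)\<bar> < e}" for Q e
  have "generate_topology_on {{\<gamma> \<in> prob_measures_on S. (\<integral>x. q x \<partial>\<gamma>) \<in> V} | (q :: _ \<Rightarrow> real) V.
          continuous_on S q \<and> open V} O'"
    using assms(1) unfolding weak_star_topology_def by (simp add: openin_topology_generated_by_iff)
  then have "\<gamma> \<in> O' \<longrightarrow> (\<exists>Q e. finite Q \<and> (\<forall>q\<in>Q. continuous_on S q) \<and> e > 0 \<and> N Q e \<subseteq> O')"
  proof (induction rule: generate_topology_on.induct)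
    case Empty
    then show ?case by simp
  next
    case (Int a b)
    show ?case
    proof
      assume "\<gamma> \<in> a \<inter> b"
      then obtain Q e Q' e' where Q: "finite Q" "\<forall>q\<in>Q. continuous_on S q" "e > 0" "N Q e \<subseteq> a"
        and Q': "finite Q'" "\<forall>q\<in>Q'. continuous_on S q" "e' > 0" "N Q' e' \<subseteq> b"
        using Int.IH by (elim IntE) meson
      have "N (Q \<union> Q') (min e e') \<subseteq> N Q e \<inter> N Q' e'" unfolding N_def by auto
      then have "N (Q \<union> Q') (min e e') \<subseteq> a \<inter> b" using Q(4) Q'(4) by blast
      moreover have "finite (Q \<union> Q')" "\<forall>q\<in>Q \<union> Q'. continuous_on S q" "min e e' > 0"
        using Q(1-3) Q'(1-3) by auto
      ultimately show "\<exists>Q e. finite Q \<and> (\<forall>q\<in>Q. continuous_on S q) \<and> e > 0 \<and> N Q e \<subseteq> a \<inter> b"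
        by blast
    qed
  next
    case (UN K)
    show ?case
    proof
      assume "\<gamma> \<in> \<Union>K"
      then obtain k where k: "k \<in> K" "\<gamma> \<in> k" by blast
      then obtain Q e where "finite Q" "\<forall>q\<in>Q. continuous_on S q" "e > 0" "N Q e \<subseteq> k"
        using UN.IH[OF k(1)] by meson
      moreover from this have "N Q e \<subseteq> \<Union>K" using k(1) by blast
      ultimately show "\<exists>Q e. finite Q \<and> (\<forall>q\<in>Q. continuous_on S q) \<and> e > 0 \<and> N Q e \<subseteq> \<Union>K"
        by blast
    qed
  next
    case (Basis s)
    show ?case
    proof
      assume \<gamma>: "\<gamma> \<in> s"
      obtain q :: "_ \<Rightarrow> real" and V where s: "s = {\<gamma> \<in> prob_measures_on S. (\<integral>x. q x \<partial>\<gamma>) \<in> V}"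
        and q: "continuous_on S q" and V: "open V" using Basis by blast
      have "(\<integral>x. q x \<partial>\<gamma>) \<in> V" using \<gamma> s by simp
      then obtain e where e: "e > 0" "ball (\<integral>x. q x \<partial>\<gamma>) e \<subseteq> V" using V open_contains_ball by blast
      have "N {q} e \<subseteq> s"
        using e(2) by (auto simp: s N_def dist_real_def abs_minus_commute subset_iff)
      then show "\<exists>Q e. finite Q \<and> (\<forall>q\<in>Q. continuous_on S q) \<and> e > 0 \<and> N Q e \<subseteq> s"
        using q e(1) by (intro exI[of _ "{q}"] exI[of _ e]) simp
    qed
  qed
  then show ?thesis using assms(2) unfolding N_def by simp
qed

lemma weak_star_closedin_level:
  assumes "continuous_on S q"
  shows "closedin (weak_star_topology S) {\<gamma> \<in> prob_measures_on S. (\<integral>x. q x \<partial>\<gamma>) = (0::real)}"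
proof -
  have "openin (weak_star_topology S) {\<gamma> \<in> prob_measures_on S. (\<integral>x. q x \<partial>\<gamma>) \<in> - {0}}"
    unfolding weak_star_topology_def
    by (rule topology_generated_by_Basis) (use assms in blast)
  moreover have "topspace (weak_star_topology S) - {\<gamma> \<in> prob_measures_on S. (\<integral>x. q x \<partial>\<gamma>) = 0} =
      {\<gamma> \<in> prob_measures_on S. (\<integral>x. q x \<partial>\<gamma>) \<in> - {0}}"
    by (auto simp: topspace_weak_star_topology)
  ultimately show ?thesis
    unfolding closedin_def by (auto simp: topspace_weak_star_topology)
qed

text \<open>\<open>G\<close> is a conserved quantity whose zeros in \<open>Y\<close> form the level \<open>A\<close>, such as the squared distance of \<open>F\<close> from \<open>z\<close>.\<close>

locale invariant_level = steerable_system U f L Y A T0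
  for U :: "'u::metric_space set" and f :: "'a::euclidean_space \<Rightarrow> 'u \<Rightarrow> 'a" and L and Y A :: "'a set" and T0 +
  fixes G :: "'a \<Rightarrow> real"
  assumes G_C1: "G \<in> C1" and G_nonneg: "\<And>y. G y \<ge> 0"
    and G_eq_0: "\<And>y. y \<in> Y \<Longrightarrow> G y = 0 \<longleftrightarrow> y \<in> A"
    and G_conserved: "\<And>y u. y \<in> Y \<Longrightarrow> u \<in> U \<Longrightarrow> grad G y \<bullet> f y u = 0"
begin

definition W_concentrated :: "('a \<times> 'u) measure set" where
  "W_concentrated = {\<gamma> \<in> W f U Y. AE p in \<gamma>. fst p \<in> A}"

lemma W_prob: "\<gamma> \<in> W f U Y \<Longrightarrow> \<gamma> \<in> prob_measures_on (Y \<times> U)"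
  by (simp add: W_def)

lemma continuous_wrt_finite_measure_on:
  fixes q :: "'a \<times> 'u \<Rightarrow> real"
  assumes "\<gamma> \<in> finite_measures_on (Y \<times> U)" "continuous_on (Y \<times> U) q"
  shows "q \<in> borel_measurable \<gamma>" "integrable \<gamma> q" "\<exists>B. \<forall>x\<in>space \<gamma>. \<bar>q x\<bar> \<le> B" "space \<gamma> = Y \<times> U"
  using continuous_on_integrable[OF compact_YU assms(2)] assms(1) by (auto simp: finite_measures_on_def)

lemma prob_measure_is_finite: "\<gamma> \<in> prob_measures_on (Y \<times> U) \<Longrightarrow> \<gamma> \<in> finite_measures_on (Y \<times> U)"
  by (auto simp: prob_measures_on_def finite_measures_on_def prob_space_def)

lemma continuous_wrt_prob_measure_on:
  fixes q :: "'a \<times> 'u \<Rightarrow> real"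
  assumes "\<gamma> \<in> prob_measures_on (Y \<times> U)" "continuous_on (Y \<times> U) q"
  shows "q \<in> borel_measurable \<gamma>" "integrable \<gamma> q" "space \<gamma> = Y \<times> U"
  using continuous_wrt_finite_measure_on[OF prob_measure_is_finite[OF assms(1)] assms(2)] by auto

lemma prob_integral_const: "\<gamma> \<in> prob_measures_on (Y \<times> U) \<Longrightarrow> (\<integral>x. c \<partial>\<gamma>) = (c::real)"
  using prob_space.prob_space by (auto simp: prob_measures_on_def)

lemma prob_integral_bound:
  fixes q :: "'a \<times> 'u \<Rightarrow> real"
  assumes "\<gamma> \<in> prob_measures_on (Y \<times> U)" "continuous_on (Y \<times> U) q" "\<And>x. x \<in> Y \<times> U \<Longrightarrow> \<bar>q x\<bar> \<le> M"
  shows "\<bar>\<integral>x. q x \<partial>\<gamma>\<bar> \<le> M"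
proof -
  note qf = continuous_wrt_prob_measure_on[OF assms(1,2)]
  have c: "integrable \<gamma> (\<lambda>x. M)" using continuous_wrt_prob_measure_on(2)[OF assms(1), of "\<lambda>_. M"] by simp
  have "(\<integral>x. q x \<partial>\<gamma>) \<le> (\<integral>x. M \<partial>\<gamma>)"
    by (rule integral_mono[OF qf(2) c]) (use assms(3) qf(3) in \<open>auto simp: abs_le_iff\<close>)
  moreover have "(\<integral>x. - M \<partial>\<gamma>) \<le> (\<integral>x. q x \<partial>\<gamma>)"
    by (rule integral_mono[OF _ qf(2)]) (use c assms(3) qf(3) in \<open>auto simp: abs_le_iff minus_le_iff\<close>)
  ultimately show ?thesis
    using prob_integral_const[OF assms(1), of M] prob_integral_const[OF assms(1), of "- M"] by linarith
qed

lemma bound_YU: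
  fixes q :: "'a \<times> 'u \<Rightarrow> real"
  assumes "continuous_on (Y \<times> U) q"
  obtains M where "M \<ge> 0" "\<And>x. x \<in> Y \<times> U \<Longrightarrow> \<bar>q x\<bar> \<le> M"
proof -
  have "bounded (q ` (Y \<times> U))" by (rule compact_imp_bounded[OF compact_continuous_image[OF assms compact_YU]])
  then obtain M where "\<And>x. x \<in> Y \<times> U \<Longrightarrow> \<bar>q x\<bar> \<le> M" unfolding bounded_iff by auto
  then show ?thesis using that[of "max 0 M"] by fastforce
qed

lemma W_integral_grad_eq_0: "\<gamma> \<in> W f U Y \<Longrightarrow> \<phi> \<in> C1 \<Longrightarrow> (\<integral>(y, u). grad \<phi> y \<bullet> f y u \<partial>\<gamma>) = 0"
  by (simp add: W_def)

lemma G_continuous: "continuous_on (Y \<times> U) (\<lambda>p. G (fst p))"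
  by (intro continuous_on_compose2[OF C1_continuous[OF G_C1, of UNIV]] continuous_intros) auto

lemma AE_in_A_iff:
  assumes "\<gamma> \<in> prob_measures_on (Y \<times> U)"
  shows "(AE p in \<gamma>. fst p \<in> A) \<longleftrightarrow> (\<integral>p. G (fst p) \<partial>\<gamma>) = 0"
proof -
  note qf = continuous_wrt_prob_measure_on[OF assms G_continuous]
  have "(\<integral>p. G (fst p) \<partial>\<gamma>) = 0 \<longleftrightarrow> (AE p in \<gamma>. G (fst p) = 0)"
    by (rule integral_nonneg_eq_0_iff_AE[OF qf(2)]) (simp add: G_nonneg)
  also have "\<dots> \<longleftrightarrow> (AE p in \<gamma>. fst p \<in> A)"
    by (rule AE_cong) (use G_eq_0 qf(3) in auto)
  finally show ?thesis by simp
qed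

lemma W1_subset_W2: "W1 f U Y y0 \<subseteq> W2 f U Y y0"
proof
  fix \<gamma> assume "\<gamma> \<in> W1 f U Y y0"
  then obtain \<xi> where \<xi>: "\<gamma> \<in> W f U Y" "\<xi> \<in> finite_measures_on (Y \<times> U)"
    "\<forall>\<phi>\<in>C1. (\<integral>(y, u). \<phi> y - \<phi> y0 \<partial>\<gamma>) = (\<integral>(y, u). grad \<phi> y \<bullet> f y u \<partial>\<xi>)"
    unfolding W1_def by blast
  then show "\<gamma> \<in> W2 f U Y y0"
    unfolding W2_def by (intro CollectI conjI exI[of _ "\<lambda>_. \<xi>"]) auto
qed

text \<open>Test the defining limit with \<open>G\<close>: its right-hand sides vanish as \<open>G\<close> is conserved, so the nonnegative function \<open>G\<close> has
integral \<open>G y0 = 0\<close>.\<close>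

lemma W2_subset_W_concentrated:
  assumes y0: "y0 \<in> A" shows "W2 f U Y y0 \<subseteq> W_concentrated"
proof
  fix \<gamma> assume \<gamma>: "\<gamma> \<in> W2 f U Y y0"
  then obtain \<xi> :: "nat \<Rightarrow> ('a \<times> 'u) measure" where \<xi>: "\<gamma> \<in> W f U Y" "\<And>l. \<xi> l \<in> finite_measures_on (Y \<times> U)"
    "(\<lambda>l. \<integral>(y, u). grad G y \<bullet> f y u \<partial>\<xi> l) \<longlonglongrightarrow> (\<integral>(y, u). G y - G y0 \<partial>\<gamma>)"
    unfolding W2_def using G_C1 by blast
  have "(\<integral>(y, u). grad G y \<bullet> f y u \<partial>\<xi> l) = 0" for l
  proof -
    have "space (\<xi> l) = Y \<times> U" by (rule continuous_wrt_finite_measure_on(4)[OF \<xi>(2) continuous_on_const[of _ 0]])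
    then have "(\<integral>(y, u). grad G y \<bullet> f y u \<partial>\<xi> l) = (\<integral>x. 0 \<partial>\<xi> l)"
      by (intro Bochner_Integration.integral_cong) (auto simp: G_conserved)
    then show ?thesis by simp
  qed
  then have "(\<integral>(y, u). G y - G y0 \<partial>\<gamma>) = 0"
    using \<xi>(3) by (simp add: LIMSEQ_const_iff)
  moreover have "G y0 = 0" using G_eq_0 y0 A_subset by auto
  ultimately have "(\<integral>p. G (fst p) \<partial>\<gamma>) = 0" by (simp add: case_prod_unfold)
  then show "\<gamma> \<in> W_concentrated"
    unfolding W_concentrated_def using \<xi>(1) AE_in_A_iff[OF W_prob[OF \<xi>(1)]] by simp
qed

text \<open>Weak duality: the gradient term integrates to zero against members of \<open>W\<close>.\<close>

lemma dual_bound: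
  fixes q :: "'a \<times> 'u \<Rightarrow> real"
  assumes \<gamma>: "\<gamma> \<in> W_concentrated" and q: "continuous_on (Y \<times> U) q" and \<eta>: "\<eta> \<in> C1"
    and c: "\<And>y u. y \<in> A \<Longrightarrow> u \<in> U \<Longrightarrow> c \<le> q (y, u) + grad \<eta> y \<bullet> f y u"
  shows "c \<le> (\<integral>x. q x \<partial>\<gamma>)"
proof -
  have W: "\<gamma> \<in> W f U Y" and AE: "AE p in \<gamma>. fst p \<in> A" using \<gamma> by (auto simp: W_concentrated_def)
  note P = W_prob[OF W]
  have g: "continuous_on (Y \<times> U) (\<lambda>(y, u). grad \<eta> y \<bullet> f y u)" by (rule grad_dot_f_continuous[OF \<eta>])
  note i = continuous_wrt_prob_measure_on(2)[OF P q] continuous_wrt_prob_measure_on(2)[OF P g]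
  have "c = (\<integral>x. c \<partial>\<gamma>)" using prob_integral_const[OF P] by simp
  also have "\<dots> \<le> (\<integral>x. q x + (\<lambda>(y, u). grad \<eta> y \<bullet> f y u) x \<partial>\<gamma>)"
  proof (rule integral_mono_AE)
    show "AE x in \<gamma>. c \<le> q x + (\<lambda>(y, u). grad \<eta> y \<bullet> f y u) x"
      using AE AE_space by eventually_elim (use c continuous_wrt_prob_measure_on(3)[OF P q] in auto)
    show "integrable \<gamma> (\<lambda>x. c)" using continuous_wrt_prob_measure_on(2)[OF P, of "\<lambda>_. c"] by simp
  qed (use i in auto)
  also have "\<dots> = (\<integral>x. q x \<partial>\<gamma>)" using i W_integral_grad_eq_0[OF W \<eta>] by simp
  finally show ?thesis .
qed

text \<open>\<open>W1\<close> and the larger set \<open>W_concentrated\<close> have the same infima of integrals; this is the form in which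
the construction of \<open>\<eta>\<close> is used below.\<close>

lemma W_concentrated_bound:
  fixes q :: "'a \<times> 'u \<Rightarrow> real"
  assumes \<gamma>: "\<gamma> \<in> W_concentrated" and q: "continuous_on (Y \<times> U) q" and y0: "y0 \<in> A"
    and c: "\<And>\<gamma>. \<gamma> \<in> W1 f U Y y0 \<Longrightarrow> c \<le> (\<integral>x. q x \<partial>\<gamma>)"
  shows "c \<le> (\<integral>x. q x \<partial>\<gamma>)"
proof (rule field_le_epsilon)
  fix d :: real assume "d > 0"
  then obtain \<eta> where "\<eta> \<in> C1" "\<forall>y\<in>A. \<forall>u\<in>U. c - d \<le> q (y, u) + grad \<eta> y \<bullet> f y u"
    using dual_function_of_W1_bound[OF q y0 _ c] by blast
  then have "c - d \<le> (\<integral>x. q x \<partial>\<gamma>)" by (intro dual_bound[OF \<gamma> q]) auto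
  then show "c \<le> (\<integral>x. q x \<partial>\<gamma>) + d" by simp
qed

lemma W1_convex:
  assumes 1: "\<gamma>1 \<in> W1 f U Y y0" and 2: "\<gamma>2 \<in> W1 f U Y y0" and t: "0 \<le> t" "t \<le> 1"
  shows "\<exists>\<gamma>\<in>W1 f U Y y0. \<forall>q :: 'a \<times> 'u \<Rightarrow> real. continuous_on (Y \<times> U) q \<longrightarrow>
    (\<integral>x. q x \<partial>\<gamma>) = (1 - t) * (\<integral>x. q x \<partial>\<gamma>1) + t * (\<integral>x. q x \<partial>\<gamma>2)"
proof -
  have t': "0 \<le> 1 - t" "0 \<le> t" using t by auto
  have mix: "\<exists>K\<in>finite_measures_on (Y \<times> U).
      measure K (Y \<times> U) = (1 - t) * measure M (Y \<times> U) + t * measure N (Y \<times> U) \<and>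
      (\<forall>q :: 'a \<times> 'u \<Rightarrow> real. continuous_on (Y \<times> U) q \<longrightarrow>
        (\<integral>x. q x \<partial>K) = (1 - t) * (\<integral>x. q x \<partial>M) + t * (\<integral>x. q x \<partial>N))"
    if M: "M \<in> finite_measures_on (Y \<times> U)" and N: "N \<in> finite_measures_on (Y \<times> U)" for M N
  proof -
    have s: "sets N = sets M" "finite_measure M" "finite_measure N" and sM: "sets M = sets (restrict_space borel (Y \<times> U))"
      using M N by (auto simp: finite_measures_on_def)
    have sp: "space M = Y \<times> U" by (rule continuous_wrt_finite_measure_on(4)[OF M continuous_on_const[of _ 0]])
    obtain K where K: "sets K = sets M" "finite_measure K"
      "measure K (space M) = (1 - t) * measure M (space M) + t * measure N (space M)"
      "\<And>g::'a \<times> 'u \<Rightarrow> real. g \<in> borel_measurable M \<Longrightarrow> (\<exists>B. \<forall>x\<in>space M. \<bar>g x\<bar> \<le> B) \<Longrightarrow>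
        (\<integral>x. g x \<partial>K) = (1 - t) * (\<integral>x. g x \<partial>M) + t * (\<integral>x. g x \<partial>N)"
      by (rule finite_measure_combination[OF s t']) blast
    show ?thesis
    proof (intro bexI[of _ K] conjI allI impI)
      show "K \<in> finite_measures_on (Y \<times> U)" using K sM by (simp add: finite_measures_on_def)
      show "measure K (Y \<times> U) = (1 - t) * measure M (Y \<times> U) + t * measure N (Y \<times> U)" using K(3) sp by simp
      fix q :: "'a \<times> 'u \<Rightarrow> real" assume q: "continuous_on (Y \<times> U) q"
      show "(\<integral>x. q x \<partial>K) = (1 - t) * (\<integral>x. q x \<partial>M) + t * (\<integral>x. q x \<partial>N)"
        by (rule K(4)) (use continuous_wrt_finite_measure_on[OF M q] in auto)
    qed
  qed
  from 1 obtain \<xi>1 where \<xi>1: "\<gamma>1 \<in> W f U Y" "\<xi>1 \<in> finite_measures_on (Y \<times> U)"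
    "\<And>\<phi>. \<phi> \<in> C1 \<Longrightarrow> (\<integral>(y, u). \<phi> y - \<phi> y0 \<partial>\<gamma>1) = (\<integral>(y, u). grad \<phi> y \<bullet> f y u \<partial>\<xi>1)"
    unfolding W1_def by blast
  from 2 obtain \<xi>2 where \<xi>2: "\<gamma>2 \<in> W f U Y" "\<xi>2 \<in> finite_measures_on (Y \<times> U)"
    "\<And>\<phi>. \<phi> \<in> C1 \<Longrightarrow> (\<integral>(y, u). \<phi> y - \<phi> y0 \<partial>\<gamma>2) = (\<integral>(y, u). grad \<phi> y \<bullet> f y u \<partial>\<xi>2)"
    unfolding W1_def by blast
  note P1 = W_prob[OF \<xi>1(1)] and P2 = W_prob[OF \<xi>2(1)]
  obtain \<gamma> where \<gamma>: "\<gamma> \<in> finite_measures_on (Y \<times> U)"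
      "measure \<gamma> (Y \<times> U) = (1 - t) * measure \<gamma>1 (Y \<times> U) + t * measure \<gamma>2 (Y \<times> U)"
      "\<And>q :: 'a \<times> 'u \<Rightarrow> real. continuous_on (Y \<times> U) q \<Longrightarrow>
        (\<integral>x. q x \<partial>\<gamma>) = (1 - t) * (\<integral>x. q x \<partial>\<gamma>1) + t * (\<integral>x. q x \<partial>\<gamma>2)"
    using mix[OF prob_measure_is_finite[OF P1] prob_measure_is_finite[OF P2]] by blast
  obtain \<xi> where \<xi>: "\<xi> \<in> finite_measures_on (Y \<times> U)"
      "\<And>q :: 'a \<times> 'u \<Rightarrow> real. continuous_on (Y \<times> U) q \<Longrightarrow>
        (\<integral>x. q x \<partial>\<xi>) = (1 - t) * (\<integral>x. q x \<partial>\<xi>1) + t * (\<integral>x. q x \<partial>\<xi>2)"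
    using mix[OF \<xi>1(2) \<xi>2(2)] by blast
  have "measure \<gamma>1 (Y \<times> U) = 1" "measure \<gamma>2 (Y \<times> U) = 1"
    using prob_space.prob_space[of \<gamma>1] prob_space.prob_space[of \<gamma>2] P1 P2
      continuous_wrt_prob_measure_on(3)[OF P1 continuous_on_const[of _ 0]] continuous_wrt_prob_measure_on(3)[OF P2 continuous_on_const[of _ 0]]
    by (auto simp: prob_measures_on_def)
  then have "measure \<gamma> (space \<gamma>) = 1"
    using \<gamma>(2) continuous_wrt_finite_measure_on(4)[OF \<gamma>(1) continuous_on_const[of _ 0]] by simp
  then have "emeasure \<gamma> (space \<gamma>) = 1"
    using \<gamma>(1) finite_measure.emeasure_eq_measure[of \<gamma>] by (simp add: finite_measures_on_def)
  then have prob: "\<gamma> \<in> prob_measures_on (Y \<times> U)"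
    using \<gamma>(1) by (auto simp: finite_measures_on_def prob_measures_on_def intro: prob_spaceI)
  have "\<gamma> \<in> W1 f U Y y0"
    unfolding W1_def W_def
  proof (intro CollectI conjI prob ballI bexI[OF _ \<xi>(1)])
    fix \<phi> :: "'a \<Rightarrow> real" assume \<phi>: "\<phi> \<in> C1"
    note g = grad_dot_f_continuous[OF \<phi>]
    show "(\<integral>(y, u). grad \<phi> y \<bullet> f y u \<partial>\<gamma>) = 0"
      using \<gamma>(3)[OF g] W_integral_grad_eq_0[OF \<xi>1(1) \<phi>] W_integral_grad_eq_0[OF \<xi>2(1) \<phi>] by simp
    show "(\<integral>(y, u). \<phi> y - \<phi> y0 \<partial>\<gamma>) = (\<integral>(y, u). grad \<phi> y \<bullet> f y u \<partial>\<xi>)"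
      using \<gamma>(3)[OF C1_fst_continuous[OF \<phi>, of "\<phi> y0"]] \<xi>(2)[OF g] \<xi>1(3)[OF \<phi>] \<xi>2(3)[OF \<phi>] by simp
  qed
  then show ?thesis using \<gamma>(3) by blast
qed

text \<open>Density of \<open>W1\<close> with respect to finitely many integrals, from convexity and \<open>W_concentrated_bound\<close>. Instead of separating convex sets in
\<open>r\<close> dimensions, one minimises the squared distance \<open>D\<close> of the vector of integrals from its value at \<open>\<gamma>\<close>. Let \<open>\<gamma>1\<close> be almost
optimal with difference vector \<open>b\<close>. For the cost \<open>?k\<close>, the combination of the \<open>q i\<close> with weights \<open>b i\<close>,
some \<open>\<gamma>2 \<in> W1\<close> does almost as well as \<open>\<gamma>\<close>; moving from \<open>\<gamma>1\<close> a small way \<open>t\<close> towards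
\<open>\<gamma>2\<close> then decreases \<open>D\<close> at first order by \<open>2 * t * D\<close>, so the infimum is zero.\<close>

lemma W1_approximates:
  fixes q :: "nat \<Rightarrow> 'a \<times> 'u \<Rightarrow> real"
  assumes \<gamma>: "\<gamma> \<in> W_concentrated" and y0: "y0 \<in> A"
    and q: "\<And>i. i < r \<Longrightarrow> continuous_on (Y \<times> U) (q i)" and e: "e > 0"
  shows "\<exists>\<gamma>'\<in>W1 f U Y y0. \<forall>i<r. \<bar>(\<integral>x. q i x \<partial>\<gamma>') - (\<integral>x. q i x \<partial>\<gamma>)\<bar> < e"
proof -
  define v where "v \<gamma>' i = (\<integral>x. q i x \<partial>\<gamma>') - (\<integral>x. q i x \<partial>\<gamma>)" for \<gamma>' i
  define D where "D \<gamma>' = (\<Sum>i<r. (v \<gamma>' i)\<^sup>2)" for \<gamma>'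
  define I where "I = W1 f U Y y0"
  define m where "m = (INF \<gamma>'\<in>I. D \<gamma>')"
  have ne: "I \<noteq> {}" unfolding I_def by (rule W1_nonempty[OF y0])
  have D0: "0 \<le> D \<gamma>'" for \<gamma>' by (simp add: D_def sum_nonneg)
  note inf = real_INF_approx[of I 0 D, OF ne D0, folded m_def]
  have m0: "0 \<le> m" unfolding m_def by (rule cINF_greatest[OF ne]) (rule D0)
  have "\<exists>M. \<forall>i<r. \<forall>x\<in>Y \<times> U. \<bar>q i x\<bar> \<le> M"
  proof -
    have "\<forall>i. \<exists>M. i < r \<longrightarrow> (M \<ge> 0 \<and> (\<forall>x\<in>Y \<times> U. \<bar>q i x\<bar> \<le> M))"
      using bound_YU[OF q] by metis
    then obtain M where M: "\<And>i. i < r \<Longrightarrow> M i \<ge> 0 \<and> (\<forall>x\<in>Y \<times> U. \<bar>q i x\<bar> \<le> M i)" by metis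
    have "\<bar>q i x\<bar> \<le> (\<Sum>i<r. M i)" if "i < r" "x \<in> Y \<times> U" for i x
    proof -
      have "M i \<le> (\<Sum>i<r. M i)" using M that by (intro member_le_sum) auto
      then show ?thesis using M that by fastforce
    qed
    then show ?thesis by blast
  qed
  then obtain M where M: "\<And>i x. i < r \<Longrightarrow> x \<in> Y \<times> U \<Longrightarrow> \<bar>q i x\<bar> \<le> M" by blast
  define R where "R = real r * (2 * M)\<^sup>2"
  have R: "R \<ge> 0" by (simp add: R_def)
  have W: "\<gamma>' \<in> prob_measures_on (Y \<times> U)" if "\<gamma>' \<in> I" for \<gamma>'
    using that W_prob by (auto simp: I_def W1_def)
  have vdiff: "(\<Sum>i<r. (v \<gamma>2 i - v \<gamma>1 i)\<^sup>2) \<le> R" if "\<gamma>1 \<in> I" "\<gamma>2 \<in> I" for \<gamma>1 \<gamma>2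
  proof -
    have "(\<Sum>i<r. (v \<gamma>2 i - v \<gamma>1 i)\<^sup>2) \<le> (\<Sum>i<r. (2 * M)\<^sup>2)"
    proof (rule sum_mono)
      fix i assume "i \<in> {..<r}"
      then have i: "i < r" by simp
      have "\<bar>v \<gamma>2 i - v \<gamma>1 i\<bar> \<le> 2 * M"
        using prob_integral_bound[OF W[OF that(1)] q[OF i] M[OF i]] prob_integral_bound[OF W[OF that(2)] q[OF i] M[OF i]]
        by (simp add: v_def)
      then have "\<bar>v \<gamma>2 i - v \<gamma>1 i\<bar>\<^sup>2 \<le> (2 * M)\<^sup>2" by (rule power_mono) simp
      then show "(v \<gamma>2 i - v \<gamma>1 i)\<^sup>2 \<le> (2 * M)\<^sup>2" by simp
    qed
    then show ?thesis by (simp add: R_def)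
  qed
  have "m = 0"
  proof (rule ccontr)
    assume "m \<noteq> 0"
    then have m: "m > 0" using m0 by simp
    \<comment> \<open>keeps the second order term \<open>t\<^sup>2 * R\<close> below \<open>t * m / 2\<close>, a fraction of the first order gain \<open>2 * t * m\<close>\<close>
    define t where "t = min (1/2) (m / (2 * (R + 1)))"
    have "0 < t" using m R by (simp add: t_def)
    moreover have "t \<le> 1/2" unfolding t_def by (rule min.cobounded1)
    ultimately have t: "0 < t" "t \<le> 1/2" .
    have tR: "t * R \<le> m / 2"
    proof -
      have "t * R \<le> m / (2 * (R + 1)) * R" using R by (intro mult_right_mono) (auto simp: t_def)
      also have "\<dots> \<le> m / 2" using R m by (simp add: field_simps)
      finally show ?thesis .
    qed
    define \<delta> where "\<delta> = t * m / 2"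
    have \<delta>: "\<delta> > 0" using t m by (simp add: \<delta>_def)
    obtain \<gamma>1 where \<gamma>1: "\<gamma>1 \<in> I" "D \<gamma>1 < m + \<delta>" using inf(2)[OF \<delta>] by blast
    define b where "b i = v \<gamma>1 i" for i
    let ?k = "\<lambda>x. \<Sum>i<r. b i * q i x"
    have kc: "continuous_on (Y \<times> U) ?k" using q by (intro continuous_intros) auto
    have kint: "(\<integral>x. ?k x \<partial>\<gamma>') = (\<Sum>i<r. b i * (\<integral>x. q i x \<partial>\<gamma>'))" if "\<gamma>' \<in> prob_measures_on (Y \<times> U)" for \<gamma>'
      using continuous_wrt_prob_measure_on(2)[OF that q] by simp
    have "\<exists>\<gamma>2\<in>I. (\<integral>x. ?k x \<partial>\<gamma>2) < (\<integral>x. ?k x \<partial>\<gamma>) + \<delta>"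
    proof (rule ccontr)
      assume "\<not> ?thesis"
      then have "\<And>\<gamma>2. \<gamma>2 \<in> W1 f U Y y0 \<Longrightarrow> (\<integral>x. ?k x \<partial>\<gamma>) + \<delta> \<le> (\<integral>x. ?k x \<partial>\<gamma>2)"
        by (auto simp: I_def not_less)
      from W_concentrated_bound[OF \<gamma> kc y0 this] show False using \<delta> by simp
    qed
    then obtain \<gamma>2 where \<gamma>2: "\<gamma>2 \<in> I" "(\<integral>x. ?k x \<partial>\<gamma>2) < (\<integral>x. ?k x \<partial>\<gamma>) + \<delta>" by blast
    have P: "\<gamma> \<in> prob_measures_on (Y \<times> U)" using \<gamma> W_prob by (auto simp: W_concentrated_def)
    \<comment> \<open>in the direction \<open>b\<close>, the integrals for \<open>\<gamma>2\<close> reach or pass the target up to \<open>\<delta>\<close>\<close>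
    have opt: "(\<Sum>i<r. b i * v \<gamma>2 i) \<le> \<delta>"
      using \<gamma>2(2) unfolding kint[OF W[OF \<gamma>2(1)]] kint[OF P] by (simp add: v_def right_diff_distrib sum_subtractf)
    have t01: "0 \<le> t" "t \<le> 1" using t by auto
    obtain \<gamma>3 where \<gamma>3: "\<gamma>3 \<in> I" "\<And>q :: 'a \<times> 'u \<Rightarrow> real. continuous_on (Y \<times> U) q \<Longrightarrow>
      (\<integral>x. q x \<partial>\<gamma>3) = (1 - t) * (\<integral>x. q x \<partial>\<gamma>1) + t * (\<integral>x. q x \<partial>\<gamma>2)"
      using W1_convex[OF \<gamma>1(1)[unfolded I_def] \<gamma>2(1)[unfolded I_def] t01] unfolding I_def by blast
    have v3: "v \<gamma>3 i = b i + t * (v \<gamma>2 i - b i)" if "i < r" for i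
      using \<gamma>3(2)[OF q[OF that]] by (simp add: v_def b_def algebra_simps)
    have "D \<gamma>3 = (\<Sum>i<r. (1 - 2 * t) * (b i)\<^sup>2 + 2 * t * (b i * v \<gamma>2 i) + t\<^sup>2 * (v \<gamma>2 i - b i)\<^sup>2)"
      unfolding D_def by (rule sum.cong) (auto simp: v3 power2_eq_square algebra_simps)
    also have "\<dots> = (1 - 2 * t) * D \<gamma>1 + 2 * t * (\<Sum>i<r. b i * v \<gamma>2 i) + t\<^sup>2 * (\<Sum>i<r. (v \<gamma>2 i - v \<gamma>1 i)\<^sup>2)"
      by (simp add: sum.distrib sum_distrib_left D_def b_def)
    also have "\<dots> \<le> (1 - 2 * t) * (m + \<delta>) + 2 * t * \<delta> + t\<^sup>2 * R"
      using t \<gamma>1(2) opt vdiff[OF \<gamma>1(1) \<gamma>2(1)] by (intro add_mono mult_left_mono) auto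
    also have "\<dots> = m - 2 * (t * m) + \<delta> + t * (t * R)" by (simp add: power2_eq_square algebra_simps)
    also have "\<dots> \<le> m - 2 * (t * m) + t * m / 2 + t * (m / 2)"
    proof -
      have "t * (t * R) \<le> t * (m / 2)" using tR t by (intro mult_left_mono) auto
      then show ?thesis unfolding \<delta>_def by linarith
    qed
    also have "\<dots> < m" using t m by simp
    finally show False using inf(1)[OF \<gamma>3(1)] by simp
  qed
  then obtain \<gamma>' where \<gamma>': "\<gamma>' \<in> I" "D \<gamma>' < e\<^sup>2" using inf(2)[of "e\<^sup>2"] e by auto
  have "\<bar>v \<gamma>' i\<bar> < e" if "i < r" for i
  proof -
    have "(v \<gamma>' i)\<^sup>2 \<le> D \<gamma>'" unfolding D_def using that by (intro member_le_sum) auto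
    then have "\<bar>v \<gamma>' i\<bar>\<^sup>2 < e\<^sup>2" using \<gamma>'(2) by simp
    then show ?thesis by (rule power_less_imp_less_base) (use e in simp)
  qed
  then show ?thesis using \<gamma>'(1) unfolding v_def I_def by blast
qed

end


section \<open>Closure and sequential limits\<close>

text \<open>Exponents are encoded by repetition in the list, which makes the monomials countable and closed under
multiplication by a coordinate.\<close>

definition coordinate_monomial :: "'a::euclidean_space list \<Rightarrow> 'a \<Rightarrow> real" where
  "coordinate_monomial bs y = prod_list (map (\<lambda>b. y \<bullet> b) bs)"

lemma coordinate_monomial_continuous:
  "continuous_on S (coordinate_monomial bs)"
  unfolding coordinate_monomial_def[abs_def]
  by (induction bs) (auto intro!: continuous_intros)

context invariant_level
begin

text \<open>That the complement of the support is a null set requires a countable cover by open null sets; here the complement of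
\<open>A \<times> U\<close> is exhausted by the compact sets \<open>K n\<close> on which \<open>G \<ge> 1 / (n + 1)\<close>, and each is covered by finitely many.\<close>

lemma W_level_eq_W_concentrated:
  assumes A: "A = level_set F z"
  shows "W_level f U Y F z = W_concentrated"
proof -
  have "(supp \<gamma> \<subseteq> A \<times> U) \<longleftrightarrow> (AE p in \<gamma>. fst p \<in> A)" if \<gamma>: "\<gamma> \<in> W f U Y" for \<gamma>
  proof -
    note P = W_prob[OF \<gamma>]
    note qf = continuous_wrt_prob_measure_on[OF P G_continuous]
    have sets: "sets \<gamma> = sets (restrict_space borel (Y \<times> U))" using P by (simp add: prob_measures_on_def)
    have closed_YU: "closed (Y \<times> U)" by (rule compact_imp_closed[OF compact_YU])
    have msets: "N \<inter> (Y \<times> U) \<in> sets \<gamma>" if "N \<in> sets borel" for N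
      using that closed_YU by (auto simp: sets sets_restrict_space)
    show ?thesis
    proof
      assume supp: "supp \<gamma> \<subseteq> A \<times> U"
      define K where "K n = {p \<in> Y \<times> U. inverse (real (Suc n)) \<le> G (fst p)}" for n
      have Kn: "K n \<in> null_sets \<gamma>" for n
      proof -
        have "closedin (top_of_set (Y \<times> U)) ((Y \<times> U) \<inter> (\<lambda>p. G (fst p)) -` {inverse (real (Suc n))..})"
          by (rule continuous_closedin_preimage[OF G_continuous]) simp
        also have "(Y \<times> U) \<inter> (\<lambda>p. G (fst p)) -` {inverse (real (Suc n))..} = K n"
          unfolding K_def by auto
        finally have cK: "compact (K n)" using compact_YU closedin_compact by blast
        have "\<exists>N. open N \<and> p \<in> N \<and> N \<inter> (Y \<times> U) \<in> null_sets \<gamma>" if p: "p \<in> K n" for p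
        proof -
          have "G (fst p) \<noteq> 0" using p by (auto simp: K_def simp del: of_nat_Suc)
          then have "fst p \<notin> A" using p G_eq_0[of "fst p"] by (auto simp: K_def)
          then have "p \<notin> supp \<gamma>" using supp by auto
          then obtain N where N: "open N" "p \<in> N" "emeasure \<gamma> (N \<inter> space \<gamma>) = 0"
            using p qf(3) unfolding supp_def K_def by (auto simp: zero_less_iff_neq_zero)
          then show ?thesis using msets[of N] qf(3) by (intro exI[of _ N]) (auto intro: null_setsI)
        qed
        then obtain N where N: "\<And>p. p \<in> K n \<Longrightarrow> open (N p) \<and> p \<in> N p \<and> N p \<inter> (Y \<times> U) \<in> null_sets \<gamma>" by metis
        obtain C where C: "C \<subseteq> K n" "finite C" "K n \<subseteq> (\<Union>p\<in>C. N p)"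
          by (rule compactE_image[OF cK, of "K n" N]) (use N in auto)
        have "(\<Union>p\<in>C. N p \<inter> (Y \<times> U)) \<in> null_sets \<gamma>"
          using C N by (intro null_sets.finite_UN) auto
        moreover have "K n \<subseteq> (\<Union>p\<in>C. N p \<inter> (Y \<times> U))" using C(3) by (auto simp: K_def)
        moreover have "K n \<in> sets \<gamma>"
          using msets[of "K n"] cK by (auto simp: K_def Int_absorb2 borel_compact)
        ultimately show ?thesis using null_sets_subset by blast
      qed
      have "(\<Union>n. K n) \<in> null_sets \<gamma>" by (rule null_sets_UN) (rule Kn)
      then show "AE p in \<gamma>. fst p \<in> A"
      proof (rule AE_I')
        show "{p \<in> space \<gamma>. \<not> fst p \<in> A} \<subseteq> (\<Union>n. K n)"
        proof
          fix p assume p: "p \<in> {p \<in> space \<gamma>. \<not> fst p \<in> A}"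
          then have "G (fst p) > 0" using G_eq_0[of "fst p"] G_nonneg[of "fst p"] qf(3) by force
          then obtain n where "inverse (real (Suc n)) < G (fst p)" using reals_Archimedean by blast
          then show "p \<in> (\<Union>n. K n)" using p qf(3) by (auto simp: K_def intro!: less_imp_le)
        qed
      qed
    next
      assume AE: "AE p in \<gamma>. fst p \<in> A"
      show "supp \<gamma> \<subseteq> A \<times> U"
      proof
        fix p assume p: "p \<in> supp \<gamma>"
        then have pYU: "p \<in> Y \<times> U" using qf(3) by (simp add: supp_def)
        have "fst p \<in> A"
        proof (rule ccontr)
          assume "fst p \<notin> A"
          define N where "N = (- A) \<times> (UNIV :: 'u set)"
          have "open N" unfolding N_def using compact_imp_closed[OF compact_A] by (intro open_Times) auto
          then have "emeasure \<gamma> (N \<inter> space \<gamma>) > 0"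
            using p \<open>fst p \<notin> A\<close> unfolding supp_def N_def by (auto simp: mem_Times_iff)
          moreover have "N \<inter> space \<gamma> \<in> sets \<gamma>" using msets[of N] \<open>open N\<close> qf(3) by simp
          then have "emeasure \<gamma> (N \<inter> space \<gamma>) = 0"
          proof (subst AE_iff_measurable[symmetric, of _ _ "\<lambda>p. fst p \<in> A"])
            show "{x \<in> space \<gamma>. \<not> fst x \<in> A} = N \<inter> space \<gamma>" by (auto simp: N_def)
          qed (use AE in auto)
          ultimately show False by simp
        qed
        then show "p \<in> A \<times> U" using pYU by (auto simp: mem_Times_iff)
      qed
    qed
  qed
  then show ?thesis unfolding W_level_def W_concentrated_def A[symmetric] by auto
qed

lemma W_concentrated_eq:
  "W_concentrated = {\<gamma> \<in> prob_measures_on (Y \<times> U). (\<forall>\<phi>\<in>C1. (\<integral>(y, u). grad \<phi> y \<bullet> f y u \<partial>\<gamma>) = 0) \<and> (\<integral>p. G (fst p) \<partial>\<gamma>) = 0}"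
  unfolding W_concentrated_def W_def using AE_in_A_iff by auto

text \<open>An intersection of zero sets of weak-star continuous integrals.\<close>

lemma W_concentrated_closed: "closedin (weak_star_topology (Y \<times> U)) W_concentrated"
proof -
  let ?C = "\<lambda>q. {\<gamma> \<in> prob_measures_on (Y \<times> U). (\<integral>x. q x \<partial>\<gamma>) = (0::real)}"
  have "W_concentrated = (\<Inter>q\<in>insert (\<lambda>p. G (fst p)) ((\<lambda>\<phi>. \<lambda>(y, u). grad \<phi> y \<bullet> f y u) ` C1). ?C q)"
    unfolding W_concentrated_eq by auto
  also have "closedin (weak_star_topology (Y \<times> U)) \<dots>"
    by (rule closedin_INT) (auto intro!: weak_star_closedin_level G_continuous grad_dot_f_continuous)
  finally show ?thesis .
qed

theorem closure_of_W1:
  assumes y0: "y0 \<in> A"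
  shows "weak_star_topology (Y \<times> U) closure_of W1 f U Y y0 = W_concentrated"
proof
  show "weak_star_topology (Y \<times> U) closure_of W1 f U Y y0 \<subseteq> W_concentrated"
    by (rule closure_of_minimal[OF order_trans[OF W1_subset_W2 W2_subset_W_concentrated[OF y0]] W_concentrated_closed])
  show "W_concentrated \<subseteq> weak_star_topology (Y \<times> U) closure_of W1 f U Y y0"
  proof
    fix \<gamma> assume \<gamma>: "\<gamma> \<in> W_concentrated"
    have P: "\<gamma> \<in> prob_measures_on (Y \<times> U)" using \<gamma> by (simp add: W_concentrated_eq)
    show "\<gamma> \<in> weak_star_topology (Y \<times> U) closure_of W1 f U Y y0"
      unfolding in_closure_of
    proof (intro conjI allI impI)
      show "\<gamma> \<in> topspace (weak_star_topology (Y \<times> U))" using P by (simp add: topspace_weak_star_topology)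
      fix O' assume "\<gamma> \<in> O' \<and> openin (weak_star_topology (Y \<times> U)) O'"
      then obtain Q :: "('a \<times> 'u \<Rightarrow> real) set" and e where Q: "finite Q" "\<forall>q\<in>Q. continuous_on (Y \<times> U) q" "e > 0"
        and sub: "{\<gamma>' \<in> prob_measures_on (Y \<times> U). \<forall>q\<in>Q. \<bar>(\<integral>x. q x \<partial>\<gamma>') - (\<integral>x. q x \<partial>\<gamma>)\<bar> < e} \<subseteq> O'"
        using weak_star_neighbourhood[of "Y \<times> U" O' \<gamma>] by blast
      obtain n h where h: "Q = h ` {i::nat. i < n}" using finite_imp_nat_seg_image_inj_on[OF Q(1)] by blast
      obtain \<gamma>' where \<gamma>': "\<gamma>' \<in> W1 f U Y y0" "\<forall>i<n. \<bar>(\<integral>x. h i x \<partial>\<gamma>') - (\<integral>x. h i x \<partial>\<gamma>)\<bar> < e"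
        using W1_approximates[OF \<gamma> y0 _ Q(3), of n h] Q(2) h by auto
      have "\<gamma>' \<in> prob_measures_on (Y \<times> U)" using \<gamma>'(1) W_prob by (auto simp: W1_def)
      then have "\<gamma>' \<in> O'" using sub \<gamma>'(2) h by auto
      then show "\<exists>y. y \<in> W1 f U Y y0 \<and> y \<in> O'" using \<gamma>'(1) by blast
    qed
  qed
qed

text \<open>Polynomials are dense in the continuous functions on \<open>Y\<close>, so it suffices to pass from monomials to polynomials. The set of good
functions is linear but not visibly closed under products; the induction on polynomials therefore shows that
multiplication by a polynomial \<open>p\<close> preserves the functions \<open>g\<close> all of whose products with monomials are good.\<close>

lemma integral_tendsto_if_monomials_tendsto:
  fixes \<phi> :: "'a \<Rightarrow> real"
  assumes \<gamma>n: "\<And>n. \<gamma>n n \<in> prob_measures_on (Y \<times> U)" and \<gamma>: "\<gamma> \<in> prob_measures_on (Y \<times> U)"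
    and mono: "\<And>bs. set bs \<subseteq> Basis \<Longrightarrow>
      (\<lambda>n. \<integral>p. coordinate_monomial bs (fst p) \<partial>\<gamma>n n) \<longlonglongrightarrow> (\<integral>p. coordinate_monomial bs (fst p) \<partial>\<gamma>)"
    and \<phi>: "continuous_on Y \<phi>"
  shows "(\<lambda>n. \<integral>p. \<phi> (fst p) \<partial>\<gamma>n n) \<longlonglongrightarrow> (\<integral>p. \<phi> (fst p) \<partial>\<gamma>)"
proof -
  define good :: "('a \<Rightarrow> real) \<Rightarrow> bool" where
    "good g \<longleftrightarrow> continuous_on Y g \<and> (\<lambda>n. \<integral>p. g (fst p) \<partial>\<gamma>n n) \<longlonglongrightarrow> (\<integral>p. g (fst p) \<partial>\<gamma>)" for g
  have fc: "continuous_on (Y \<times> U) (\<lambda>p. g (fst p))" if "continuous_on Y g" for g :: "'a \<Rightarrow> real"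
    by (rule continuous_on_compose2[OF that]) (auto intro!: continuous_intros)
  have good_add: "good (\<lambda>y. g y + h y)" if "good g" "good h" for g h
    using that continuous_wrt_prob_measure_on(2)[OF \<gamma>n fc] continuous_wrt_prob_measure_on(2)[OF \<gamma> fc]
    unfolding good_def by (auto intro!: continuous_intros tendsto_intros)
  have good_scale: "good (\<lambda>y. c * g y)" if "good g" for g c
    using that unfolding good_def by (auto intro!: continuous_intros tendsto_intros)
  have good_sum: "good (\<lambda>y. \<Sum>i\<in>I. g i y)" if "\<And>i. i \<in> I \<Longrightarrow> good (g i)" "finite I" for g :: "'a \<Rightarrow> 'a \<Rightarrow> real" and I
    using that(2,1)
  proof (induction I)
    case empty
    then show ?case by (simp add: good_def)
  next
    case (insert x I)
    then show ?case using good_add by simp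
  qed
  define multiplier where "multiplier p \<longleftrightarrow> (\<forall>g. (\<forall>bs. set bs \<subseteq> Basis \<longrightarrow> good (\<lambda>y. g y * coordinate_monomial bs y)) \<longrightarrow>
      (\<forall>bs. set bs \<subseteq> Basis \<longrightarrow> good (\<lambda>y. p y * g y * coordinate_monomial bs y)))" for p
  have "multiplier p" if "real_polynomial_function p" for p :: "'a \<Rightarrow> real"
    using that
  proof (induction rule: real_polynomial_function.induct)
    case (linear p)
    show ?case
      unfolding multiplier_def
    proof (intro allI impI)
      fix g bs assume g: "\<forall>bs. set bs \<subseteq> Basis \<longrightarrow> good (\<lambda>y. g y * coordinate_monomial bs y)" and bs: "set bs \<subseteq> (Basis :: 'a set)"
      have pe: "p y = (\<Sum>b\<in>Basis. (y \<bullet> b) * p b)" for y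
      proof -
        have "linear p" using linear by (rule bounded_linear.linear)
        then have "p (\<Sum>b\<in>Basis. (y \<bullet> b) *\<^sub>R b) = (\<Sum>b\<in>Basis. (y \<bullet> b) * p b)"
          by (simp add: linear_sum linear_scale)
        then show ?thesis by (simp add: euclidean_representation)
      qed
      have "p y * g y * coordinate_monomial bs y =
          (\<Sum>b\<in>Basis. p b * (g y * coordinate_monomial (b # bs) y))" for y
        unfolding arg_cong[OF pe[of y], of "\<lambda>v. v * g y * coordinate_monomial bs y"] sum_distrib_right
        by (rule sum.cong) (simp_all add: coordinate_monomial_def)
      moreover have "good (\<lambda>y. \<Sum>b\<in>Basis. p b * (g y * coordinate_monomial (b # bs) y))"
        using g bs by (intro good_sum good_scale) auto
      ultimately show "good (\<lambda>y. p y * g y * coordinate_monomial bs y)" by simp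
    qed
  next
    case (const c)
    then show ?case unfolding multiplier_def using good_scale by (simp add: mult.assoc)
  next
    case (add p q)
    show ?case
      unfolding multiplier_def
    proof (intro allI impI)
      fix g bs assume g: "\<forall>bs. set bs \<subseteq> Basis \<longrightarrow> good (\<lambda>y. g y * coordinate_monomial bs y)" and bs: "set bs \<subseteq> (Basis :: 'a set)"
      have "good (\<lambda>y. p y * g y * coordinate_monomial bs y + q y * g y * coordinate_monomial bs y)"
        using add.IH g bs unfolding multiplier_def by (intro good_add) blast+
      then show "good (\<lambda>y. (p y + q y) * g y * coordinate_monomial bs y)" by (simp add: algebra_simps)
    qed
  next
    case (mult p q)
    show ?case
      unfolding multiplier_def
    proof (intro allI impI)
      fix g bs assume g: "\<forall>bs. set bs \<subseteq> Basis \<longrightarrow> good (\<lambda>y. g y * coordinate_monomial bs y)" and bs: "set bs \<subseteq> (Basis :: 'a set)"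
      have "\<forall>bs. set bs \<subseteq> Basis \<longrightarrow> good (\<lambda>y. q y * g y * coordinate_monomial bs y)"
        using mult.IH(2) g unfolding multiplier_def by blast
      then have "good (\<lambda>y. p y * (q y * g y) * coordinate_monomial bs y)"
        using mult.IH(1)[unfolded multiplier_def, rule_format, of "\<lambda>y. q y * g y"] bs by blast
      then show "good (\<lambda>y. (p y * q y) * g y * coordinate_monomial bs y)" by (simp add: mult.assoc)
    qed
  qed
  moreover have "good (\<lambda>y. 1 * coordinate_monomial bs y)" if "set bs \<subseteq> Basis" for bs
    using mono[OF that] coordinate_monomial_continuous unfolding good_def by simp
  ultimately have poly: "good p" if "real_polynomial_function p" for p
    using that unfolding multiplier_def
    by (drule_tac x=p in meta_spec) (auto dest!: spec[of _ "\<lambda>_. 1"] spec[of _ "[]"] simp: coordinate_monomial_def)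
  show ?thesis
  proof (rule LIMSEQ_I)
    fix e :: real assume e: "e > 0"
    obtain p where p: "real_polynomial_function p" "\<And>y. y \<in> Y \<Longrightarrow> \<bar>\<phi> y - p y\<bar> < e / 3"
      using Stone_Weierstrass_real_polynomial_function[OF compact_Y \<phi>, of "e / 3"] e by auto
    have pc: "continuous_on Y p" using poly[OF p(1)] by (simp add: good_def)
    have "(\<lambda>n. \<integral>q. p (fst q) \<partial>\<gamma>n n) \<longlonglongrightarrow> (\<integral>q. p (fst q) \<partial>\<gamma>)" using poly[OF p(1)] by (simp add: good_def)
    then obtain N where N: "\<And>n. n \<ge> N \<Longrightarrow> \<bar>(\<integral>q. p (fst q) \<partial>\<gamma>n n) - (\<integral>q. p (fst q) \<partial>\<gamma>)\<bar> < e / 3"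
      using LIMSEQ_D[of "\<lambda>n. \<integral>q. p (fst q) \<partial>\<gamma>n n" "\<integral>q. p (fst q) \<partial>\<gamma>" "e / 3"] e by auto
    have close: "\<bar>(\<integral>q. \<phi> (fst q) \<partial>\<mu>) - (\<integral>q. p (fst q) \<partial>\<mu>)\<bar> \<le> e / 3" if \<mu>: "\<mu> \<in> prob_measures_on (Y \<times> U)" for \<mu>
    proof -
      have "(\<integral>q. \<phi> (fst q) \<partial>\<mu>) - (\<integral>q. p (fst q) \<partial>\<mu>) = (\<integral>q. \<phi> (fst q) - p (fst q) \<partial>\<mu>)"
        using continuous_wrt_prob_measure_on(2)[OF \<mu> fc[OF \<phi>]] continuous_wrt_prob_measure_on(2)[OF \<mu> fc[OF pc]] by simp
      also have "\<bar>\<dots>\<bar> \<le> e / 3"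
        by (rule prob_integral_bound[OF \<mu>]) (use fc[OF \<phi>] fc[OF pc] p(2) in \<open>auto intro!: continuous_intros less_imp_le\<close>)
      finally show ?thesis .
    qed
    show "\<exists>N. \<forall>n\<ge>N. norm ((\<integral>p. \<phi> (fst p) \<partial>\<gamma>n n) - (\<integral>p. \<phi> (fst p) \<partial>\<gamma>)) < e"
    proof (intro exI[of _ N] allI impI)
      fix n assume "n \<ge> N"
      then show "norm ((\<integral>p. \<phi> (fst p) \<partial>\<gamma>n n) - (\<integral>p. \<phi> (fst p) \<partial>\<gamma>)) < e"
        using close[OF \<gamma>n[of n]] close[OF \<gamma>] N[of n] unfolding real_norm_def by linarith
    qed
  qed
qed

text \<open>Apart from membership in \<open>W\<close>, the definition of \<open>W2\<close> sees \<open>\<gamma>\<close> only through integrals of functions of the state. To approximate \<open>\<gamma>\<close> by a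
sequence in \<open>W1\<close> for all of these at once, it is enough to approximate the integrals of the first \<open>l\<close> monomials up to
\<open>1 / (l + 1)\<close>, for each \<open>l\<close>.\<close>

theorem W2_eq_W_concentrated:
  assumes y0: "y0 \<in> A" shows "W2 f U Y y0 = W_concentrated"
proof
  show "W2 f U Y y0 \<subseteq> W_concentrated" by (rule W2_subset_W_concentrated[OF y0])
  show "W_concentrated \<subseteq> W2 f U Y y0"
  proof
    fix \<gamma> assume \<gamma>: "\<gamma> \<in> W_concentrated"
    have W: "\<gamma> \<in> W f U Y" and P: "\<gamma> \<in> prob_measures_on (Y \<times> U)"
      using \<gamma> W_prob by (auto simp: W_concentrated_def)
    define B where "B = from_nat_into (lists (Basis :: 'a set))"
    have cB: "countable (lists (Basis :: 'a set))" by (intro countable_lists countable_finite) simp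
    have B: "\<exists>i. B i = bs" if "set bs \<subseteq> Basis" for bs
      unfolding B_def using from_nat_into_surj[OF cB, of bs] that by (auto simp: lists_eq_set)
    define q where "q i p = coordinate_monomial (B i) (fst p)" for i and p :: "'a \<times> 'u"
    have qc: "continuous_on (Y \<times> U) (q i)" for i
      unfolding q_def[abs_def]
      by (rule continuous_on_compose2[OF coordinate_monomial_continuous[of UNIV]]) (auto intro!: continuous_intros)
    have "\<exists>\<gamma>'\<in>W1 f U Y y0. \<forall>i<l. \<bar>(\<integral>x. q i x \<partial>\<gamma>') - (\<integral>x. q i x \<partial>\<gamma>)\<bar> < inverse (real (Suc l))" for l
      by (rule W1_approximates[OF \<gamma> y0 qc]) simp
    then obtain \<gamma>n where \<gamma>n: "\<And>l. \<gamma>n l \<in> W1 f U Y y0"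
      "\<And>l i. i < l \<Longrightarrow> \<bar>(\<integral>x. q i x \<partial>\<gamma>n l) - (\<integral>x. q i x \<partial>\<gamma>)\<bar> < inverse (real (Suc l))" by metis
    have Pn: "\<gamma>n l \<in> prob_measures_on (Y \<times> U)" for l using \<gamma>n(1)[of l] W_prob by (auto simp: W1_def)
    have lim_q: "(\<lambda>l. \<integral>x. q i x \<partial>\<gamma>n l) \<longlonglongrightarrow> (\<integral>x. q i x \<partial>\<gamma>)" for i
    proof (rule LIM_zero_cancel)
      show "(\<lambda>l. (\<integral>x. q i x \<partial>\<gamma>n l) - (\<integral>x. q i x \<partial>\<gamma>)) \<longlonglongrightarrow> 0"
      proof (rule Lim_null_comparison[OF _ LIMSEQ_inverse_real_of_nat])
        show "\<forall>\<^sub>F l in sequentially. norm ((\<integral>x. q i x \<partial>\<gamma>n l) - (\<integral>x. q i x \<partial>\<gamma>)) \<le> inverse (real (Suc l))"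
          using eventually_gt_at_top[of i] by eventually_elim (use \<gamma>n(2) in \<open>auto intro: less_imp_le\<close>)
      qed
    qed
    have lim: "(\<lambda>l. \<integral>p. \<phi> (fst p) \<partial>\<gamma>n l) \<longlonglongrightarrow> (\<integral>p. \<phi> (fst p) \<partial>\<gamma>)" if "continuous_on Y \<phi>" for \<phi> :: "'a \<Rightarrow> real"
    proof (rule integral_tendsto_if_monomials_tendsto[of \<gamma>n \<gamma> \<phi>, OF Pn P _ that])
      fix bs :: "'a list" assume "set bs \<subseteq> Basis"
      then obtain i where "B i = bs" using B by blast
      then show "(\<lambda>n. \<integral>p. coordinate_monomial bs (fst p) \<partial>\<gamma>n n) \<longlonglongrightarrow> (\<integral>p. coordinate_monomial bs (fst p) \<partial>\<gamma>)"
        using lim_q[of i] by (simp add: q_def)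
    qed
    have "\<forall>l. \<exists>\<xi>. \<xi> \<in> finite_measures_on (Y \<times> U) \<and> (\<forall>\<phi>\<in>C1. (\<integral>(y, u). \<phi> y - \<phi> y0 \<partial>\<gamma>n l) = (\<integral>(y, u). grad \<phi> y \<bullet> f y u \<partial>\<xi>))"
      using \<gamma>n(1) unfolding W1_def by blast
    from choice[OF this] obtain \<xi> where \<xi>: "\<And>l. \<xi> l \<in> finite_measures_on (Y \<times> U)"
      "\<And>l \<phi>. \<phi> \<in> C1 \<Longrightarrow> (\<integral>(y, u). \<phi> y - \<phi> y0 \<partial>\<gamma>n l) = (\<integral>(y, u). grad \<phi> y \<bullet> f y u \<partial>\<xi> l)" by blast
    have "(\<lambda>l. \<integral>(y, u). grad \<phi> y \<bullet> f y u \<partial>\<xi> l) \<longlonglongrightarrow> (\<integral>(y, u). \<phi> y - \<phi> y0 \<partial>\<gamma>)" if \<phi>: "\<phi> \<in> C1" for \<phi>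
    proof -
      have "continuous_on Y (\<lambda>y. \<phi> y - \<phi> y0)" by (intro continuous_intros C1_continuous[OF \<phi>])
      from lim[OF this] show ?thesis using \<xi>(2)[OF \<phi>] by (simp add: case_prod_unfold)
    qed
    then show "\<gamma> \<in> W2 f U Y y0" unfolding W2_def using W \<xi>(1) by blast
  qed
qed

text \<open>A weak-star limit of a minimising sequence; all conditions that define \<open>W_concentrated\<close> are integrals of
continuous functions and pass to the limit.\<close>

lemma W_concentrated_minimizer:
  fixes q :: "'a \<times> 'u \<Rightarrow> real"
  assumes q: "continuous_on (Y \<times> U) q"
    and approx: "\<And>e. e > 0 \<Longrightarrow> \<exists>\<gamma>\<in>W_concentrated. (\<integral>x. q x \<partial>\<gamma>) \<le> c + e"
  shows "\<exists>\<gamma>\<in>W_concentrated. (\<integral>x. q x \<partial>\<gamma>) \<le> c"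
proof -
  have "\<exists>\<gamma>\<in>W_concentrated. (\<integral>x. q x \<partial>\<gamma>) \<le> c + inverse (real (Suc n))" for n
    by (rule approx) simp
  then obtain \<gamma> where \<gamma>: "\<And>n. \<gamma> n \<in> W_concentrated" "\<And>n. (\<integral>x. q x \<partial>\<gamma> n) \<le> c + inverse (real (Suc n))" by metis
  have P: "\<gamma> n \<in> prob_measures_on (Y \<times> U)" for n using \<gamma>(1) by (simp add: W_concentrated_eq)
  obtain r \<mu> where r: "strict_mono (r :: nat \<Rightarrow> nat)" and \<mu>: "\<mu> \<in> prob_measures_on (Y \<times> U)"
    and lim: "\<And>q :: 'a \<times> 'u \<Rightarrow> real. continuous_on (Y \<times> U) q \<Longrightarrow> (\<lambda>n. \<integral>x. q x \<partial>\<gamma> (r n)) \<longlonglongrightarrow> (\<integral>x. q x \<partial>\<mu>)"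
    using prob_measures_sequentially_compact[where \<gamma>=\<gamma>, OF compact_YU P] by blast
  have zero: "(\<integral>x. g x \<partial>\<mu>) = 0" if "continuous_on (Y \<times> U) g" "\<And>n. (\<integral>x. g x \<partial>\<gamma> n) = 0" for g :: "'a \<times> 'u \<Rightarrow> real"
    using lim[OF that(1)] that(2) by (simp add: LIMSEQ_const_iff)
  have "\<mu> \<in> W_concentrated"
    unfolding W_concentrated_eq using \<mu> zero[OF G_continuous] zero[OF grad_dot_f_continuous] \<gamma>(1)
    by (auto simp: W_concentrated_eq)
  moreover have "(\<integral>x. q x \<partial>\<mu>) \<le> c"
  proof (rule LIMSEQ_le[OF lim[OF q]])
    have "(\<lambda>n. c + inverse (real (Suc (r n)))) \<longlonglongrightarrow> c + 0"
      by (intro tendsto_intros LIMSEQ_subseq_LIMSEQ[OF LIMSEQ_inverse_real_of_nat r, unfolded o_def])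
    then show "(\<lambda>n. c + inverse (real (Suc (r n)))) \<longlonglongrightarrow> c" by simp
  qed (use \<gamma>(2) in auto)
  ultimately show ?thesis by blast
qed

end


section \<open>Equality of the optimal values\<close>

context invariant_level
begin

lemma level_cost_eq:
  assumes A: "A = level_set F z" and \<gamma>: "\<gamma> \<in> W_concentrated" and k: "continuous_on (Y \<times> U) (\<lambda>(y, u). k y u)"
  shows "level_cost k U F z \<gamma> = (\<integral>(y, u). k y u \<partial>\<gamma>)"
proof -
  have P: "\<gamma> \<in> prob_measures_on (Y \<times> U)" and AE: "AE p in \<gamma>. fst p \<in> A"
    using \<gamma> W_prob by (auto simp: W_concentrated_def)
  note qf = continuous_wrt_prob_measure_on[OF P k]
  have "A \<times> U \<in> sets \<gamma>"
  proof -
    have "sets \<gamma> = sets (restrict_space borel (Y \<times> U))" using P by (simp add: prob_measures_on_def)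
    moreover have "A \<times> U = (Y \<times> U) \<inter> (A \<times> U)" using A_subset by auto
    moreover have "A \<times> U \<in> sets borel" using compact_imp_closed[OF compact_AU] by simp
    ultimately show ?thesis unfolding sets_restrict_space by blast
  qed
  then have m: "(\<lambda>p. indicator (A \<times> U) p *\<^sub>R k (fst p) (snd p)) \<in> borel_measurable \<gamma>"
    using qf(1) by (intro borel_measurable_scaleR borel_measurable_indicator) (auto simp: case_prod_unfold)
  show ?thesis
    unfolding level_cost_def set_lebesgue_integral_def A[symmetric] case_prod_unfold
  proof (rule integral_cong_AE[OF m])
    show "AE p in \<gamma>. indicator (A \<times> U) p *\<^sub>R k (fst p) (snd p) = k (fst p) (snd p)"
      using AE AE_space by eventually_elim (use qf(3) in \<open>auto simp: mem_Times_iff\<close>)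
  qed (use qf(1) in \<open>simp add: case_prod_unfold\<close>)
qed

lemma admissible_eq:
  assumes "y0 \<in> A" shows "admissible f U Y T y0 = {(u, y). control U u \<and> solves f u y0 y}"
  using stays_in_A[OF assms] A_subset by (fastforce simp: admissible_def)

text \<open>Where \<open>q \<le> 0\<close>, a compact set disjoint from \<open>A \<times> U\<close>, the function \<open>G\<close> has a positive minimum, so a large multiple of it
outweighs \<open>q\<close>.\<close>

lemma penalty_extends_dual_bound:
  fixes q :: "'a \<times> 'u \<Rightarrow> real"
  assumes q: "continuous_on (Y \<times> U) q" and pos: "\<And>y u. y \<in> A \<Longrightarrow> u \<in> U \<Longrightarrow> 0 < q (y, u)"
  shows "\<exists>C. \<forall>y\<in>Y. \<forall>u\<in>U. 0 \<le> q (y, u) + C * G y"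
proof -
  define K where "K = {p \<in> Y \<times> U. q p \<le> 0}"
  have "closedin (top_of_set (Y \<times> U)) ((Y \<times> U) \<inter> q -` {..0})"
    by (rule continuous_closedin_preimage[OF q]) simp
  also have "(Y \<times> U) \<inter> q -` {..0} = K" by (auto simp: K_def)
  finally have K: "compact K" using compact_YU closedin_compact by blast
  obtain M where M: "M \<ge> 0" "\<And>x. x \<in> Y \<times> U \<Longrightarrow> \<bar>q x\<bar> \<le> M" using bound_YU[OF q] by blast
  have Gc: "continuous_on K (\<lambda>p. G (fst p))"
    by (rule continuous_on_subset[OF G_continuous]) (auto simp: K_def)
  obtain m where m: "m > 0" "\<And>p. p \<in> K \<Longrightarrow> m \<le> G (fst p)"
  proof (cases "K = {}")
    case True then show ?thesis using that[of 1] by simp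
  next
    case False
    obtain p where p: "p \<in> K" "\<And>p'. p' \<in> K \<Longrightarrow> G (fst p) \<le> G (fst p')"
      using continuous_attains_inf[OF K False Gc] by blast
    have "fst p \<notin> A" using pos[of "fst p" "snd p"] p(1) by (auto simp: K_def)
    then have "G (fst p) > 0"
      using G_eq_0[of "fst p"] G_nonneg[of "fst p"] p(1) by (auto simp: K_def order_less_le)
    then show ?thesis using that p(2) by blast
  qed
  have "0 \<le> q (y, u) + M / m * G y" if "y \<in> Y" "u \<in> U" for y u
  proof (cases "q (y, u) \<le> 0")
    case True
    then have "m \<le> G y" using m(2)[of "(y, u)"] that by (auto simp: K_def)
    then have "M / m * m \<le> M / m * G y" using M m by (intro mult_left_mono) auto
    then show ?thesis using m M(2)[of "(y, u)"] that by (simp add: abs_le_iff)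
  next
    case False
    moreover have "0 \<le> M / m * G y" using M m G_nonneg by simp
    ultimately show ?thesis by linarith
  qed
  then show ?thesis by blast
qed

text \<open>All values are compared with \<open>c\<close>, the infimum over \<open>W1\<close>. The dual value is at most \<open>c\<close> by integration, and at least \<open>c - e\<close> by the triplet
\<open>(c - e, - C * G, \<eta>)\<close>. The minimal cost \<open>a T\<close> on \<open>[0, T]\<close> satisfies \<open>c * T - O(1) \<le> a T\<close> by closing
trajectories, and \<open>a T - O(1) \<le> c * T\<close> because it yields subsolutions, which can be integrated against
members of \<open>W1\<close>.\<close>

theorem optimal_values:
  fixes k :: "'a \<Rightarrow> 'u \<Rightarrow> real"
  assumes A: "A = level_set F z" and y0: "y0 \<in> A" and k: "continuous_on (Y \<times> U) (\<lambda>(y, u). k y u)"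
  shows "\<exists>c. (value_T f k U Y y0 \<longlongrightarrow> ereal c) at_top \<and> k_star f k U Y y0 = ereal c \<and>
    d_star f k U Y y0 = ereal c \<and> k_level f k U Y F z = ereal c \<and>
    (\<exists>\<gamma>\<in>W_level f U Y F z. level_cost k U F z \<gamma> = c)"
proof -
  let ?q = "\<lambda>(y, u). k y u"
  define c where "c = (INF \<gamma>\<in>W1 f U Y y0. \<integral>x. ?q x \<partial>\<gamma>)"
  obtain M where M: "M \<ge> 0" "\<And>x. x \<in> Y \<times> U \<Longrightarrow> \<bar>?q x\<bar> \<le> M" using bound_YU[OF k] by blast
  have MA: "\<bar>?q x\<bar> \<le> M" if "x \<in> A \<times> U" for x
    using M(2)[of x] that A_subset by auto
  have W1P: "\<gamma> \<in> prob_measures_on (Y \<times> U)" if "\<gamma> \<in> W1 f U Y y0" for \<gamma>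
    using that W_prob by (auto simp: W1_def)
  have lb: "- M \<le> (\<integral>x. ?q x \<partial>\<gamma>)" if "\<gamma> \<in> W1 f U Y y0" for \<gamma>
    using prob_integral_bound[OF W1P[OF that] k M(2)] by (simp add: abs_le_iff)
  have inf: "\<gamma> \<in> W1 f U Y y0 \<Longrightarrow> c \<le> (\<integral>x. ?q x \<partial>\<gamma>)"
    "e > 0 \<Longrightarrow> \<exists>\<gamma>\<in>W1 f U Y y0. (\<integral>x. ?q x \<partial>\<gamma>) < c + e" for \<gamma> e
    unfolding c_def
    using real_INF_approx[of "W1 f U Y y0" "- M" "\<lambda>\<gamma>. \<integral>x. ?q x \<partial>\<gamma>", OF W1_nonempty[OF y0] lb] by blast+
  have near: "\<exists>\<gamma>\<in>W1 f U Y y0. (\<integral>x. ?q x \<partial>\<gamma>) \<le> c + e" if "e > 0" for e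
    using inf(2)[OF that] less_imp_le by blast
  have W1_conc: "W1 f U Y y0 \<subseteq> W_concentrated" using W1_subset_W2 W2_subset_W_concentrated[OF y0] by blast
  have conc: "c \<le> (\<integral>x. ?q x \<partial>\<gamma>)" if "\<gamma> \<in> W_concentrated" for \<gamma>
    by (rule W_concentrated_bound[OF that k y0 inf(1)])
  have star: "k_star f k U Y y0 = ereal c"
    unfolding k_star_def by (rule INF_ereal_eqI[OF inf(1) near])
  have cost: "level_cost k U F z \<gamma> = (\<integral>x. ?q x \<partial>\<gamma>)" if "\<gamma> \<in> W_concentrated" for \<gamma>
    by (rule level_cost_eq[OF A that k])
  have level: "k_level f k U Y F z = ereal c"
    unfolding k_level_def W_level_eq_W_concentrated[OF A]
  proof (rule INF_ereal_eqI)
    fix e :: real assume "e > 0"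
    then obtain \<gamma> where "\<gamma> \<in> W1 f U Y y0" "(\<integral>x. ?q x \<partial>\<gamma>) \<le> c + e" using near by blast
    then show "\<exists>\<gamma>\<in>W_concentrated. level_cost k U F z \<gamma> \<le> c + e" using W1_conc cost by force
  qed (use conc cost in simp)
  have minimum: "\<exists>\<gamma>\<in>W_level f U Y F z. level_cost k U F z \<gamma> = c"
  proof -
    have "\<exists>\<gamma>\<in>W_concentrated. (\<integral>x. ?q x \<partial>\<gamma>) \<le> c"
      by (rule W_concentrated_minimizer[OF k]) (use near W1_conc in blast)
    then show ?thesis unfolding W_level_eq_W_concentrated[OF A] using conc cost by force
  qed
  have dual: "d_star f k U Y y0 = ereal c"
  proof -
    let ?S = "{(\<mu>, \<psi>, \<eta>). \<psi> \<in> C1 \<and> \<eta> \<in> C1 \<and>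
         (\<forall>y\<in>Y. \<forall>u\<in>U. k y u + (\<psi> y0 - \<psi> y) + grad \<eta> y \<bullet> f y u - \<mu> \<ge> 0 \<and> grad \<psi> y \<bullet> f y u \<ge> 0)}"
    have "d_star f k U Y y0 = (SUP x\<in>?S. ereal (fst x))" by (simp add: d_star_def case_prod_unfold)
    also have "\<dots> = ereal c"
    proof (rule SUP_ereal_eqI)
      fix x :: "real \<times> ('a \<Rightarrow> real) \<times> ('a \<Rightarrow> real)" assume "x \<in> ?S"
      then obtain \<mu> \<psi> \<eta> where x: "x = (\<mu>, \<psi>, \<eta>)" and \<psi>: "\<psi> \<in> C1" and \<eta>: "\<eta> \<in> C1"
        and 1: "\<And>y u. y \<in> Y \<Longrightarrow> u \<in> U \<Longrightarrow> k y u + (\<psi> y0 - \<psi> y) + grad \<eta> y \<bullet> f y u - \<mu> \<ge> 0"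
        and 2: "\<And>y u. y \<in> Y \<Longrightarrow> u \<in> U \<Longrightarrow> grad \<psi> y \<bullet> f y u \<ge> 0" by auto
      have "\<mu> \<le> (\<integral>x. ?q x \<partial>\<gamma>)" if \<gamma>: "\<gamma> \<in> W1 f U Y y0" for \<gamma>
      proof -
        obtain \<xi> where \<xi>: "\<gamma> \<in> W f U Y" "\<xi> \<in> finite_measures_on (Y \<times> U)"
          "(\<integral>(y, u). \<psi> y - \<psi> y0 \<partial>\<gamma>) = (\<integral>(y, u). grad \<psi> y \<bullet> f y u \<partial>\<xi>)"
          using \<gamma> \<psi> unfolding W1_def by blast
        note P = W1P[OF \<gamma>]
        have "0 \<le> (\<integral>(y, u). grad \<psi> y \<bullet> f y u \<partial>\<xi>)"
          by (rule Bochner_Integration.integral_nonneg)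
            (use 2 continuous_wrt_finite_measure_on(4)[OF \<xi>(2) k] in auto)
        then have a: "0 \<le> (\<integral>(y, u). \<psi> y - \<psi> y0 \<partial>\<gamma>)" using \<xi>(3) by simp
        note i = continuous_wrt_prob_measure_on(2)[OF P k] continuous_wrt_prob_measure_on(2)[OF P C1_fst_continuous[OF \<psi>, of "\<psi> y0"]]
          continuous_wrt_prob_measure_on(2)[OF P grad_dot_f_continuous[OF \<eta>]]
        let ?r = "\<lambda>x. ?q x - (\<lambda>(y, u). \<psi> y - \<psi> y0) x + (\<lambda>(y, u). grad \<eta> y \<bullet> f y u) x"
        have "\<mu> = (\<integral>x. \<mu> \<partial>\<gamma>)" using prob_integral_const[OF P] by simp
        also have "\<dots> \<le> (\<integral>x. ?r x \<partial>\<gamma>)"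
        proof (rule integral_mono)
          show "integrable \<gamma> (\<lambda>x. \<mu>)" using continuous_wrt_prob_measure_on(2)[OF P, of "\<lambda>_. \<mu>"] by simp
          show "integrable \<gamma> ?r" using i by (intro Bochner_Integration.integrable_add Bochner_Integration.integrable_diff)
          fix x assume "x \<in> space \<gamma>"
          then obtain y u where "x = (y, u)" "y \<in> Y" "u \<in> U" using continuous_wrt_prob_measure_on(3)[OF P k] by auto
          then show "\<mu> \<le> ?r x" using 1[of y u] by simp
        qed
        also have "\<dots> = (\<integral>x. ?q x \<partial>\<gamma>) - (\<integral>(y, u). \<psi> y - \<psi> y0 \<partial>\<gamma>) + (\<integral>(y, u). grad \<eta> y \<bullet> f y u \<partial>\<gamma>)"
          by (simp only: Bochner_Integration.integral_diff[OF i(1,2)]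
              Bochner_Integration.integral_add[OF Bochner_Integration.integrable_diff[OF i(1,2)] i(3)])
        also have "\<dots> \<le> (\<integral>x. ?q x \<partial>\<gamma>)" using a W_integral_grad_eq_0[OF \<xi>(1) \<eta>] by simp
        finally show ?thesis .
      qed
      then show "fst x \<le> c" unfolding x c_def by (auto intro!: cINF_greatest[OF W1_nonempty[OF y0]])
    next
      fix e :: real assume e: "e > 0"
      obtain \<eta> where \<eta>: "\<eta> \<in> C1" "\<forall>y\<in>A. \<forall>u\<in>U. c - e / 2 \<le> ?q (y, u) + grad \<eta> y \<bullet> f y u"
        using dual_function_of_W1_bound[OF k y0 _ inf(1), of "e / 2"] e by auto
      let ?g = "\<lambda>x. ?q x + (\<lambda>(y, u). grad \<eta> y \<bullet> f y u) x - (c - e)"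
      obtain C where C: "\<forall>y\<in>Y. \<forall>u\<in>U. 0 \<le> ?g (y, u) + C * G y"
      proof -
        have gc: "continuous_on (Y \<times> U) ?g"
          by (intro continuous_on_diff continuous_on_add k grad_dot_f_continuous[OF \<eta>(1)] continuous_on_const)
        have "0 < ?g (y, u)" if "y \<in> A" "u \<in> U" for y u
          using \<eta>(2)[rule_format, OF that] e by simp
        from penalty_extends_dual_bound[OF gc this] show ?thesis using that by blast
      qed
      have Gy0: "G y0 = 0" using G_eq_0 y0 A_subset by auto
      note \<psi> = C1_scale[OF G_C1, of "- C"]
      have "(c - e, (\<lambda>y. - C * G y), \<eta>) \<in> ?S"
        using C \<eta>(1) \<psi>(1) by (auto simp: \<psi>(2)[unfolded mult_minus_left] \<psi>(2) Gy0 G_conserved algebra_simps)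
      then show "\<exists>x\<in>?S. c - e \<le> fst x" by (intro bexI[of _ "(c - e, (\<lambda>y. - C * G y), \<eta>)"]) auto
    qed
    finally show ?thesis .
  qed
  have lim: "(value_T f k U Y y0 \<longlongrightarrow> ereal c) at_top"
  proof -
    let ?S = "{(u, y). control U u \<and> solves f u y0 y}"
    define J where "J T p = integral {0..T} (\<lambda>t. ?q (snd p t, fst p t))" for T and p :: "(real \<Rightarrow> 'u) \<times> (real \<Rightarrow> 'a)"
    define a where "a T = (INF p\<in>?S. J T p)" for T
    obtain u y \<tau> where "control U u" "solves f u y0 y" by (rule steer[OF y0 y0])
    then have ne: "?S \<noteq> {}" by auto
    have Jb: "- (M * T) \<le> J T p" if "T > 0" "p \<in> ?S" for T p
      using cost_integral_le[OF k MA y0, of "fst p" "snd p" 0 T] that by (auto simp: J_def abs_le_iff)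
    have inf_a: "p \<in> ?S \<Longrightarrow> a T \<le> J T p" "e > 0 \<Longrightarrow> \<exists>p\<in>?S. J T p < a T + e" if "T > 0" for T p e
      unfolding a_def using real_INF_approx[of ?S "- (M * T)" "J T", OF ne Jb[OF that]] by blast+
    have value_eq: "value_T f k U Y y0 T = ereal (a T / T)" if T: "T > 0" for T
    proof -
      have "(INF (u, y)\<in>admissible f U Y T y0. ereal (LINT t:{0..T}|lebesgue. k (y t) (u t))) =
          (INF p\<in>?S. ereal (J T p))"
        unfolding admissible_eq[OF y0]
      proof (rule INF_cong[OF refl])
        fix p assume p: "p \<in> ?S"
        then have "(\<lambda>t. ?q (snd p t, fst p t)) absolutely_integrable_on {0..T}"
          by (intro cost_integrable[OF k y0]) auto
        then show "(case p of (u, y) \<Rightarrow> ereal (LINT t:{0..T}|lebesgue. k (y t) (u t))) = ereal (J T p)"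
          using set_lebesgue_integral_eq_integral(2) by (auto simp: J_def case_prod_unfold)
      qed
      also have "\<dots> = ereal (a T)"
        by (rule INF_ereal_eqI[OF inf_a(1)[OF T]]) (use inf_a(2)[OF T] less_imp_le in blast)+
      finally show ?thesis unfolding value_T_def by simp
    qed
    have low: "c - 2 * M * T0 / T \<le> a T / T" if T: "T > 0" for T
    proof -
      have "c * T - 2 * M * T0 \<le> a T"
        unfolding a_def
      proof (rule cINF_greatest[OF ne])
        fix p assume "p \<in> ?S"
        then show "c * T - 2 * M * T0 \<le> J T p"
          using W1_bound_le_cost[OF k MA y0 _ _ T inf(1), of "fst p" "snd p"] by (auto simp: J_def)
      qed
      then have "(c * T - 2 * M * T0) / T \<le> a T / T" using T by (simp add: divide_right_mono)
      then show ?thesis using T by (simp add: diff_divide_distrib)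
    qed
    have up: "a T / T \<le> c + 2 * M * T0 / T" if T: "T \<ge> T0" for T
    proof -
      have T': "T > 0" using T T0_pos by simp
      have "(a T - 2 * M * T0) / T \<le> c"
      proof (rule field_le_epsilon)
        fix d :: real assume d: "d > 0"
        obtain \<eta> where \<eta>: "\<eta> \<in> C1" "\<forall>y\<in>A. \<forall>u\<in>U. (a T - 2 * M * T0) / T - d \<le> ?q (y, u) + grad \<eta> y \<bullet> f y u"
        proof -
          have "a T \<le> integral {0..T} (\<lambda>t. ?q (y t, u t))" if "control U u" "solves f u y0 y" for u y
            using inf_a(1)[OF T', of "(u, y)"] that by (simp add: J_def)
          from dual_function_of_cost_bound[OF k MA y0 T d this] show ?thesis using that by blast
        qed
        have "(a T - 2 * M * T0) / T - d \<le> (\<integral>x. ?q x \<partial>\<gamma>)" if "\<gamma> \<in> W1 f U Y y0" for \<gamma>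
          by (rule dual_bound[OF _ k \<eta>(1)]) (use \<eta>(2) that W1_conc in auto)
        then have "(a T - 2 * M * T0) / T - d \<le> c"
          unfolding c_def by (intro cINF_greatest[OF W1_nonempty[OF y0]])
        then show "(a T - 2 * M * T0) / T \<le> c + d" by simp
      qed
      then show ?thesis by (simp add: diff_divide_distrib)
    qed
    have z: "((\<lambda>T. 2 * M * T0 / T) \<longlongrightarrow> 0) at_top"
      by (intro tendsto_divide_0[OF tendsto_const] filterlim_at_top_imp_at_infinity filterlim_ident)
    have "((\<lambda>T. a T / T) \<longlongrightarrow> c) at_top"
    proof (rule tendsto_sandwich)
      show "\<forall>\<^sub>F T in at_top. c - 2 * M * T0 / T \<le> a T / T"
        using eventually_gt_at_top[of 0] by eventually_elim (rule low)
      show "\<forall>\<^sub>F T in at_top. a T / T \<le> c + 2 * M * T0 / T"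
        using eventually_ge_at_top[of T0] by eventually_elim (rule up)
      show "((\<lambda>T. c - 2 * M * T0 / T) \<longlongrightarrow> c) at_top" using tendsto_diff[OF tendsto_const z, of c] by simp
      show "((\<lambda>T. c + 2 * M * T0 / T) \<longlongrightarrow> c) at_top" using tendsto_add[OF tendsto_const z, of c] by simp
    qed
    then have "((\<lambda>T. ereal (a T / T)) \<longlongrightarrow> ereal c) at_top" by (rule tendsto_ereal)
    then show ?thesis
    proof (rule Lim_transform_eventually)
      show "\<forall>\<^sub>F T in at_top. ereal (a T / T) = value_T f k U Y y0 T"
        using eventually_gt_at_top[of 0] by eventually_elim (simp add: value_eq)
    qed
  qed
  show ?thesis using lim star dual level minimum by blast
qed

end

theorem proposition4p1:
  fixes U :: "'u::metric_space set"
    and f :: "real ^ 'm \<Rightarrow> 'u \<Rightarrow> real ^ 'm"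
    and k :: "real ^ 'm \<Rightarrow> 'u \<Rightarrow> real"
    and F :: "real ^ 'm \<Rightarrow> real ^ 'k"
    and Z :: "(real ^ 'k) set"
    and Y Yhat :: "(real ^ 'm) set"
  assumes U_compact: "compact U"
    and f_cont: "continuous_on (UNIV \<times> U) (\<lambda>(y, u). f y u)"
    and f_lipschitz: "\<exists>L. \<forall>u\<in>U. L-lipschitz_on UNIV (\<lambda>y. f y u)"
    and k_cont: "continuous_on (UNIV \<times> U) (\<lambda>(y, u). k y u)"
    and Z_compact: "compact Z"
    and Y_def: "Y = (\<Union>z\<in>Z. level_set F z)"
    and Y_compact: "compact Y"
    and Y_regular: "closure (interior Y) = Y"
    and Yhat_compact: "compact Yhat"
    and Y_Yhat: "Y \<subseteq> Yhat"
    and invariant: "\<forall>z\<in>Z. forward_invariant f U (level_set F z)"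
    and F_C1: "\<forall>i. (\<lambda>y. F y $ i) \<in> C1"
    and III: "\<forall>i. \<forall>y\<in>Yhat. \<forall>u\<in>U. grad (\<lambda>x. F x $ i) y \<bullet> f y u = 0"
    and IV: "\<exists>T0>0. \<forall>z\<in>Z. \<forall>y1\<in>level_set F z. \<forall>y2\<in>level_set F z. steers_within f U T0 y1 y2"
  shows "\<forall>z\<in>Z. \<forall>y0\<in>level_set F z.
           (value_T f k U Y y0 \<longlongrightarrow> k_star f k U Y y0) at_top \<and>
           k_star f k U Y y0 = d_star f k U Y y0 \<and>
           d_star f k U Y y0 = k_level f k U Y F z \<and>
           (\<exists>\<gamma>\<in>W_level f U Y F z. ereal (level_cost k U F z \<gamma>) = k_level f k U Y F z) \<and>
           weak_star_topology (Y \<times> U) closure_of W1 f U Y y0 = W2 f U Y y0 \<and>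
           W2 f U Y y0 = W_level f U Y F z"
proof (intro ballI)
  fix z y0 assume z: "z \<in> Z" and y0: "y0 \<in> level_set F z"
  obtain T0 where T0: "T0 > 0"
    "\<And>y1 y2. y1 \<in> level_set F z \<Longrightarrow> y2 \<in> level_set F z \<Longrightarrow> steers_within f U T0 y1 y2"
    using IV z by blast
  obtain L0 where L0: "\<And>u. u \<in> U \<Longrightarrow> L0-lipschitz_on UNIV (\<lambda>y. f y u)" using f_lipschitz by blast
  \<comment> \<open>the locale asks for a positive Lipschitz constant\<close>
  define L where "L = max L0 1"
  have lip: "norm (f y u - f y' u) \<le> L * norm (y - y')" if "u \<in> U" for u y y'
  proof -
    have "norm (f y u - f y' u) \<le> L0 * norm (y - y')"
      using lipschitz_onD[OF L0[OF that], of y y'] by (simp add: dist_norm)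
    also have "\<dots> \<le> L * norm (y - y')" by (intro mult_right_mono) (auto simp: L_def)
    finally show ?thesis .
  qed
  have F_continuous: "continuous_on S F" for S
  proof -
    have "continuous_on S (\<lambda>y. \<chi> i. F y $ i)"
      using F_C1 by (intro continuous_on_vec_lambda C1_continuous) auto
    then show ?thesis by simp
  qed
  define G where "G y = (\<Sum>i\<in>UNIV. (F y $ i - z $ i)\<^sup>2)" for y
  have G_zero: "G y = 0 \<longleftrightarrow> y \<in> level_set F z" for y
    by (simp add: G_def level_set_def sum_nonneg_eq_0_iff vec_eq_iff)
  have A_Y: "level_set F z \<subseteq> Y" using z Y_def by blast
  interpret invariant_level U f L Y "level_set F z" T0 G
  proof
    have "level_set F z = Y \<inter> F -` {z}" using A_Y by (auto simp: level_set_def)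
    moreover have "closedin (top_of_set Y) (Y \<inter> F -` {z})"
      by (rule continuous_closedin_preimage[OF F_continuous]) simp
    ultimately show "compact (level_set F z)" using closedin_compact[OF Y_compact] by simp
    show "grad G y \<bullet> f y u = 0" if "y \<in> Y" "u \<in> U" for y u
      using III Y_Yhat that unfolding G_def[abs_def] C1_dist_square(2)[OF F_C1]
      by (auto simp: inner_sum_left intro!: sum.neutral)
    show "G \<in> C1" unfolding G_def[abs_def] by (rule C1_dist_square(1)[OF F_C1])
  qed (use U_compact f_cont lip Y_compact A_Y invariant z T0 G_zero in \<open>auto simp: L_def G_def sum_nonneg\<close>)
  have "continuous_on (Y \<times> U) (\<lambda>(y, u). k y u)"
    by (rule continuous_on_subset[OF k_cont]) auto
  from optimal_values[OF refl y0 this] obtain c where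
    "(value_T f k U Y y0 \<longlongrightarrow> ereal c) at_top" "k_star f k U Y y0 = ereal c"
    "d_star f k U Y y0 = ereal c" "k_level f k U Y F z = ereal c"
    "\<exists>\<gamma>\<in>W_level f U Y F z. level_cost k U F z \<gamma> = c" by blast
  then show "(value_T f k U Y y0 \<longlongrightarrow> k_star f k U Y y0) at_top \<and>
           k_star f k U Y y0 = d_star f k U Y y0 \<and>
           d_star f k U Y y0 = k_level f k U Y F z \<and>
           (\<exists>\<gamma>\<in>W_level f U Y F z. ereal (level_cost k U F z \<gamma>) = k_level f k U Y F z) \<and>
           weak_star_topology (Y \<times> U) closure_of W1 f U Y y0 = W2 f U Y y0 \<and>
           W2 f U Y y0 = W_level f U Y F z"
    using closure_of_W1[OF y0] W2_eq_W_concentrated[OF y0] W_level_eq_W_concentrated[OF refl] by auto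
qed

end
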